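(* Fix $\alpha<2$, $p>0$, and let $\mu=TS^p_\alpha(R,b)$ be a $p$-tempered $\alpha$-stable distribution on $\mathbb R^d$ with Rosi\'nski measure $R$ and shift $b$. 1. If $q\in(0,1]$ with $q<p$, then for any $\theta>0$ $$\int_{\mathbb R^d}e^{\theta|x|^q}\mu(dx)<\infty$$ whenever $$\int_{|x|>1}e^{A_{p,q}(\theta|x|^q)^{p/(p-q)}}\,|x|^{-\alpha q/(p-q)}\,R(dx)<\infty,$$ where $A_{p,q}=(q/p)^{q/(p-q)}(1-q/p)$. 2. If $R\ne0$ then $\int_{\mathbb R^d}e^{\theta|x|\log|x|}\mu(dx)=\infty$ for every $\theta>0$.
   Context: $ID(0,M,b)$ is the infinitely divisible distribution on $\mathbb R^d$ with no Gaussian part, L\'evy measure $M$, and characteristic function $\exp\left\{i\langle b,z\rangle+\int_{\mathbb R^d}\left(e^{i\langle z,x\rangle}-1-i\frac{\langle z,x\rangle}{1+|x|^2}\right)M(dx)\right\}$. For $\alpha<2$, $p>0$, $TS^p_\alpha(R,b)$ denotes the $p$-tempered $\alpha$-stable distribution with Rosi\'nski measure $R$ and shift $b\in\mathbb R^d$, i.e. $ID(0,M,b)$ with $$M(A)=\int_{\mathbb R^d}\int_0^\infty1_A(tx)\,t^{-1-\alpha}e^{-t^p}\,dt\,R(dx),\qquad A\in\mathfrak B(\mathbb R^d),$$ where $R$ is a Borel measure on $\mathbb R^d$ with $R(\{0\})=0$ and $\int(|x|^2\wedge|x|^\alpha)R(dx)<\infty$ if $\alpha\in(0,2)$, $\int(|x|^2\wedge[1+\log^+|x|])R(dx)<\infty$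 if $\alpha=0$, $\int(|x|^2\wedge1)R(dx)<\infty$ if $\alpha<0$. (These are exactly the conditions under which $M$ is a L\'evy measure when $R\ne 0$, and $M$ determines $R$.) The convention $0\log0=0$ is used. *)

theory Defs
  imports "HOL-Probability.Probability"
begin

definition char_fun :: "'a::euclidean_space measure \<Rightarrow> 'a \<Rightarrow> complex" where
  "char_fun \<mu> z = (CLINT x|\<mu>. iexp (z \<bullet> x))"

definition levy_measure :: "'a::euclidean_space measure \<Rightarrow> bool" where
  "levy_measure M \<longleftrightarrow>
     sets M = sets borel \<and> emeasure M {0} = 0 \<and>
     (\<integral>\<^sup>+x. ennreal (min ((norm x)\<^sup>2) 1) \<partial>M) < \<infinity>"

text \<open>
  \<open>is_ID M b \<mu>\<close> says that \<open>\<mu>\<close> is the infinitely divisible distribution \<open>ID(0, M, b)\<close>: the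
  probability measure with Levy triplet \<open>(0, M, b)\<close>, relative to the centering function
  \<open>x / (1 + |x|^2)\<close>. The characteristic function determines \<open>\<mu>\<close>, and its Levy-Khintchine
  form makes \<open>\<mu>\<close> infinitely divisible.
\<close>

definition is_ID :: "'a::euclidean_space measure \<Rightarrow> 'a \<Rightarrow> 'a measure \<Rightarrow> bool" where
  "is_ID M b \<mu> \<longleftrightarrow>
     levy_measure M \<and> prob_space \<mu> \<and> sets \<mu> = sets borel \<and>
     (\<forall>z. char_fun \<mu> z =
        exp (\<i> * complex_of_real (b \<bullet> z) +
             (CLINT x|M. iexp (z \<bullet> x) - 1
                - \<i> * complex_of_real ((z \<bullet> x) / (1 + (norm x)\<^sup>2)))))"

text \<open>The weight against which a Rosinski measure has to be integrable, as a function of \<open>|x|\<close>;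
  \<open>max 0 (ln r)\<close> is \<open>log\<^sup>+ r\<close>.\<close>

definition rosinski_weight :: "real \<Rightarrow> real \<Rightarrow> real" where
  "rosinski_weight \<alpha> r =
     (if \<alpha> > 0 then min (r\<^sup>2) (r powr \<alpha>)
      else if \<alpha> = 0 then min (r\<^sup>2) (1 + max 0 (ln r))
      else min (r\<^sup>2) 1)"

definition rosinski_measure :: "real \<Rightarrow> 'a::euclidean_space measure \<Rightarrow> bool" where
  "rosinski_measure \<alpha> R \<longleftrightarrow>
     sets R = sets borel \<and> emeasure R {0} = 0 \<and>
     (\<integral>\<^sup>+x. ennreal (rosinski_weight \<alpha> (norm x)) \<partial>R) < \<infinity>"

definition TS_levy_measure ::
    "real \<Rightarrow> real \<Rightarrow> 'a::euclidean_space measure \<Rightarrow> 'a measure" where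
  "TS_levy_measure p \<alpha> R = measure_of UNIV (sets borel)
     (\<lambda>A. \<integral>\<^sup>+x. (\<integral>\<^sup>+t\<in>{0<..}.
        (indicator A (t *\<^sub>R x) * ennreal (t powr (- 1 - \<alpha>) * exp (- (t powr p)))) \<partial>lborel) \<partial>R)"

text \<open>The set function above is a measure, so \<^const>\<open>measure_of\<close> does not fall back to the zero
  measure.\<close>

lemma sets_TS_levy_measure [simp, measurable_cong]:
  "sets (TS_levy_measure p \<alpha> R) = sets borel"
  unfolding TS_levy_measure_def
  by (rule sets.sets_measure_of_eq [where M = borel, unfolded space_borel])

lemma emeasure_TS_levy_measure:
  fixes R :: "'a::euclidean_space measure"
  assumes R: "sets R = sets borel" and A: "A \<in> sets borel"
  shows "emeasure (TS_levy_measure p \<alpha> R) A =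
    (\<integral>\<^sup>+x. (\<integral>\<^sup>+t\<in>{0<..}.
        (indicator A (t *\<^sub>R x) * ennreal (t powr (- 1 - \<alpha>) * exp (- (t powr p)))) \<partial>lborel) \<partial>R)"
proof -
  let ?w = "\<lambda>t::real. ennreal (t powr (- 1 - \<alpha>) * exp (- (t powr p)))"
  let ?g = "\<lambda>A x t. indicator A (t *\<^sub>R x) * ?w t * indicator {0<..} t"
  let ?\<nu> = "\<lambda>A::'a set. \<integral>\<^sup>+x. (\<integral>\<^sup>+t. ?g A x t \<partial>lborel) \<partial>R"
  have inner: "(\<lambda>x. \<integral>\<^sup>+t. ?g B x t \<partial>lborel) \<in> borel_measurable R"
    if B [measurable]: "B \<in> sets borel" for B
  proof -
    have "(\<lambda>(x, t). ?g B x t) \<in> borel_measurable (borel \<Otimes>\<^sub>M lborel)"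
      by measurable
    then have "(\<lambda>x. \<integral>\<^sup>+t. ?g B x t \<partial>lborel) \<in> borel_measurable borel"
      by (rule lborel.borel_measurable_nn_integral)
    then show ?thesis
      by (simp only: measurable_cong_sets [OF R refl])
  qed
  have "countably_additive (sets borel) ?\<nu>"
  proof (rule countably_additiveI)
    fix F :: "nat \<Rightarrow> 'a set"
    assume F: "range F \<subseteq> sets borel" "disjoint_family F" "(\<Union>i. F i) \<in> sets borel"
    then have [measurable]: "F i \<in> sets borel" for i
      by auto
    have "(\<Sum>i. ?\<nu> (F i)) = (\<integral>\<^sup>+x. (\<Sum>i. \<integral>\<^sup>+t. ?g (F i) x t \<partial>lborel) \<partial>R)"
      by (rule nn_integral_suminf [symmetric]) (rule inner, measurable)
    also have "\<dots> = (\<integral>\<^sup>+x. (\<integral>\<^sup>+t. (\<Sum>i. ?g (F i) x t) \<partial>lborel) \<partial>R)"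
      by (intro nn_integral_cong nn_integral_suminf [symmetric]) measurable
    also have "\<dots> = ?\<nu> (\<Union>i. F i)"
    proof (intro nn_integral_cong)
      fix x and t :: real
      show "(\<Sum>i. ?g (F i) x t) = ?g (\<Union>i. F i) x t"
        by (simp only: ennreal_suminf_multc suminf_indicator [OF F(2)])
    qed
    finally show "(\<Sum>i. ?\<nu> (F i)) = ?\<nu> (\<Union>i. F i)" .
  qed
  moreover have "positive (sets borel) ?\<nu>"
    by (simp add: positive_def)
  ultimately show ?thesis
    unfolding TS_levy_measure_def
    by (rule emeasure_measure_of_sigma
          [OF sets.sigma_algebra_axioms [of "borel :: 'a measure", unfolded space_borel] _ _ A, rotated])
qed

definition is_TS ::
    "real \<Rightarrow> real \<Rightarrow> 'a::euclidean_space measure \<Rightarrow> 'a \<Rightarrow> 'a measure \<Rightarrow> bool" where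
  "is_TS p \<alpha> R b \<mu> \<longleftrightarrow> rosinski_measure \<alpha> R \<and> is_ID (TS_levy_measure p \<alpha> R) b \<mu>"

definition A_const :: "real \<Rightarrow> real \<Rightarrow> real" where
  "A_const p q = (q / p) powr (q / (p - q)) * (1 - q / p)"

end

theory Submission
  imports Defs
begin

text \<open>
  Write \<open>M\<close> for the Levy measure of \<open>\<mu>\<close>. Both parts are instances of facts about infinitely divisible
  laws: a submultiplicative moment of at most exponential growth is finite for \<open>\<mu>\<close> as soon as it is
  finite for the large jumps of \<open>M\<close>, and \<open>exp (\<theta> |x| log |x|)\<close> is never integrable when the jumps are unbounded.
  The tempered stable structure enters only through two computations with \<open>M\<close>.

  Only the characteristic function of \<open>\<mu>\<close> is given, so every moment has to be reached from it.
  The law is approximated by sums \<open>S\<close> of a drift and independent identically distributed jumps, each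
  equal to 0 or distributed like \<open>M\<close> restricted to \<open>|x| > 1/(n+1)\<close> (\<open>levy_measure_null_array\<close>).
  The expectation of a product over the jumps is a power \<open>(1 + w / m) ^ m\<close>, which is close to
  \<open>exp w\<close>. One and the same limit theorem thus gives the characteristic function of \<open>S\<close>, and all the real
  exponential estimates below. Convergence of characteristic functions yields convergence of
  the expectations of Gaussian kernels \<open>exp (- \<epsilon> |x - y|^2)\<close>, because a Gaussian kernel is a mixture
  of characters (\<open>gaussian_kernel_tendsto\<close>). This replaces both the continuity theorem
  and the uniqueness theorem for characteristic functions.

  Finiteness. Let \<open>g\<close> be submultiplicative with at most exponential growth. Submultiplicativity splits
  \<open>g S\<close> into a product of \<open>g\<close> over the large jumps and \<open>g\<close> of the centred sum of small jumps,
  and the latter is dominated by finitely many exponentials \<open>exp (u \<bullet> x)\<close>. So \<open>g S\<close> has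
  bounded expectation. Averaging Gaussian kernels against \<open>g y dy\<close> gives a function comparable with
  \<open>g\<close>, and Fatou's lemma carries the bound over to \<open>\<mu>\<close> (\<open>ID_submultiplicative_moment_finite\<close>).

  Divergence. Choose a direction \<open>v\<close> and \<open>a > 1/\<theta>\<close> such that \<open>M\<close> charges a bounded subset \<open>E\<close> of \<open>v \<bullet> x > a\<close>.
  The jumps in \<open>E\<close> alone force the expectation of \<open>exp (s v \<bullet> X)\<close> under \<open>\<mu>\<close> to be at
  least \<open>exp (M(E) e^{sa} - C s - C)\<close> (\<open>exp_inner_moment_lower_bound\<close>). On the other hand the inequality
  \<open>s r \<le> \<theta> r log r + \<theta> e^{s/\<theta> - 1}\<close> bounds the same expectation by
  \<open>exp (\<theta> e^{s/\<theta> - 1})\<close> times the expectation of \<open>exp (\<theta> |X| log |X|)\<close>. Since \<open>a > 1/\<theta>\<close>,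
  the latter cannot be finite (\<open>ID_norm_log_moment_infinite\<close>).

  Tempered stable laws. If \<open>R \<noteq> 0\<close>, then \<open>M\<close> charges every \<open>|x| > r\<close>, since \<open>R\<close> then charges nonzero
  points, each of which contributes mass along its whole ray. For the first part, the \<open>M\<close>-integral of
  \<open>exp (\<theta> |x|^q)\<close> over \<open>|x| > 1\<close> reduces to a one-dimensional integral of \<open>t^{-1-\<alpha>} exp (\<theta> r^q t^q - t^p)\<close>. The exponent is maximal at
  \<open>\<tau> = (q \<theta> r^q / p)^{1/(p-q)}\<close>, with maximum \<open>A_{p,q} (\<theta> r^q)^{p/(p-q)}\<close>, and substituting \<open>t = \<tau> s\<close>
  leaves the factor \<open>\<tau>^{-\<alpha>}\<close>, a multiple of \<open>r^{-\<alpha> q/(p-q)}\<close> (\<open>tempered_tail_moment_large\<close>).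
\<close>

section \<open>Gaussian kernels and characteristic functions\<close>

definition std_gaussian :: "'a::euclidean_space measure" where
  "std_gaussian = distr (Pi\<^sub>M Basis (\<lambda>_. std_normal_distribution)) borel (\<lambda>\<omega>. \<Sum>i\<in>Basis. \<omega> i *\<^sub>R i)"

lemma measurable_gaussian_coordinates [measurable]:
  "(\<lambda>\<omega>. \<Sum>i\<in>Basis. \<omega> i *\<^sub>R (i::'a::euclidean_space))
     \<in> borel_measurable (Pi\<^sub>M Basis (\<lambda>_. std_normal_distribution))"
proof -
  have "(\<lambda>\<omega>. \<omega> i) \<in> borel_measurable (Pi\<^sub>M Basis (\<lambda>_. std_normal_distribution))"
    if "i \<in> Basis" for i :: 'a
    using measurable_component_singleton[OF that, of "\<lambda>_. std_normal_distribution"] by simp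
  then show ?thesis
    by (intro borel_measurable_sum borel_measurable_scaleR) auto
qed

lemma sets_std_gaussian [simp, measurable_cong]: "sets std_gaussian = sets borel"
  by (simp add: std_gaussian_def)

lemma prob_space_std_gaussian: "prob_space (std_gaussian :: 'a::euclidean_space measure)"
  unfolding std_gaussian_def
  by (intro prob_space.prob_space_distr prob_space_PiM prob_space_normal_density
      measurable_gaussian_coordinates) simp

lemma char_fun_std_gaussian:
  "char_fun (std_gaussian :: 'a::euclidean_space measure) x = complex_of_real (exp (- ((norm x)\<^sup>2 / 2)))"
proof -
  let ?N = "std_normal_distribution"
  interpret N: prob_space ?N
    by (rule prob_space_normal_density) simp
  interpret PN: product_sigma_finite "\<lambda>_::'a. ?N"
    by standard
  interpret Ni: real_distribution ?N
    by (rule real_dist_normal_dist)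
  have "char_fun (std_gaussian :: 'a measure) x
      = (CLINT \<omega>|Pi\<^sub>M Basis (\<lambda>_::'a. ?N). iexp (x \<bullet> (\<Sum>i\<in>Basis. \<omega> i *\<^sub>R i)))"
    unfolding char_fun_def std_gaussian_def
    by (subst integral_distr) (auto intro!: measurable_gaussian_coordinates borel_measurable_continuous_onI continuous_intros)
  also have "\<dots> = (CLINT \<omega>|Pi\<^sub>M Basis (\<lambda>_::'a. ?N). (\<Prod>i\<in>Basis. iexp ((x \<bullet> i) * \<omega> i)))"
    by (simp add: exp_sum[symmetric] inner_sum_right sum_distrib_left mult_ac)
  also have "\<dots> = (\<Prod>i\<in>(Basis::'a set). char ?N (x \<bullet> i))"
    unfolding char_def
    by (rule PN.product_integral_prod) (auto intro!: N.integrable_iexp)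
  also have "\<dots> = (\<Prod>i\<in>(Basis::'a set). complex_of_real (exp (- ((x \<bullet> i)\<^sup>2) / 2)))"
    by (simp add: char_std_normal_distribution)
  also have "\<dots> = complex_of_real (exp (\<Sum>i\<in>(Basis::'a set). - ((x \<bullet> i)\<^sup>2) / 2))"
    by (simp add: exp_sum)
  also have "(\<Sum>i\<in>(Basis::'a set). - ((x \<bullet> i)\<^sup>2) / 2) = - ((norm x)\<^sup>2 / 2)"
    by (simp add: sum_negf sum_divide_distrib[symmetric] norm_eq_sqrt_inner euclidean_inner[of x x] 
         power2_eq_square sum_nonneg)
  finally show ?thesis .
qed

text \<open>The Gaussian kernel is its own Fourier transform up to scaling, so Fubini's theorem turns its expectation
  under the law of \<open>S\<close> into an average of the characteristic function of \<open>S\<close>.\<close>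

lemma expectation_gaussian_kernel:
  fixes S :: "'b \<Rightarrow> 'a::euclidean_space"
  assumes "prob_space P" and [measurable]: "S \<in> borel_measurable P" and "\<epsilon> \<ge> 0"
  shows "complex_of_real (\<integral>\<omega>. exp (- (\<epsilon> * (norm (S \<omega> - y))\<^sup>2)) \<partial>P) =
    (CLINT z|std_gaussian. iexp (- (sqrt (2 * \<epsilon>) * (z \<bullet> y))) *
       (CLINT \<omega>|P. iexp ((sqrt (2 * \<epsilon>) *\<^sub>R z) \<bullet> S \<omega>)))"
proof -
  let ?G = "std_gaussian :: 'a measure" and ?c = "sqrt (2 * \<epsilon>)"
  interpret P: prob_space P by fact
  interpret G: prob_space ?G by (rule prob_space_std_gaussian)
  interpret PG: pair_sigma_finite P ?G ..
  interpret PG: pair_prob_space P ?G ..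
  have "complex_of_real (\<integral>\<omega>. exp (- (\<epsilon> * (norm (S \<omega> - y))\<^sup>2)) \<partial>P)
      = (CLINT \<omega>|P. complex_of_real (exp (- (\<epsilon> * (norm (S \<omega> - y))\<^sup>2))))"
    by (rule integral_complex_of_real [symmetric])
  also have "\<dots> = (CLINT \<omega>|P. CLINT z|?G. iexp ((?c *\<^sub>R (S \<omega> - y)) \<bullet> z))"
  proof (rule Bochner_Integration.integral_cong [OF refl])
    fix \<omega>
    have "\<epsilon> * (norm (S \<omega> - y))\<^sup>2 = (norm (?c *\<^sub>R (S \<omega> - y)))\<^sup>2 / 2"
      using assms(3) by (simp add: power_mult_distrib)
    then show "complex_of_real (exp (- (\<epsilon> * (norm (S \<omega> - y))\<^sup>2))) = (CLINT z|?G. iexp ((?c *\<^sub>R (S \<omega> - y)) \<bullet> z))"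
      using char_fun_std_gaussian [of "?c *\<^sub>R (S \<omega> - y)"] by (simp add: char_fun_def)
  qed
  also have "\<dots> = (CLINT z|?G. CLINT \<omega>|P. iexp ((?c *\<^sub>R (S \<omega> - y)) \<bullet> z))"
    by (rule PG.Fubini_integral [symmetric], rule PG.integrable_const_bound[where B=1]) auto
  also have "\<dots> = (CLINT z|?G. iexp (- (?c * (z \<bullet> y))) * (CLINT \<omega>|P. iexp ((?c *\<^sub>R z) \<bullet> S \<omega>)))"
    by (intro Bochner_Integration.integral_cong refl)
       (simp add: integral_mult_right_zero[symmetric] exp_add[symmetric] algebra_simps inner_commute del: integral_mult_right_zero)
  finally show ?thesis .
qed

text \<open>The averages of characteristic functions converge by dominated convergence. Knowing
  the limits for all \<open>\<epsilon>\<close> and \<open>y\<close> is all the weak convergence that the moment estimates use.\<close>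

lemma gaussian_kernel_tendsto:
  fixes S :: "nat \<Rightarrow> 'b \<Rightarrow> 'a::euclidean_space"
  assumes P: "\<And>n. prob_space (P n)" and S: "\<And>n. S n \<in> borel_measurable (P n)"
    and \<mu>: "prob_space \<mu>" and sets_\<mu>: "sets \<mu> = sets borel"
    and cf: "\<And>z. (\<lambda>n. CLINT \<omega>|P n. iexp (z \<bullet> S n \<omega>)) \<longlonglongrightarrow> char_fun \<mu> z" and "\<epsilon> \<ge> 0"
  shows "(\<lambda>n. \<integral>\<omega>. exp (- (\<epsilon> * (norm (S n \<omega> - y))\<^sup>2)) \<partial>P n) \<longlonglongrightarrow> (\<integral>x. exp (- (\<epsilon> * (norm (x - y))\<^sup>2)) \<partial>\<mu>)"
proof -
  let ?G = "std_gaussian :: 'a measure" and ?c = "sqrt (2 * \<epsilon>)"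
  interpret G: prob_space ?G by (rule prob_space_std_gaussian)
  have id: "(\<lambda>x. x) \<in> borel_measurable \<mu>"
    using sets_\<mu> by (simp add: measurable_def sets_eq_imp_space_eq)
  have meas: "(\<lambda>z. CLINT \<omega>|Q. iexp ((?c *\<^sub>R z) \<bullet> X \<omega>)) \<in> borel_measurable ?G"
    if "prob_space Q" and [measurable]: "X \<in> borel_measurable Q" for Q :: "'c measure" and X :: "'c \<Rightarrow> 'a"
  proof -
    interpret Q: prob_space Q by fact
    show ?thesis by measurable
  qed
  have le1: "norm (CLINT \<omega>|P n. iexp (z \<bullet> S n \<omega>)) \<le> 1" for n z
  proof -
    interpret P: prob_space "P n" by (rule P)
    have "norm (CLINT \<omega>|P n. iexp (z \<bullet> S n \<omega>)) \<le> (\<integral>\<omega>. norm (iexp (z \<bullet> S n \<omega>)) \<partial>P n)"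
      by (rule integral_norm_bound)
    then show ?thesis by (simp add: P.prob_space)
  qed
  have "(\<lambda>n. CLINT z|?G. iexp (- (?c * (z \<bullet> y))) * (CLINT \<omega>|P n. iexp ((?c *\<^sub>R z) \<bullet> S n \<omega>)))
     \<longlonglongrightarrow> (CLINT z|?G. iexp (- (?c * (z \<bullet> y))) * (CLINT x|\<mu>. iexp ((?c *\<^sub>R z) \<bullet> x)))"
  proof (rule integral_dominated_convergence[where w="\<lambda>_. 1"])
    show "AE z in ?G. (\<lambda>n. iexp (- (?c * (z \<bullet> y))) * (CLINT \<omega>|P n. iexp ((?c *\<^sub>R z) \<bullet> S n \<omega>)))
       \<longlonglongrightarrow> iexp (- (?c * (z \<bullet> y))) * (CLINT x|\<mu>. iexp ((?c *\<^sub>R z) \<bullet> x))"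
      using cf [unfolded char_fun_def] by (intro AE_I2 tendsto_mult tendsto_const)
    show "AE z in ?G. norm (iexp (- (?c * (z \<bullet> y))) * (CLINT \<omega>|P n. iexp ((?c *\<^sub>R z) \<bullet> S n \<omega>))) \<le> 1" for n
      using le1 [of n "?c *\<^sub>R z" for z] by (intro AE_I2) (simp only: norm_mult norm_exp_i_times mult_1_left)
  qed (use meas[OF \<mu> id] meas[OF P S] in measurable)
  then have "(\<lambda>n. complex_of_real (\<integral>\<omega>. exp (- (\<epsilon> * (norm (S n \<omega> - y))\<^sup>2)) \<partial>P n))
     \<longlonglongrightarrow> complex_of_real (\<integral>x. exp (- (\<epsilon> * (norm (x - y))\<^sup>2)) \<partial>\<mu>)"
    by (simp only: expectation_gaussian_kernel[OF P S \<open>\<epsilon> \<ge> 0\<close>] expectation_gaussian_kernel[OF \<mu> id \<open>\<epsilon> \<ge> 0\<close>])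
  then show ?thesis
    by (simp only: tendsto_of_real_iff)
qed

section \<open>The law of a single jump\<close>

lemma levy_measure_large_finite:
  fixes M :: "'a::euclidean_space measure"
  assumes "levy_measure M" and "r > 0"
  shows "emeasure M {x. r < norm x} < \<infinity>"
proof -
  have sets_M [measurable_cong]: "sets M = sets borel"
    using assms by (simp add: levy_measure_def)
  let ?c = "min (r\<^sup>2) 1"
  have c: "?c > 0" using assms by auto
  have "emeasure M {x. r < norm x} = (\<integral>\<^sup>+x. indicator {x. r < norm x} x \<partial>M)"
    by (subst nn_integral_indicator) (auto simp: sets_M)
  also have "\<dots> \<le> (\<integral>\<^sup>+x. ennreal (1 / ?c) * ennreal (min ((norm x)\<^sup>2) 1) \<partial>M)"
  proof (intro nn_integral_mono)
    fix x
    show "indicator {x. r < norm x} x \<le> ennreal (1 / ?c) * ennreal (min ((norm x)\<^sup>2) 1)"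
    proof (cases "r < norm x")
      case True
      then have "?c \<le> min ((norm x)\<^sup>2) 1"
        using assms by (intro min.mono power_mono) auto
      then have "1 \<le> (1 / ?c) * min ((norm x)\<^sup>2) 1"
        using c by (simp add: field_simps)
      then have "ennreal 1 \<le> ennreal ((1 / ?c) * min ((norm x)\<^sup>2) 1)"
        by (rule ennreal_leI)
      also have "\<dots> = ennreal (1 / ?c) * ennreal (min ((norm x)\<^sup>2) 1)"
        using c by (intro ennreal_mult) auto
      finally show ?thesis
        using True by simp
    qed simp
  qed
  also have "\<dots> = ennreal (1 / ?c) * (\<integral>\<^sup>+x. ennreal (min ((norm x)\<^sup>2) 1) \<partial>M)"
    by (rule nn_integral_cmult) measurable
  also have "\<dots> < \<infinity>"
    using assms by (auto simp: levy_measure_def ennreal_mult_less_top)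
  finally show ?thesis .
qed

text \<open>The mixture of \<open>M\<close> restricted to \<open>A\<close>, scaled by \<open>1/m\<close>, with a point mass at 0 that takes the
  remaining probability; the sum of \<open>m\<close> independent such jumps approximates the compound Poisson law
  with jump measure \<open>M\<close> on \<open>A\<close>.\<close>

definition jump_law :: "'a::euclidean_space measure \<Rightarrow> 'a set \<Rightarrow> nat \<Rightarrow> 'a measure" where
  "jump_law M A m = measure_of UNIV (sets borel)
     (\<lambda>B. ennreal (1 / m) * emeasure M (B \<inter> A) + ennreal (1 - measure M A / m) * indicator B 0)"

lemma sets_jump_law [simp, measurable_cong]: "sets (jump_law M A m) = sets borel"
  unfolding jump_law_def
  by (rule sets.sets_measure_of_eq [where M = borel, unfolded space_borel])

lemma space_jump_law [simp]: "space (jump_law M A m) = UNIV"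
  using sets_eq_imp_space_eq [OF sets_jump_law] by simp

lemma emeasure_jump_law:
  assumes M: "sets M = sets borel" and A: "A \<in> sets borel" and B: "B \<in> sets borel"
  shows "emeasure (jump_law M A m) B =
    ennreal (1 / m) * emeasure M (B \<inter> A) + ennreal (1 - measure M A / m) * indicator B 0"
proof -
  let ?\<nu> = "\<lambda>B. ennreal (1 / m) * emeasure M (B \<inter> A) + ennreal (1 - measure M A / m) * indicator B 0"
  have "countably_additive (sets borel) ?\<nu>"
  proof (rule countably_additiveI)
    fix F :: "nat \<Rightarrow> 'a set"
    assume F: "range F \<subseteq> sets borel" "disjoint_family F" "(\<Union>i. F i) \<in> sets borel"
    have "(\<Sum>i. emeasure M (F i \<inter> A)) = emeasure M (\<Union>i. F i \<inter> A)"
      using F A M by (intro suminf_emeasure) (auto simp: disjoint_family_on_def)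
    moreover have "(\<Sum>i. indicator (F i) 0) = (indicator (\<Union>i. F i) 0 :: ennreal)"
      by (rule suminf_indicator [OF F(2)])
    ultimately show "(\<Sum>i. ?\<nu> (F i)) = ?\<nu> (\<Union>i. F i)"
      by (simp add: suminf_add [symmetric])
  qed
  moreover have "positive (sets borel) ?\<nu>"
    by (simp add: positive_def)
  ultimately show ?thesis
    unfolding jump_law_def
    by (rule emeasure_measure_of_sigma
          [OF sets.sigma_algebra_axioms [of "borel :: 'a measure", unfolded space_borel] _ _ B, rotated])
qed

context
  fixes M :: "'a::euclidean_space measure" and A :: "'a set" and m :: nat
  assumes sets_M [measurable_cong]: "sets M = sets borel" and A [measurable]: "A \<in> sets borel"
    and fin: "emeasure M A < \<infinity>" and m: "m > 0" "measure M A \<le> m"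
begin

lemma prob_space_jump_law: "prob_space (jump_law M A m)"
proof (rule prob_spaceI)
  have "emeasure M A = ennreal (measure M A)"
    using fin by (intro emeasure_eq_ennreal_measure) auto
  then have "emeasure (jump_law M A m) UNIV
      = ennreal (1 / m) * ennreal (measure M A) + ennreal (1 - measure M A / m)"
    by (simp add: emeasure_jump_law[OF sets_M A])
  also have "\<dots> = ennreal (1 / m * measure M A + (1 - measure M A / m))"
    using m by (subst ennreal_plus) (auto simp: ennreal_mult [symmetric])
  also have "\<dots> = 1"
    by simp
  finally show "emeasure (jump_law M A m) (space (jump_law M A m)) = 1"
    by simp
qed

lemma integral_jump_law:
  fixes f :: "'a \<Rightarrow> 'b::{banach, second_countable_topology}"
  assumes f [measurable]: "f \<in> borel_measurable borel" and int: "set_integrable M A f" and zero: "0 \<notin> A"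
  shows "integrable (jump_law M A m) f"
    and "integral\<^sup>L (jump_law M A m) f =
      (1 - measure M A / m) *\<^sub>R f 0 + (1 / m) *\<^sub>R (LINT x:A|M. f x)"
proof -
  let ?\<rho> = "jump_law M A m"
  let ?i = "indicator (- {0}) :: 'a \<Rightarrow> real" and ?w = "\<lambda>x::'a. indicator A x * (1 / m)"
  interpret \<rho>: prob_space ?\<rho> by (rule prob_space_jump_law)
  have f\<rho>: "f \<in> borel_measurable ?\<rho>" and fM: "f \<in> borel_measurable M"
    by measurable
  \<comment> \<open>Away from 0 the law is a multiple of \<open>M\<close> on \<open>A\<close>, so integrals split into the part at 0 and an
    integral over a common density.\<close>
  have eq: "density ?\<rho> (\<lambda>x. ennreal (?i x)) = density M (\<lambda>x. ennreal (?w x))"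
  proof (rule measure_eqI)
    fix B assume "B \<in> sets (density ?\<rho> (\<lambda>x. ennreal (?i x)))"
    then have B [measurable]: "B \<in> sets borel" by simp
    have BM: "B \<in> sets M" by (simp add: sets_M)
    have "emeasure (density ?\<rho> (\<lambda>x. ennreal (?i x))) B = (\<integral>\<^sup>+x. indicator (B - {0}) x \<partial>?\<rho>)"
      by (subst emeasure_density) (auto intro!: nn_integral_cong simp del: nn_integral_indicator split: split_indicator)
    also have "\<dots> = emeasure ?\<rho> (B - {0})"
      by (intro nn_integral_indicator) simp
    also have "\<dots> = ennreal (1 / m) * emeasure M ((B - {0}) \<inter> A)"
      by (subst emeasure_jump_law[OF sets_M A]) auto
    also have "(B - {0}) \<inter> A = B \<inter> A"
      using zero by auto
    also have "ennreal (1 / m) * emeasure M (B \<inter> A) = (\<integral>\<^sup>+x. ennreal (1 / m) * indicator (B \<inter> A) x \<partial>M)"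
      by (subst nn_integral_cmult_indicator) (auto simp: sets_M)
    also have "\<dots> = emeasure (density M (\<lambda>x. ennreal (?w x))) B"
      using BM by (subst emeasure_density) (auto intro!: nn_integral_cong split: split_indicator)
    finally show "emeasure (density ?\<rho> (\<lambda>x. ennreal (?i x))) B = emeasure (density M (\<lambda>x. ennreal (?w x))) B" .
  qed (simp add: sets_M)
  have i_meas: "?i \<in> borel_measurable ?\<rho>" and w_meas: "?w \<in> borel_measurable M"
    by measurable
  have i_nonneg: "AE x in ?\<rho>. 0 \<le> ?i x" and w_nonneg: "AE x in M. 0 \<le> ?w x"
    by (intro AE_I2; simp)+
  have w_eq: "?w x *\<^sub>R f x = (1 / m) *\<^sub>R indicator A x *\<^sub>R f x" for x
    by simp
  have "integrable M (\<lambda>x. ?w x *\<^sub>R f x)"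
    unfolding w_eq using int by (intro integrable_scaleR_right) (simp add: set_integrable_def)
  then have "integrable (density M (\<lambda>x. ennreal (?w x))) f"
    by (subst integrable_density [OF fM w_meas w_nonneg])
  then have i1: "integrable ?\<rho> (\<lambda>x. ?i x *\<^sub>R f x)"
    unfolding eq [symmetric] by (subst (asm) integrable_density [OF f\<rho> i_meas i_nonneg])
  have i2: "integrable ?\<rho> (\<lambda>x. indicator {0} x *\<^sub>R f 0)"
    by (intro integrable_scaleR_left integrable_real_indicator) (auto simp: less_top[symmetric])
  define g where "g x = indicator {0} x *\<^sub>R f 0 + ?i x *\<^sub>R f x" for x
  have f_split: "f = g"
    by (intro ext) (simp add: g_def indicator_def)
  have "integrable ?\<rho> g"
    unfolding g_def by (intro Bochner_Integration.integrable_add i1 i2)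
  then show "integrable ?\<rho> f"
    by (simp only: f_split [symmetric])
  have "integral\<^sup>L ?\<rho> f = integral\<^sup>L ?\<rho> g"
    by (simp only: f_split [symmetric])
  also have "\<dots> = (\<integral>x. indicator {0} x *\<^sub>R f 0 \<partial>?\<rho>) + (\<integral>x. ?i x *\<^sub>R f x \<partial>?\<rho>)"
    unfolding g_def by (intro Bochner_Integration.integral_add i1 i2)
  also have "(\<integral>x. indicator {0} x *\<^sub>R f 0 \<partial>?\<rho>) = measure ?\<rho> {0} *\<^sub>R f 0"
    by (subst integral_scaleR_left) (auto intro!: integrable_real_indicator simp: less_top[symmetric])
  also have "measure ?\<rho> {0} = 1 - measure M A / m"
    using zero m by (simp add: measure_def emeasure_jump_law[OF sets_M A])
  also have "(\<integral>x. ?i x *\<^sub>R f x \<partial>?\<rho>) = integral\<^sup>L (density ?\<rho> (\<lambda>x. ennreal (?i x))) f"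
    by (rule integral_density [OF f\<rho> i_meas i_nonneg, symmetric])
  also have "\<dots> = (\<integral>x. ?w x *\<^sub>R f x \<partial>M)"
    unfolding eq by (rule integral_density [OF fM w_meas w_nonneg])
  also have "\<dots> = (1 / m) *\<^sub>R (LINT x:A|M. f x)"
    unfolding w_eq set_lebesgue_integral_def by (rule integral_scaleR_right)
  finally show "integral\<^sup>L ?\<rho> f = (1 - measure M A / m) *\<^sub>R f 0 + (1 / m) *\<^sub>R (LINT x:A|M. f x)" .
qed

end

text \<open>The convergence is relative to \<open>exp (w n)\<close>, so that the \<open>w n\<close> may be unbounded: keeping
  ever smaller jumps of an infinite Levy measure can make the uncentred exponents diverge, and only their
  sum with the drift converges.\<close>

lemma power_one_plus_over_exp_tendsto:
  fixes w :: "nat \<Rightarrow> complex" and m :: "nat \<Rightarrow> nat"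
  assumes m: "\<And>n. m n > 0" and z0: "(\<lambda>n. norm (w n) / m n) \<longlonglongrightarrow> 0" and w2: "(\<lambda>n. (norm (w n))\<^sup>2 / m n) \<longlonglongrightarrow> 0"
  shows "(\<lambda>n. (1 + w n / m n) ^ m n / exp (w n)) \<longlonglongrightarrow> 1"
proof -
  define z where "z n = w n / of_nat (m n)" for n
  have nz: "norm (z n) = norm (w n) / m n" for n
    by (simp add: z_def norm_divide)
  have small: "\<forall>\<^sub>F n in sequentially. norm (z n) < 1 / 2"
    using order_tendstoD(2) [OF z0, of "1/2"] by (simp add: nz)
  have "(\<lambda>n. of_nat (m n) * (ln (1 + z n) - z n)) \<longlonglongrightarrow> 0"
  proof (rule Lim_null_comparison)
    show "\<forall>\<^sub>F n in sequentially. norm (of_nat (m n) * (ln (1 + z n) - z n)) \<le> 2 * ((norm (w n))\<^sup>2 / m n)"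
      using small
    proof eventually_elim
      case (elim n)
      have "norm (ln (1 + z n) - z n) \<le> (norm (z n))\<^sup>2 / (1 - norm (z n))"
        using elim by (intro Ln_approx_linear) auto
      also have "\<dots> \<le> (norm (z n))\<^sup>2 / (1 / 2)"
        using elim by (intro divide_left_mono) auto
      finally have "m n * norm (ln (1 + z n) - z n) \<le> m n * (2 * (norm (z n))\<^sup>2)"
        by (intro mult_left_mono) auto
      also have "\<dots> = 2 * ((norm (w n))\<^sup>2 / m n)"
        using m[of n] by (simp add: nz power_divide power2_eq_square)
      finally show ?case
        by (simp add: norm_mult)
    qed
    show "(\<lambda>n. 2 * ((norm (w n))\<^sup>2 / m n)) \<longlonglongrightarrow> 0"
      using tendsto_mult_right_zero[OF w2] by simp
  qed
  then have "(\<lambda>n. exp (of_nat (m n) * (ln (1 + z n) - z n))) \<longlonglongrightarrow> 1"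
    by (auto dest: tendsto_exp)
  moreover have "\<forall>\<^sub>F n in sequentially.
      exp (of_nat (m n) * (ln (1 + z n) - z n)) = (1 + w n / m n) ^ m n / exp (w n)"
    using small
  proof eventually_elim
    case (elim n)
    have "1 + z n \<noteq> 0"
    proof
      assume "1 + z n = 0"
      then have "z n = - 1"
        by (simp add: eq_neg_iff_add_eq_0 add.commute)
      with elim show False by simp
    qed
    moreover have "of_nat (m n) * z n = w n"
      using m[of n] by (simp add: z_def)
    ultimately show ?case
      by (simp add: right_diff_distrib exp_diff exp_of_nat_mult z_def)
  qed
  ultimately show ?thesis
    by (blast intro: Lim_transform_eventually)
qed

section \<open>Null arrays with a given Levy measure\<close>

text \<open>The coordinates of \<open>P n\<close> below \<open>m n\<close> are the jumps and \<open>\<beta> n\<close> is the drift. The test functions \<open>f\<close>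
  are multiplicative weights of the jumps, and \<open>\<zeta>\<close>, \<open>u\<close> record their first-order behaviour \<open>1 + \<zeta> (u \<bullet> x)\<close> at 0, which
  the centering has to cancel: \<open>\<zeta> = \<i>\<close> gives characteristic functions, \<open>\<zeta> = 1\<close> real exponential moments.\<close>

locale null_array =
  fixes M :: "'a::euclidean_space measure" and b :: 'a
    and P :: "nat \<Rightarrow> (nat \<Rightarrow> 'a) measure" and m :: "nat \<Rightarrow> nat" and \<beta> :: "nat \<Rightarrow> 'a"
  assumes prob_space_P: "prob_space (P n)"
    and measurable_coordinate: "j < m n \<Longrightarrow> (\<lambda>\<omega>. \<omega> j) \<in> borel_measurable (P n)"
    and integrable_prod: "\<lbrakk>f \<in> borel_measurable borel; f 0 = 1;
        integrable M (\<lambda>x. f x - 1 - \<zeta> * complex_of_real (u \<bullet> x / (1 + (norm x)\<^sup>2)))\<rbrakk>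
      \<Longrightarrow> integrable (P n) (\<lambda>\<omega>. \<Prod>j<m n. f (\<omega> j))"
    and integral_prod_tendsto: "\<lbrakk>f \<in> borel_measurable borel; f 0 = 1;
        integrable M (\<lambda>x. f x - 1 - \<zeta> * complex_of_real (u \<bullet> x / (1 + (norm x)\<^sup>2)))\<rbrakk>
      \<Longrightarrow> (\<lambda>n. exp (\<zeta> * complex_of_real (u \<bullet> \<beta> n)) * (CLINT \<omega>|P n. \<Prod>j<m n. f (\<omega> j)))
        \<longlonglongrightarrow> exp (\<zeta> * complex_of_real (u \<bullet> b)
              + (CLINT x|M. f x - 1 - \<zeta> * complex_of_real (u \<bullet> x / (1 + (norm x)\<^sup>2))))"

lemma le_one_plus_square: "r \<le> 1 + r\<^sup>2" for r :: real
proof -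
  have "0 \<le> (r - 1 / 2)\<^sup>2"
    by simp
  then show ?thesis
    by (simp add: power2_eq_square algebra_simps)
qed

lemma centering_bound: "\<bar>u \<bullet> x / (1 + (norm x)\<^sup>2)\<bar> \<le> norm u"
proof -
  have "norm u * norm x \<le> norm u * (1 + (norm x)\<^sup>2)"
    by (intro mult_left_mono le_one_plus_square) auto
  then have "\<bar>u \<bullet> x\<bar> \<le> norm u * (1 + (norm x)\<^sup>2)"
    using Cauchy_Schwarz_ineq2 [of u x] by linarith
  then show ?thesis
    by (simp add: abs_divide divide_le_eq add_nonneg_pos abs_of_pos add_pos_nonneg)
qed

text \<open>The jumps of size at most \<open>1/(n+1)\<close> are removed and compensated by the drift. The number of summands
  grows faster than the square of the total jump mass, since \<open>w^2 / m\<close> is the error in replacing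
  \<open>(1 + w / m) ^ m\<close> by \<open>exp w\<close>, and \<open>w\<close> is of the order of that mass.\<close>

lemma levy_measure_null_array:
  fixes M :: "'a::euclidean_space measure"
  assumes levy: "levy_measure M"
  shows "\<exists>P m \<beta>. null_array M b P m \<beta>"
proof -
  have sets_M [measurable_cong]: "sets M = sets borel" and M0: "emeasure M {0} = 0"
    using levy by (simp_all add: levy_measure_def)
  define A :: "nat \<Rightarrow> 'a set" where "A n = {x. 1 / Suc n < norm x}" for n
  define l where "l n = measure M (A n)" for n
  define m where "m n = nat \<lceil>Suc n * (1 + l n)\<^sup>2\<rceil>" for n
  define \<beta> where "\<beta> n = b - (LINT x:A n|M. (1 / (1 + (norm x)\<^sup>2)) *\<^sub>R x)" for n
  define P where "P n = Pi\<^sub>M {..<m n} (\<lambda>_. jump_law M (A n) (m n))" for n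
  have A [measurable]: "A n \<in> sets borel" and zero: "0 \<notin> A n" for n
    by (auto simp: A_def)
  have AM: "A n \<in> sets M" for n by (simp add: sets_M)
  have fin: "emeasure M (A n) < \<infinity>" for n
    unfolding A_def by (rule levy_measure_large_finite [OF levy]) simp
  have l0: "l n \<ge> 0" for n by (simp add: l_def)
  have m_ge: "Suc n * (1 + l n)\<^sup>2 \<le> m n" for n
    unfolding m_def by linarith
  have m_pos: "m n > 0" for n
  proof -
    have "0 < Suc n * (1 + l n)\<^sup>2"
      using l0 [of n] by (intro mult_pos_pos) (auto simp: add_pos_nonneg)
    then show ?thesis using m_ge [of n] by linarith
  qed
  have l_le: "l n \<le> m n" for n
  proof -
    have "l n \<le> 1 * (1 + l n)\<^sup>2"
      using l0[of n] by (simp add: power2_eq_square algebra_simps)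
    also have "\<dots> \<le> Suc n * (1 + l n)\<^sup>2"
      by (intro mult_right_mono) auto
    finally show ?thesis using m_ge [of n] by linarith
  qed
  note jump = sets_M A fin m_pos l_le [unfolded l_def]
  have prob_\<rho>: "prob_space (jump_law M (A n) (m n))" for n
    by (rule prob_space_jump_law [OF jump])
  interpret PP: product_sigma_finite "\<lambda>_::nat. jump_law M (A n) (m n)" for n
    by (intro product_sigma_finite.intro prob_space_imp_sigma_finite prob_\<rho>)
  have cen: "set_integrable M (A n) (\<lambda>x. (1 / (1 + (norm x)\<^sup>2)) *\<^sub>R x)" for n
    unfolding set_integrable_def
  proof (rule integrableI_bounded_set_indicator [of _ _ _ 1])
    have "norm ((1 / (1 + (norm x)\<^sup>2)) *\<^sub>R x) \<le> 1" for x :: 'a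
    proof -
      have "norm x \<le> 1 + (norm x)\<^sup>2"
        by (rule le_one_plus_square)
      then show ?thesis by (simp add: divide_le_eq add_nonneg_pos abs_of_pos add_pos_nonneg)
    qed
    then show "AE x in M. x \<in> A n \<longrightarrow> norm ((1 / (1 + (norm x)\<^sup>2)) *\<^sub>R x) \<le> 1" by simp
  qed (use fin AM in auto)
  have cen_u: "(LINT x:A n|M. u \<bullet> x / (1 + (norm x)\<^sup>2)) = u \<bullet> (b - \<beta> n)" for n u
  proof -
    have "u \<bullet> (b - \<beta> n) = (LINT x|M. u \<bullet> (indicator (A n) x *\<^sub>R ((1 / (1 + (norm x)\<^sup>2)) *\<^sub>R x)))"
      using cen [of n] unfolding \<beta>_def set_lebesgue_integral_def set_integrable_def
      by (subst integral_inner_right) auto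
    then show ?thesis
      unfolding set_lebesgue_integral_def by simp
  qed
  have cen_u_int: "set_integrable M (A n) (\<lambda>x. u \<bullet> x / (1 + (norm x)\<^sup>2))" for n u
    using integrable_inner_right [of u, OF cen [of n, unfolded set_integrable_def]]
    unfolding set_integrable_def by simp
  \<comment> \<open>For fixed \<open>n\<close> the expectation is exactly a power; the drift turns its exponent into the integral
    of the centred weight, and the exponent itself grows at most linearly in the total jump mass.\<close>
  have steps: "integrable (P n) (\<lambda>\<omega>. \<Prod>j<m n. f (\<omega> j)) \<and>
      (CLINT \<omega>|P n. \<Prod>j<m n. f (\<omega> j)) = (1 + (CLINT x:A n|M. f x - 1) / m n) ^ m n \<and>
      norm (CLINT x:A n|M. f x - 1) \<le> (LINT x|M. norm (f x - 1 - \<zeta> * complex_of_real (u \<bullet> x / (1 + (norm x)\<^sup>2)))) + norm \<zeta> * norm u * l n \<and>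
      \<zeta> * complex_of_real (u \<bullet> \<beta> n) + (CLINT x:A n|M. f x - 1)
      = \<zeta> * complex_of_real (u \<bullet> b) + (CLINT x:A n|M. f x - 1 - \<zeta> * complex_of_real (u \<bullet> x / (1 + (norm x)\<^sup>2)))"
    if f [measurable]: "f \<in> borel_measurable borel" and f0: "f 0 = 1"
      and int: "integrable M (\<lambda>x. f x - 1 - \<zeta> * complex_of_real (u \<bullet> x / (1 + (norm x)\<^sup>2)))" for f \<zeta> u n
  proof -
    let ?c = "\<lambda>x. \<zeta> * complex_of_real (u \<bullet> x / (1 + (norm x)\<^sup>2))"
    have h: "set_integrable M (A n) (\<lambda>x. f x - 1 - ?c x)"
      unfolding set_integrable_def using AM by (intro integrable_mult_indicator int)
    have c: "set_integrable M (A n) ?c"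
    proof (intro set_integrable_mult_right)
      show "set_integrable M (A n) (\<lambda>x. complex_of_real (u \<bullet> x / (1 + (norm x)\<^sup>2)))"
      proof -
        have "integrable M (\<lambda>x. complex_of_real (indicator (A n) x *\<^sub>R (u \<bullet> x / (1 + (norm x)\<^sup>2))))"
          using cen_u_int [of n u] unfolding set_integrable_def by (rule integrable_of_real)
        then show ?thesis
          by (simp add: set_integrable_def scaleR_conv_of_real)
      qed
    qed
    have w: "set_integrable M (A n) (\<lambda>x. f x - 1)"
      using set_integral_add(1) [OF h c] by simp
    have one: "set_integrable M (A n) (\<lambda>x. 1 :: complex)"
      unfolding set_integrable_def using fin AM
      by (intro integrableI_bounded_set_indicator [of _ _ _ 1]) auto
    have one_eq: "(CLINT x:A n|M. 1) = l n"
      using fin AM unfolding l_def set_lebesgue_integral_def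
      by (subst integral_scaleR_left) (auto intro!: integrable_real_indicator simp: scaleR_conv_of_real)
    have fA: "set_integrable M (A n) f"
      using set_integral_add(1) [OF w one] by simp
    have fA_eq: "(CLINT x:A n|M. f x) = (CLINT x:A n|M. f x - 1) + l n"
      using set_integral_add(2) [OF w one] one_eq by simp
    have w_eq: "(CLINT x:A n|M. f x - 1) = (CLINT x:A n|M. f x - 1 - ?c x) + (CLINT x:A n|M. ?c x)"
      using set_integral_add(2) [OF h c] by simp
    have c_eq: "(CLINT x:A n|M. ?c x) = \<zeta> * complex_of_real (u \<bullet> (b - \<beta> n))"
      by (simp only: set_integral_mult_right set_integral_complex_of_real cen_u)
    have c_norm: "norm (CLINT x:A n|M. ?c x) \<le> norm \<zeta> * norm u * l n"
    proof -
      have "norm (CLINT x:A n|M. ?c x) \<le> (LINT x|M. (norm \<zeta> * norm u) * indicator (A n) x)"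
        unfolding set_lebesgue_integral_def
      proof (rule Bochner_Integration.integral_norm_bound_integral)
        show "integrable M (\<lambda>x. (norm \<zeta> * norm u) * indicator (A n) x)"
          using fin AM by (intro integrable_mult_right) auto
        show "norm (indicator (A n) x *\<^sub>R ?c x) \<le> (norm \<zeta> * norm u) * indicator (A n) x" for x
        proof -
          have "norm (?c x) \<le> norm \<zeta> * norm u"
            unfolding norm_mult norm_of_real by (intro mult_left_mono centering_bound) simp
          then show ?thesis by (simp only: norm_scaleR) (simp add: indicator_def)
        qed
      qed (use c in \<open>simp add: set_integrable_def\<close>)
      then show ?thesis using AM by (simp add: l_def)
    qed
    have "norm (CLINT x:A n|M. f x - 1 - ?c x) \<le> (LINT x|M. norm (f x - 1 - ?c x))"
      unfolding set_lebesgue_integral_def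
      by (rule Bochner_Integration.integral_norm_bound_integral) (use h int in \<open>auto simp: set_integrable_def indicator_def\<close>)
    then have bound: "norm (CLINT x:A n|M. f x - 1) \<le> (LINT x|M. norm (f x - 1 - ?c x)) + norm \<zeta> * norm u * l n"
      unfolding w_eq using c_norm by (intro norm_triangle_le add_mono)
    have "integral\<^sup>L (jump_law M (A n) (m n)) f = 1 + (CLINT x:A n|M. f x - 1) / m n"
      using m_pos [of n] f0
      by (subst integral_jump_law [OF jump f fA zero])
         (simp add: fA_eq scaleR_conv_of_real l_def[symmetric] field_simps)
    then have "(CLINT \<omega>|P n. \<Prod>j<m n. f (\<omega> j)) = (1 + (CLINT x:A n|M. f x - 1) / m n) ^ m n"
      unfolding P_def by (subst PP.product_integral_prod) (auto intro!: integral_jump_law(1) [OF jump f fA zero])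
    moreover have "integrable (P n) (\<lambda>\<omega>. \<Prod>j<m n. f (\<omega> j))"
      unfolding P_def by (intro PP.product_integrable_prod) (auto intro!: integral_jump_law(1) [OF jump f fA zero])
    moreover have "\<zeta> * complex_of_real (u \<bullet> \<beta> n) + (CLINT x:A n|M. f x - 1)
      = \<zeta> * complex_of_real (u \<bullet> b) + (CLINT x:A n|M. f x - 1 - ?c x)"
      unfolding w_eq c_eq by (simp add: inner_diff_right algebra_simps)
    ultimately show ?thesis using bound by blast
  qed
  have "null_array M b P m \<beta>"
  proof (rule null_array.intro)
    show "prob_space (P n)" for n
      unfolding P_def by (intro prob_space_PiM prob_\<rho>)
    show "(\<lambda>\<omega>. \<omega> j) \<in> borel_measurable (P n)" if "j < m n" for j n
      unfolding P_def using measurable_component_singleton [of j "{..<m n}" "\<lambda>_. jump_law M (A n) (m n)"] that by simp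
    fix f \<zeta> u
    assume f: "f \<in> borel_measurable borel" "f 0 = 1"
      "integrable M (\<lambda>x. f x - 1 - \<zeta> * complex_of_real (u \<bullet> x / (1 + (norm x)\<^sup>2)))"
    note steps = steps [OF f]
    let ?h = "\<lambda>x. f x - 1 - \<zeta> * complex_of_real (u \<bullet> x / (1 + (norm x)\<^sup>2))"
    show "integrable (P n) (\<lambda>\<omega>. \<Prod>j<m n. f (\<omega> j))" for n
      using steps by blast
    define w where "w n = (CLINT x:A n|M. f x - 1)" for n
    define B where "B = (LINT x|M. norm (?h x)) + norm \<zeta> * norm u"
    have B: "B \<ge> 0" unfolding B_def by simp
    have w_le: "norm (w n) \<le> B * (1 + l n)" for n
    proof -
      have "norm (w n) \<le> (LINT x|M. norm (?h x)) * 1 + norm \<zeta> * norm u * l n"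
        unfolding w_def using steps by simp
      also have "\<dots> \<le> (LINT x|M. norm (?h x)) * (1 + l n) + norm \<zeta> * norm u * (1 + l n)"
        using l0 by (intro add_mono mult_left_mono) auto
      finally show ?thesis by (simp add: B_def distrib_right)
    qed
    have inv: "(\<lambda>n. 1 / real (Suc n)) \<longlonglongrightarrow> 0"
      using LIMSEQ_inverse_real_of_nat by (simp add: inverse_eq_divide)
    have "(\<lambda>n. (1 + w n / m n) ^ m n / exp (w n)) \<longlonglongrightarrow> 1"
    proof (rule power_one_plus_over_exp_tendsto [OF m_pos])
      have w2: "(norm (w n))\<^sup>2 / m n \<le> B\<^sup>2 * (1 / Suc n)" for n
      proof -
        have "(norm (w n))\<^sup>2 * Suc n \<le> (B * (1 + l n))\<^sup>2 * Suc n"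
          using w_le by (intro mult_right_mono power_mono) auto
        also have "\<dots> = B\<^sup>2 * (Suc n * (1 + l n)\<^sup>2)"
          by (simp add: power_mult_distrib)
        also have "\<dots> \<le> B\<^sup>2 * m n"
          using m_ge by (intro mult_left_mono) auto
        finally show ?thesis using m_pos [of n] by (simp add: field_simps)
      qed
      have w1: "norm (w n) / m n \<le> B * (1 / Suc n)" for n
      proof -
        have "norm (w n) * Suc n \<le> (B * (1 + l n)) * Suc n"
          using w_le by (intro mult_right_mono) auto
        also have "\<dots> = B * (Suc n * (1 + l n))" by simp
        also have "\<dots> \<le> B * m n"
        proof (rule mult_left_mono [OF _ B])
          have "Suc n * (1 + l n) \<le> Suc n * (1 + l n)\<^sup>2"
            using l0 [of n] by (intro mult_left_mono) (auto simp: power2_eq_square algebra_simps)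
          then show "Suc n * (1 + l n) \<le> m n" using m_ge [of n] by linarith
        qed
        finally show ?thesis using m_pos [of n] by (simp add: field_simps)
      qed
      show "(\<lambda>n. (norm (w n))\<^sup>2 / m n) \<longlonglongrightarrow> 0"
        by (rule tendsto_sandwich [OF _ _ tendsto_const tendsto_mult_right_zero [OF inv, of "B\<^sup>2"]])
           (use w2 in auto)
      show "(\<lambda>n. norm (w n) / m n) \<longlonglongrightarrow> 0"
        by (rule tendsto_sandwich [OF _ _ tendsto_const tendsto_mult_right_zero [OF inv, of B]])
           (use w1 in auto)
    qed
    moreover have "(\<lambda>n. \<zeta> * complex_of_real (u \<bullet> b) + (CLINT x:A n|M. ?h x))
        \<longlonglongrightarrow> \<zeta> * complex_of_real (u \<bullet> b) + (CLINT x|M. ?h x)"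
    proof (intro tendsto_add tendsto_const, unfold set_lebesgue_integral_def)
      have h_meas [measurable]: "?h \<in> borel_measurable M"
        using f(3) by (rule borel_measurable_integrable)
      show "(\<lambda>n. CLINT x|M. indicator (A n) x *\<^sub>R ?h x) \<longlonglongrightarrow> (CLINT x|M. ?h x)"
      proof (rule integral_dominated_convergence [where w = "\<lambda>x. norm (?h x)"])
        show "(\<lambda>x. indicator (A n) x *\<^sub>R ?h x) \<in> borel_measurable M" for n
          using AM h_meas by (intro borel_measurable_scaleR) auto
        show "AE x in M. norm (indicator (A n) x *\<^sub>R ?h x) \<le> norm (?h x)" for n
          by (auto simp: indicator_def)
        have "AE x in M. x \<noteq> 0"
          using M0 by (intro AE_I [where N = "{0}"]) (auto simp: sets_M)
        then show "AE x in M. (\<lambda>n. indicator (A n) x *\<^sub>R ?h x) \<longlonglongrightarrow> ?h x"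
        proof eventually_elim
          case (elim x)
          then have "\<forall>\<^sub>F n in sequentially. 1 / Suc n < norm x"
            by (intro order_tendstoD(2) [OF inv]) auto
          then have "\<forall>\<^sub>F n in sequentially. indicator (A n) x *\<^sub>R ?h x = ?h x"
            by eventually_elim (simp add: A_def)
          then show ?case by (rule tendsto_eventually)
        qed
      qed (use h_meas f(3) in auto)
    qed
    ultimately have "(\<lambda>n. ((1 + w n / m n) ^ m n / exp (w n)) * exp (\<zeta> * complex_of_real (u \<bullet> b) + (CLINT x:A n|M. ?h x)))
        \<longlonglongrightarrow> 1 * exp (\<zeta> * complex_of_real (u \<bullet> b) + (CLINT x|M. ?h x))"
      by (intro tendsto_mult tendsto_exp)
    moreover have "((1 + w n / m n) ^ m n / exp (w n)) * exp (\<zeta> * complex_of_real (u \<bullet> b) + (CLINT x:A n|M. ?h x))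
        = exp (\<zeta> * complex_of_real (u \<bullet> \<beta> n)) * (CLINT \<omega>|P n. \<Prod>j<m n. f (\<omega> j))" for n
    proof -
      have "\<zeta> * complex_of_real (u \<bullet> b) + (CLINT x:A n|M. ?h x) = \<zeta> * complex_of_real (u \<bullet> \<beta> n) + w n"
        using steps [of n] by (simp only: w_def)
      moreover have "(CLINT \<omega>|P n. \<Prod>j<m n. f (\<omega> j)) = (1 + w n / m n) ^ m n"
        using steps [of n] by (simp only: w_def)
      ultimately show ?thesis
        by (simp only: exp_add) simp
    qed
    ultimately show "(\<lambda>n. exp (\<zeta> * complex_of_real (u \<bullet> \<beta> n)) * (CLINT \<omega>|P n. \<Prod>j<m n. f (\<omega> j)))
        \<longlonglongrightarrow> exp (\<zeta> * complex_of_real (u \<bullet> b) + (CLINT x|M. ?h x))"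
      by simp
  qed
  then show ?thesis by blast
qed

section \<open>Products of exponential weights over the jumps\<close>

text \<open>Exponentials of linear functionals factor over sums of independent jumps, whereas exponentials of the
  norm do not; a norm is at most the dimension times its largest coordinate.\<close>

lemma exp_norm_le_sum_exp_inner:
  fixes \<kappa> :: real
  assumes "\<kappa> \<ge> 0"
  shows "\<exists>U::'a::euclidean_space set. finite U \<and> (\<forall>x. exp (\<kappa> * norm x) \<le> (\<Sum>u\<in>U. exp (u \<bullet> x)))"
proof -
  define c where "c = \<kappa> * DIM('a)"
  define U :: "'a set" where "U = (\<lambda>i. c *\<^sub>R i) ` Basis \<union> (\<lambda>i. - c *\<^sub>R i) ` Basis"
  have U: "finite U" by (simp add: U_def)
  moreover have "exp (\<kappa> * norm x) \<le> (\<Sum>u\<in>U. exp (u \<bullet> x))" for x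
  proof -
    obtain i where i: "i \<in> Basis" "\<And>j. j \<in> Basis \<Longrightarrow> \<bar>x \<bullet> j\<bar> \<le> \<bar>x \<bullet> i\<bar>"
      using obtains_MAX [OF finite_Basis nonempty_Basis, of "\<lambda>i. \<bar>x \<bullet> i\<bar>"]
      by (metis Max_ge finite_Basis finite_imageI imageI)
    have "norm x \<le> (\<Sum>j\<in>Basis. \<bar>x \<bullet> j\<bar>)"
      by (rule norm_le_l1)
    also have "\<dots> \<le> DIM('a) * \<bar>x \<bullet> i\<bar>"
      by (rule sum_bounded_above) (rule i(2))
    finally have "\<kappa> * norm x \<le> c * \<bar>x \<bullet> i\<bar>"
      using assms mult_left_mono [of "norm x" _ \<kappa>] by (simp add: c_def mult.assoc)
    moreover obtain u where u: "u \<in> U" "u \<bullet> x = c * \<bar>x \<bullet> i\<bar>"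
    proof (cases "x \<bullet> i \<ge> 0")
      case True
      then show ?thesis using i(1) by (intro that [of "c *\<^sub>R i"]) (auto simp: U_def inner_commute)
    next
      case False
      then show ?thesis using i(1) by (intro that [of "- c *\<^sub>R i"]) (auto simp: U_def inner_commute)
    qed
    moreover have "exp (u \<bullet> x) \<le> (\<Sum>u\<in>U. exp (u \<bullet> x))"
      using U u by (intro member_le_sum) auto
    ultimately show ?thesis
      by (smt (verit) exp_le_cancel_iff)
  qed
  ultimately show ?thesis by blast
qed

text \<open>The weight, once centred, is of second order at 0, which is what a Levy measure integrates. The
  centering function \<open>x / (1 + |x|^2)\<close> differs from \<open>x\<close> by a term of third order.\<close>

lemma exp_minus_centering_bound:
  fixes u x :: "'a::euclidean_space" and \<zeta> :: complex
  assumes x: "norm x \<le> 1"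
  defines "B \<equiv> norm \<zeta> * norm u"
  shows "norm (exp (\<zeta> * complex_of_real (u \<bullet> x)) - 1 - \<zeta> * complex_of_real (u \<bullet> x / (1 + (norm x)\<^sup>2)))
      \<le> (B\<^sup>2 * exp B + B) * (norm x)\<^sup>2"
proof -
  define w where "w = \<zeta> * complex_of_real (u \<bullet> x)"
  have B: "B \<ge> 0" by (simp add: B_def)
  have "norm w = norm \<zeta> * \<bar>u \<bullet> x\<bar>"
    by (simp add: w_def norm_mult)
  also have "\<dots> \<le> norm \<zeta> * (norm u * norm x)"
    by (intro mult_left_mono Cauchy_Schwarz_ineq2) auto
  finally have w: "norm w \<le> B * norm x" by (simp add: B_def)
  have wB: "norm w \<le> B"
    using w mult_left_mono [OF x B] by simp
  have "norm (exp w - (\<Sum>k\<le>1. w ^ k / fact k)) \<le> exp \<bar>Re w\<bar> * norm w ^ Suc 1 / fact 1"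
    by (rule Taylor_exp)
  then have "norm (exp w - 1 - w) \<le> exp \<bar>Re w\<bar> * (norm w)\<^sup>2"
    by (simp add: power2_eq_square algebra_simps)
  also have "\<dots> \<le> exp B * (B * norm x)\<^sup>2"
    using abs_Re_le_cmod [of w] wB w by (intro mult_mono power_mono) auto
  finally have 1: "norm (exp w - 1 - w) \<le> B\<^sup>2 * exp B * (norm x)\<^sup>2"
    by (simp add: power_mult_distrib mult_ac)
  have pos: "1 + (norm x)\<^sup>2 > 0"
    by (rule add_pos_nonneg) auto
  have "r - r / (1 + (norm x)\<^sup>2) = r * ((norm x)\<^sup>2 / (1 + (norm x)\<^sup>2))" for r :: real
    using pos by (simp add: field_simps)
  then have "w - \<zeta> * complex_of_real (u \<bullet> x / (1 + (norm x)\<^sup>2)) = w * complex_of_real ((norm x)\<^sup>2 / (1 + (norm x)\<^sup>2))"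
    unfolding w_def right_diff_distrib [symmetric] of_real_diff [symmetric] mult.assoc of_real_mult [symmetric]
    by (simp only:)
  then have "norm (w - \<zeta> * complex_of_real (u \<bullet> x / (1 + (norm x)\<^sup>2))) = norm w * ((norm x)\<^sup>2 / (1 + (norm x)\<^sup>2))"
    by (simp only: norm_mult norm_of_real) simp
  also have "\<dots> \<le> B * (norm x)\<^sup>2"
  proof (intro mult_mono wB B)
    have "(norm x)\<^sup>2 / (1 + (norm x)\<^sup>2) \<le> (norm x)\<^sup>2 / 1"
      by (rule divide_left_mono) (use pos in auto)
    then show "(norm x)\<^sup>2 / (1 + (norm x)\<^sup>2) \<le> (norm x)\<^sup>2" by simp
  qed (use pos in auto)
  finally have 2: "norm (w - \<zeta> * complex_of_real (u \<bullet> x / (1 + (norm x)\<^sup>2))) \<le> B * (norm x)\<^sup>2" .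
  have eq: "exp w - 1 - \<zeta> * complex_of_real (u \<bullet> x / (1 + (norm x)\<^sup>2))
      = (exp w - 1 - w) + (w - \<zeta> * complex_of_real (u \<bullet> x / (1 + (norm x)\<^sup>2)))"
    by simp
  show ?thesis
    unfolding w_def [symmetric] eq distrib_right by (rule norm_triangle_mono [OF 1 2])
qed

text \<open>Small jumps are handled by the second-order bound, large ones by the finiteness of \<open>M\<close> on \<open>|x| > 1\<close>, where
  the centering is bounded.\<close>

lemma integrable_compensated:
  fixes M :: "'a::euclidean_space measure" and f :: "'a \<Rightarrow> complex"
  assumes levy: "levy_measure M" and f: "f \<in> borel_measurable borel"
    and small: "\<And>x. norm x \<le> 1 \<Longrightarrow> f x = exp (\<zeta> * complex_of_real (u \<bullet> x))"
    and large: "set_integrable M {x. 1 < norm x} f"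
  shows "integrable M (\<lambda>x. f x - 1 - \<zeta> * complex_of_real (u \<bullet> x / (1 + (norm x)\<^sup>2)))"
proof -
  have sets_M [measurable_cong]: "sets M = sets borel"
    using levy by (simp add: levy_measure_def)
  note f [measurable]
  let ?c = "\<lambda>x. \<zeta> * complex_of_real (u \<bullet> x / (1 + (norm x)\<^sup>2))"
  let ?L = "{x::'a. 1 < norm x}"
  have L: "?L \<in> sets M" by (simp add: sets_M)
  have fin: "emeasure M ?L < \<infinity>"
    by (rule levy_measure_large_finite [OF levy]) simp
  have c_le: "norm (1 + ?c x) \<le> 1 + norm \<zeta> * norm u" for x
  proof -
    have "norm (?c x) \<le> norm \<zeta> * norm u"
      unfolding norm_mult norm_of_real by (intro mult_left_mono centering_bound) simp
    then show ?thesis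
      by (intro norm_triangle_le) simp
  qed
  have "set_integrable M ?L (\<lambda>x. 1 + ?c x)"
    unfolding set_integrable_def
    by (rule integrableI_bounded_set_indicator [OF L _ fin, of _ "1 + norm \<zeta> * norm u"])
       (use c_le in auto)
  with large have "set_integrable M ?L (\<lambda>x. f x - (1 + ?c x))"
    by (rule set_integral_diff)
  then have i1: "set_integrable M ?L (\<lambda>x. f x - 1 - ?c x)"
    by (simp add: diff_diff_eq)
  define C where "C = (norm \<zeta> * norm u)\<^sup>2 * exp (norm \<zeta> * norm u) + norm \<zeta> * norm u"
  have i2: "set_integrable M (- ?L) (\<lambda>x. f x - 1 - ?c x)"
    unfolding set_integrable_def
  proof (rule Bochner_Integration.integrable_bound)
    have "integrable M (\<lambda>x. min ((norm x)\<^sup>2) 1)"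
      using levy by (intro integrableI_bounded) (auto simp: levy_measure_def)
    then show "integrable M (\<lambda>x. C * min ((norm x)\<^sup>2) 1)"
      by (rule integrable_mult_right)
    show "AE x in M. norm (indicator (- ?L) x *\<^sub>R (f x - 1 - ?c x)) \<le> norm (C * min ((norm x)\<^sup>2) 1)"
    proof (rule AE_I2)
      fix x
      show "norm (indicator (- ?L) x *\<^sub>R (f x - 1 - ?c x)) \<le> norm (C * min ((norm x)\<^sup>2) 1)"
      proof (cases "norm x \<le> 1")
        case True
        then have "norm (f x - 1 - ?c x) \<le> C * (norm x)\<^sup>2"
          unfolding small [OF True] C_def by (rule exp_minus_centering_bound)
        moreover have "min ((norm x)\<^sup>2) 1 = (norm x)\<^sup>2"
          using True by (simp add: min_def power_le_one)
        moreover have "indicator (- ?L) x = (1 :: real)"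
          using True by (simp add: indicator_def)
        ultimately show ?thesis
          by (simp only: scaleR_one real_norm_def)
      qed (simp add: indicator_def)
    qed
  qed simp
  have "set_integrable M (?L \<union> - ?L) (\<lambda>x. f x - 1 - ?c x)"
    using L by (intro set_integrable_Un i1 i2) (auto simp: sets_M)
  then show ?thesis
    by (simp add: set_integrable_def)
qed

text \<open>Small jumps are weighted exponentially, so that their weights collect into the exponential of a sum;
  large jumps have an arbitrary weight \<open>k\<close>, for which only integrability is required.\<close>

definition jump_weight :: "('a::euclidean_space \<Rightarrow> real) \<Rightarrow> 'a \<Rightarrow> 'a \<Rightarrow> real" where
  "jump_weight k u x = (if norm x \<le> 1 then exp (u \<bullet> x) else k x)"

text \<open>With weight 0 on the large jumps, this is, in the limit law, the logarithm of the expectation of \<open>exp (u \<bullet> x)\<close> for the drift and the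
  small jumps, restricted to the event that there is no large jump.\<close>

definition small_jump_exponent :: "'a::euclidean_space measure \<Rightarrow> 'a \<Rightarrow> 'a \<Rightarrow> real" where
  "small_jump_exponent M b u =
     u \<bullet> b + (LINT x|M. jump_weight (\<lambda>_. 0) u x - 1 - u \<bullet> x / (1 + (norm x)\<^sup>2))"

locale levy_null_array = null_array +
  assumes levy: "levy_measure M"
begin

definition total :: "nat \<Rightarrow> (nat \<Rightarrow> 'a) \<Rightarrow> 'a" where
  "total n \<omega> = \<beta> n + (\<Sum>j<m n. \<omega> j)"

lemma measurable_total [measurable]: "total n \<in> borel_measurable (P n)"
  unfolding total_def
  by (intro borel_measurable_add borel_measurable_const borel_measurable_sum measurable_coordinate) auto

lemma char_fun_total_tendsto:
  assumes "is_ID M b \<mu>"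
  shows "(\<lambda>n. CLINT \<omega>|P n. iexp (z \<bullet> total n \<omega>)) \<longlonglongrightarrow> char_fun \<mu> z"
proof -
  let ?f = "\<lambda>x. exp (\<i> * complex_of_real (z \<bullet> x))"
  have sets_M [measurable_cong]: "sets M = sets borel"
    using levy by (simp add: levy_measure_def)
  have "set_integrable M {x. 1 < norm x} ?f"
    unfolding set_integrable_def
    using levy_measure_large_finite [OF levy, of 1]
    by (intro integrableI_bounded_set_indicator [of _ _ _ 1]) (auto simp: sets_M)
  then have int: "integrable M (\<lambda>x. ?f x - 1 - \<i> * complex_of_real (z \<bullet> x / (1 + (norm x)\<^sup>2)))"
    by (intro integrable_compensated levy) auto
  have "iexp (z \<bullet> total n \<omega>) = iexp (z \<bullet> \<beta> n) * (\<Prod>j<m n. ?f (\<omega> j))" for n \<omega>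
    by (simp add: total_def inner_add_right inner_sum_right distrib_left exp_add sum_distrib_left exp_sum)
  then show ?thesis
    using integral_prod_tendsto [OF _ _ int] assms
    by (simp add: is_ID_def inner_commute [of b z])
qed

text \<open>In the limit the large jumps contribute their integral additively to the exponent, separately from
  \<open>u\<close>. Bounds that are uniform in \<open>k\<close> rest on this separation.\<close>

lemma jump_weight_prod:
  assumes k [measurable]: "k \<in> borel_measurable borel" and int_k: "set_integrable M {x. 1 < norm x} k"
  shows integrable_jump_weight: "integrable (P n) (\<lambda>\<omega>. \<Prod>j<m n. jump_weight k u (\<omega> j))"
    and jump_weight_tendsto: "(\<lambda>n. exp (u \<bullet> \<beta> n) * (LINT \<omega>|P n. (\<Prod>j<m n. jump_weight k u (\<omega> j))))
      \<longlonglongrightarrow> exp (small_jump_exponent M b u + (LINT x:{x. 1 < norm x}|M. k x))"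
proof -
  let ?L = "{x::'a. 1 < norm x}"
  have compensated: "integrable M (\<lambda>x. complex_of_real (jump_weight k u x) - 1 - 1 * complex_of_real (u \<bullet> x / (1 + (norm x)\<^sup>2)))"
    if k [measurable]: "k \<in> borel_measurable borel" and int: "set_integrable M ?L k" for k
  proof (rule integrable_compensated [OF levy])
    show "(\<lambda>x. complex_of_real (jump_weight k u x)) \<in> borel_measurable borel"
      unfolding jump_weight_def by measurable
    show "complex_of_real (jump_weight k u x) = exp (1 * complex_of_real (u \<bullet> x))" if "norm x \<le> 1" for x
      using that by (simp add: jump_weight_def exp_of_real)
    have "integrable M (\<lambda>x. complex_of_real (indicator ?L x *\<^sub>R k x))"
      using int unfolding set_integrable_def by (rule integrable_of_real)
    also have "(\<lambda>x. complex_of_real (indicator ?L x *\<^sub>R k x))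
        = (\<lambda>x. indicator ?L x *\<^sub>R complex_of_real (jump_weight k u x))"
      by (auto simp: jump_weight_def indicator_def)
    finally show "set_integrable M ?L (\<lambda>x. complex_of_real (jump_weight k u x))"
      by (simp add: set_integrable_def)
  qed
  have compensated_real: "integrable M (\<lambda>x. jump_weight k u x - 1 - u \<bullet> x / (1 + (norm x)\<^sup>2))"
    if "k \<in> borel_measurable borel" "set_integrable M ?L k" for k
    using integrable_Re [OF compensated [OF that]] by simp
  have meas: "(\<lambda>x. complex_of_real (jump_weight k u x)) \<in> borel_measurable borel"
    unfolding jump_weight_def by measurable
  have zero: "complex_of_real (jump_weight k u 0) = 1"
    by (simp add: jump_weight_def)
  have int: "integrable (P n) (\<lambda>\<omega>. \<Prod>j<m n. complex_of_real (jump_weight k u (\<omega> j)))" for n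
    by (rule integrable_prod [OF meas zero compensated [OF k int_k]])
  from integrable_Re [OF int]
  show "integrable (P n) (\<lambda>\<omega>. \<Prod>j<m n. jump_weight k u (\<omega> j))"
    by (simp flip: of_real_prod)
  have "(LINT x|M. jump_weight k u x - 1 - u \<bullet> x / (1 + (norm x)\<^sup>2))
      = (LINT x|M. (jump_weight (\<lambda>_. 0) u x - 1 - u \<bullet> x / (1 + (norm x)\<^sup>2)) + indicator ?L x *\<^sub>R k x)"
    by (intro Bochner_Integration.integral_cong) (auto simp: jump_weight_def indicator_def)
  also have "\<dots> = (LINT x|M. jump_weight (\<lambda>_. 0) u x - 1 - u \<bullet> x / (1 + (norm x)\<^sup>2)) + (LINT x:?L|M. k x)"
    unfolding set_lebesgue_integral_def
    by (intro Bochner_Integration.integral_add compensated_real)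
       (use int_k in \<open>auto simp: set_integrable_def\<close>)
  finally have exponent: "u \<bullet> b + (LINT x|M. jump_weight k u x - 1 - u \<bullet> x / (1 + (norm x)\<^sup>2))
      = small_jump_exponent M b u + (LINT x:?L|M. k x)"
    by (simp add: small_jump_exponent_def)
  have lim: "(\<lambda>n. exp (1 * complex_of_real (u \<bullet> \<beta> n)) * (CLINT \<omega>|P n. \<Prod>j<m n. complex_of_real (jump_weight k u (\<omega> j))))
      \<longlonglongrightarrow> exp (1 * complex_of_real (u \<bullet> b) + (CLINT x|M. complex_of_real (jump_weight k u x) - 1 - 1 * complex_of_real (u \<bullet> x / (1 + (norm x)\<^sup>2))))"
    by (rule integral_prod_tendsto [OF meas zero compensated [OF k int_k]])
  have l: "exp (1 * complex_of_real (u \<bullet> \<beta> n)) * (CLINT \<omega>|P n. \<Prod>j<m n. complex_of_real (jump_weight k u (\<omega> j)))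
      = complex_of_real (exp (u \<bullet> \<beta> n) * (LINT \<omega>|P n. (\<Prod>j<m n. jump_weight k u (\<omega> j))))" for n
    by (simp add: exp_of_real flip: of_real_prod)
  have "(CLINT x|M. complex_of_real (jump_weight k u x) - 1 - 1 * complex_of_real (u \<bullet> x / (1 + (norm x)\<^sup>2)))
      = (CLINT x|M. complex_of_real (jump_weight k u x - 1 - u \<bullet> x / (1 + (norm x)\<^sup>2)))"
    by simp
  then have "exp (1 * complex_of_real (u \<bullet> b) + (CLINT x|M. complex_of_real (jump_weight k u x) - 1 - 1 * complex_of_real (u \<bullet> x / (1 + (norm x)\<^sup>2))))
      = complex_of_real (exp (u \<bullet> b + (LINT x|M. jump_weight k u x - 1 - u \<bullet> x / (1 + (norm x)\<^sup>2))))"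
    by (simp only: integral_complex_of_real mult_1 of_real_add [symmetric] exp_of_real)
  with lim l exponent
  show "(\<lambda>n. exp (u \<bullet> \<beta> n) * (LINT \<omega>|P n. (\<Prod>j<m n. jump_weight k u (\<omega> j))))
      \<longlonglongrightarrow> exp (small_jump_exponent M b u + (LINT x:?L|M. k x))"
    by (simp only: tendsto_of_real_iff)
qed

end

section \<open>Finiteness of submultiplicative moments\<close>

text \<open>Completing the square in the norm leaves half of the Gaussian exponent, whose integral is a product over the
  coordinates.\<close>

lemma nn_integral_gaussian_exp_norm_finite:
  "(\<integral>\<^sup>+z. ennreal (exp (\<kappa> * norm z - (norm z)\<^sup>2)) \<partial>(lborel :: 'a::euclidean_space measure)) < \<infinity>"
proof -
  have "(\<integral>\<^sup>+z. ennreal (exp (\<kappa> * norm z - (norm z)\<^sup>2)) \<partial>(lborel :: 'a measure))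
      \<le> (\<integral>\<^sup>+z. ennreal (exp (\<kappa>\<^sup>2 / 2)) * (\<Prod>i\<in>Basis. ennreal (exp (- ((z \<bullet> i)\<^sup>2 / 2)))) \<partial>(lborel :: 'a measure))"
  proof (intro nn_integral_mono)
    fix z :: 'a
    have "\<kappa> * norm z \<le> \<kappa>\<^sup>2 / 2 + (norm z)\<^sup>2 / 2"
      using zero_le_power2 [of "\<kappa> - norm z"] by (simp add: power2_diff)
    then have "exp (\<kappa> * norm z - (norm z)\<^sup>2) \<le> exp (\<kappa>\<^sup>2 / 2 + - ((norm z)\<^sup>2 / 2))"
      by simp
    also have "(norm z)\<^sup>2 / 2 = (\<Sum>i\<in>Basis. (z \<bullet> i)\<^sup>2 / 2)"
      by (simp add: norm_eq_sqrt_inner euclidean_inner [of z z] sum_divide_distrib power2_eq_square sum_nonneg)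
    also have "exp (\<kappa>\<^sup>2 / 2 + - (\<Sum>i\<in>Basis. (z \<bullet> i)\<^sup>2 / 2)) = exp (\<kappa>\<^sup>2 / 2) * (\<Prod>i\<in>Basis. exp (- ((z \<bullet> i)\<^sup>2 / 2)))"
      by (simp only: exp_add sum_negf [symmetric] exp_sum finite_Basis)
    finally show "ennreal (exp (\<kappa> * norm z - (norm z)\<^sup>2))
        \<le> ennreal (exp (\<kappa>\<^sup>2 / 2)) * (\<Prod>i\<in>Basis. ennreal (exp (- ((z \<bullet> i)\<^sup>2 / 2))))"
      by (simp add: prod_ennreal prod_nonneg flip: ennreal_mult)
  qed
  also have "\<dots> = ennreal (exp (\<kappa>\<^sup>2 / 2)) * (\<Prod>i\<in>(Basis::'a set). (\<integral>\<^sup>+t. ennreal (exp (- (t\<^sup>2 / 2))) \<partial>lborel))"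
    by (subst nn_integral_cmult, measurable, subst nn_integral_lborel_prod) auto
  also have "\<dots> < \<infinity>"
  proof -
    have "(\<integral>\<^sup>+t. ennreal (exp (- (t\<^sup>2 / 2))) \<partial>lborel) = (\<integral>\<^sup>+t. ennreal (sqrt (2 * pi) * std_normal_density t) \<partial>lborel)"
      by (simp add: std_normal_density_def)
    also have "\<dots> = ennreal (\<integral>t. sqrt (2 * pi) * std_normal_density t \<partial>lborel)"
      by (intro nn_integral_eq_integral integrable_mult_right integrable_normal_density)
         (auto simp: normal_density_nonneg)
    finally show ?thesis
      by (auto simp: ennreal_mult_less_top power_less_top_ennreal)
  qed
  finally show ?thesis .
qed

context levy_null_array
begin

definition large_indices :: "nat \<Rightarrow> (nat \<Rightarrow> 'a) \<Rightarrow> nat set" where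
  "large_indices n \<omega> = {j. j < m n \<and> 1 < norm (\<omega> j)}"

definition small_part :: "nat \<Rightarrow> (nat \<Rightarrow> 'a) \<Rightarrow> 'a" where
  "small_part n \<omega> = \<beta> n + (\<Sum>j\<in>{..<m n} - large_indices n \<omega>. \<omega> j)"

lemma finite_large_indices [simp]: "finite (large_indices n \<omega>)"
  by (simp add: large_indices_def)

lemma large_indices_subset: "large_indices n \<omega> \<subseteq> {..<m n}"
  by (auto simp: large_indices_def)

lemma total_eq_small_part: "total n \<omega> = small_part n \<omega> + (\<Sum>j\<in>large_indices n \<omega>. \<omega> j)"
  using sum.subset_diff [OF large_indices_subset [of n \<omega>], of \<omega>]
  by (simp add: total_def small_part_def)

text \<open>The small jumps and the drift together form one vector, so their weight sees only that vector.\<close>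

lemma jump_weight_prod_eq:
  "exp (u \<bullet> \<beta> n) * (\<Prod>j<m n. jump_weight k u (\<omega> j))
    = exp (u \<bullet> small_part n \<omega>) * (\<Prod>j\<in>large_indices n \<omega>. k (\<omega> j))"
proof -
  let ?L = "large_indices n \<omega>"
  have "(\<Prod>j<m n. jump_weight k u (\<omega> j))
      = (\<Prod>j\<in>{..<m n} - ?L. jump_weight k u (\<omega> j)) * (\<Prod>j\<in>?L. jump_weight k u (\<omega> j))"
    by (rule prod.subset_diff [OF large_indices_subset]) simp
  also have "(\<Prod>j\<in>?L. jump_weight k u (\<omega> j)) = (\<Prod>j\<in>?L. k (\<omega> j))"
    by (intro prod.cong refl) (auto simp: large_indices_def jump_weight_def)
  also have "(\<Prod>j\<in>{..<m n} - ?L. jump_weight k u (\<omega> j)) = (\<Prod>j\<in>{..<m n} - ?L. exp (u \<bullet> \<omega> j))"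
    by (intro prod.cong refl) (auto simp: large_indices_def jump_weight_def)
  also have "\<dots> = exp (u \<bullet> (\<Sum>j\<in>{..<m n} - ?L. \<omega> j))"
    by (simp add: exp_sum inner_sum_right)
  finally show ?thesis
    by (simp add: small_part_def inner_add_right exp_add)
qed

end

lemma submultiplicative_sum:
  fixes g :: "'a::real_vector \<Rightarrow> real"
  assumes "\<And>x. 0 < g x" and "\<And>x y. g (x + y) \<le> g x * g y" and "finite J"
  shows "g (y + (\<Sum>j\<in>J. h j)) \<le> g y * (\<Prod>j\<in>J. g (h j))"
  using assms(3)
proof induction
  case (insert j J)
  have "g (y + (\<Sum>j\<in>insert j J. h j)) = g ((y + (\<Sum>j\<in>J. h j)) + h j)"
    using insert by (simp add: ac_simps)
  also have "\<dots> \<le> g (y + (\<Sum>j\<in>J. h j)) * g (h j)"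
    by (rule assms(2))
  also have "\<dots> \<le> (g y * (\<Prod>j\<in>J. g (h j))) * g (h j)"
    using insert assms(1) [of "h j"] by (intro mult_right_mono) auto
  finally show ?case
    using insert by (simp add: ac_simps)
qed simp

text \<open>Submultiplicativity peels off the large jumps one by one, and the growth bound replaces \<open>g\<close> of the remaining
  small part by finitely many exponentials. Each of the resulting products is a product of jump
  weights, whose expectation converges.\<close>

lemma (in levy_null_array) submultiplicative_moment_total_bound:
  fixes g :: "'a \<Rightarrow> real"
  assumes g [measurable]: "g \<in> borel_measurable borel"
    and pos: "\<And>x. 0 < g x" and submult: "\<And>x y. g (x + y) \<le> g x * g y"
    and growth: "\<And>x. g x \<le> A * exp (\<kappa> * norm x)" and "\<kappa> \<ge> 0"
    and large: "(\<integral>\<^sup>+x\<in>{x. 1 < norm x}. ennreal (g x) \<partial>M) < \<infinity>"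
  shows "\<exists>a l. a \<longlonglongrightarrow> l \<and> (\<forall>n. (\<integral>\<^sup>+\<omega>. ennreal (g (total n \<omega>)) \<partial>P n) \<le> ennreal (a n))"
proof -
  obtain U :: "'a set" where U: "finite U" "\<And>x. exp (\<kappa> * norm x) \<le> (\<Sum>u\<in>U. exp (u \<bullet> x))"
    using exp_norm_le_sum_exp_inner [OF \<open>\<kappa> \<ge> 0\<close>] by blast
  have "0 < A * exp (\<kappa> * norm (0::'a))"
    using pos growth by (rule less_le_trans)
  then have A: "A > 0" by simp
  have sets_M [measurable_cong]: "sets M = sets borel"
    using levy by (simp add: levy_measure_def)
  have int: "set_integrable M {x. 1 < norm x} g"
    unfolding set_integrable_def
  proof (rule integrableI_bounded)
    have "(\<integral>\<^sup>+x. ennreal (norm (indicator {x. 1 < norm x} x *\<^sub>R g x)) \<partial>M)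
        = (\<integral>\<^sup>+x\<in>{x. 1 < norm x}. ennreal (g x) \<partial>M)"
      using pos by (intro nn_integral_cong) (auto simp: indicator_def less_imp_le)
    then show "(\<integral>\<^sup>+x. ennreal (norm (indicator {x. 1 < norm x} x *\<^sub>R g x)) \<partial>M) < \<infinity>"
      using large by simp
  qed measurable
  define I where "I n u = (LINT \<omega>|P n. (\<Prod>j<m n. jump_weight g u (\<omega> j)))" for n u
  define a where "a n = A * (\<Sum>u\<in>U. exp (u \<bullet> \<beta> n) * I n u)" for n
  have "a \<longlonglongrightarrow> A * (\<Sum>u\<in>U. exp (small_jump_exponent M b u + (LINT x:{x. 1 < norm x}|M. g x)))"
    unfolding a_def I_def
    by (intro tendsto_mult tendsto_const tendsto_sum jump_weight_tendsto g int)
  moreover have "(\<integral>\<^sup>+\<omega>. ennreal (g (total n \<omega>)) \<partial>P n) \<le> ennreal (a n)" for n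
  proof -
    have "g (total n \<omega>) \<le> A * (\<Sum>u\<in>U. exp (u \<bullet> \<beta> n) * (\<Prod>j<m n. jump_weight g u (\<omega> j)))" for \<omega>
    proof -
      let ?p = "\<Prod>j\<in>large_indices n \<omega>. g (\<omega> j)"
      have "g (total n \<omega>) \<le> g (small_part n \<omega>) * ?p"
        unfolding total_eq_small_part by (rule submultiplicative_sum [OF pos submult]) simp
      also have "\<dots> \<le> (A * (\<Sum>u\<in>U. exp (u \<bullet> small_part n \<omega>))) * ?p"
      proof (rule mult_right_mono)
        show "g (small_part n \<omega>) \<le> A * (\<Sum>u\<in>U. exp (u \<bullet> small_part n \<omega>))"
          using growth [of "small_part n \<omega>"] mult_left_mono [OF U(2) [of "small_part n \<omega>"], of A] A by linarith
      qed (use pos in \<open>auto intro!: prod_nonneg simp: less_imp_le\<close>)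
      finally show ?thesis
        by (simp add: jump_weight_prod_eq sum_distrib_right mult.assoc)
    qed
    then have "(\<integral>\<^sup>+\<omega>. ennreal (g (total n \<omega>)) \<partial>P n)
        \<le> (\<integral>\<^sup>+\<omega>. ennreal (A * (\<Sum>u\<in>U. exp (u \<bullet> \<beta> n) * (\<Prod>j<m n. jump_weight g u (\<omega> j)))) \<partial>P n)"
      by (intro nn_integral_mono ennreal_leI)
    also have "\<dots> = ennreal (LINT \<omega>|P n. A * (\<Sum>u\<in>U. exp (u \<bullet> \<beta> n) * (\<Prod>j<m n. jump_weight g u (\<omega> j))))"
    proof (rule nn_integral_eq_integral)
      show "integrable (P n) (\<lambda>\<omega>. A * (\<Sum>u\<in>U. exp (u \<bullet> \<beta> n) * (\<Prod>j<m n. jump_weight g u (\<omega> j))))"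
        by (intro integrable_mult_right Bochner_Integration.integrable_sum integrable_jump_weight g int)
      have "0 \<le> jump_weight g u x" for u x
        using pos [of x] by (simp add: jump_weight_def)
      then show "AE \<omega> in P n. 0 \<le> A * (\<Sum>u\<in>U. exp (u \<bullet> \<beta> n) * (\<Prod>j<m n. jump_weight g u (\<omega> j)))"
        using A by (intro AE_I2 mult_nonneg_nonneg sum_nonneg prod_nonneg) auto
    qed
    also have "(LINT \<omega>|P n. A * (\<Sum>u\<in>U. exp (u \<bullet> \<beta> n) * (\<Prod>j<m n. jump_weight g u (\<omega> j)))) = a n"
      unfolding a_def I_def
      by (simp add: Bochner_Integration.integral_sum integrable_jump_weight [OF g int])
    finally show ?thesis .
  qed
  ultimately show ?thesis by blast
qed

lemma nn_integral_gaussian_smoothing: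
  fixes X :: "'b \<Rightarrow> 'a::euclidean_space" and g :: "'a \<Rightarrow> real"
  assumes Q: "prob_space Q" and [measurable]: "X \<in> borel_measurable Q" "g \<in> borel_measurable borel"
  shows "(\<integral>\<^sup>+\<omega>. (\<integral>\<^sup>+y. ennreal (g y) * ennreal (exp (- ((norm (X \<omega> - y))\<^sup>2))) \<partial>lborel) \<partial>Q)
    = (\<integral>\<^sup>+y. ennreal (g y) * ennreal (\<integral>\<omega>. exp (- ((norm (X \<omega> - y))\<^sup>2)) \<partial>Q) \<partial>lborel)"
proof -
  interpret Q: prob_space Q by fact
  interpret pair_sigma_finite Q "lborel :: 'a measure" ..
  have "(\<integral>\<^sup>+\<omega>. (\<integral>\<^sup>+y. ennreal (g y) * ennreal (exp (- ((norm (X \<omega> - y))\<^sup>2))) \<partial>lborel) \<partial>Q)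
      = (\<integral>\<^sup>+y. (\<integral>\<^sup>+\<omega>. ennreal (g y) * ennreal (exp (- ((norm (X \<omega> - y))\<^sup>2))) \<partial>Q) \<partial>lborel)"
    by (rule Fubini' [symmetric]) measurable
  also have "\<dots> = (\<integral>\<^sup>+y. ennreal (g y) * ennreal (\<integral>\<omega>. exp (- ((norm (X \<omega> - y))\<^sup>2)) \<partial>Q) \<partial>lborel)"
  proof (intro nn_integral_cong)
    fix y
    have "integrable Q (\<lambda>\<omega>. exp (- ((norm (X \<omega> - y))\<^sup>2)))"
      by (rule Q.integrable_const_bound [where B = 1]) auto
    then have "(\<integral>\<^sup>+\<omega>. ennreal (exp (- ((norm (X \<omega> - y))\<^sup>2))) \<partial>Q) = ennreal (\<integral>\<omega>. exp (- ((norm (X \<omega> - y))\<^sup>2)) \<partial>Q)"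
      by (rule nn_integral_eq_integral) auto
    then show "(\<integral>\<^sup>+\<omega>. ennreal (g y) * ennreal (exp (- ((norm (X \<omega> - y))\<^sup>2))) \<partial>Q)
        = ennreal (g y) * ennreal (\<integral>\<omega>. exp (- ((norm (X \<omega> - y))\<^sup>2)) \<partial>Q)"
      by (subst nn_integral_cmult) auto
  qed
  finally show ?thesis .
qed

text \<open>Gaussian smoothing changes a submultiplicative function by bounded factors only:
  \<open>g (x + z)\<close> lies between \<open>g x / g (- z)\<close> and \<open>g x * g z\<close>, and the Gaussian integrates the exponential growth of
  \<open>g z\<close>.\<close>

lemma submultiplicative_smoothing_bounds:
  fixes g :: "'a::euclidean_space \<Rightarrow> real"
  assumes g [measurable]: "g \<in> borel_measurable borel"
    and pos: "\<And>x. 0 < g x" and submult: "\<And>x y. g (x + y) \<le> g x * g y"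
    and growth: "\<And>x. g x \<le> A * exp (\<kappa> * norm x)"
  shows "\<exists>c C::ennreal. c > 0 \<and> C < \<infinity> \<and>
    (\<forall>x. c * ennreal (g x) \<le> (\<integral>\<^sup>+y. ennreal (g y) * ennreal (exp (- ((norm (x - y))\<^sup>2))) \<partial>lborel) \<and>
         (\<integral>\<^sup>+y. ennreal (g y) * ennreal (exp (- ((norm (x - y))\<^sup>2))) \<partial>lborel) \<le> C * ennreal (g x))"
proof -
  define c where "c = (\<integral>\<^sup>+z. ennreal (exp (- (\<kappa> * norm z) - (norm z)\<^sup>2) / A) \<partial>(lborel :: 'a measure))"
  define C where "C = ennreal A * (\<integral>\<^sup>+z. ennreal (exp (\<kappa> * norm z - (norm z)\<^sup>2)) \<partial>(lborel :: 'a measure))"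
  have "0 < A * exp (\<kappa> * norm (0::'a))"
    using pos growth by (rule less_le_trans)
  then have A: "A > 0" by simp
  have "c \<noteq> 0"
  proof
    assume "c = 0"
    then have "AE z::'a in lborel. ennreal (exp (- (\<kappa> * norm z) - (norm z)\<^sup>2) / A) = 0"
      unfolding c_def by (subst (asm) nn_integral_0_iff_AE) auto
    then have "AE z::'a in lborel. False"
      using A by simp
    then have "emeasure lborel (UNIV :: 'a set) = 0"
      by (simp add: AE_iff_measurable [of UNIV])
    then show False by simp
  qed
  then have c: "c > 0" by (simp add: zero_less_iff_neq_zero)
  have C: "C < \<infinity>"
    unfolding C_def using nn_integral_gaussian_exp_norm_finite [of \<kappa>, where 'a = 'a]
    by (simp add: ennreal_mult_less_top)
  have shift: "(\<integral>\<^sup>+y. ennreal (g y) * ennreal (exp (- ((norm (x - y))\<^sup>2))) \<partial>lborel)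
      = (\<integral>\<^sup>+z. ennreal (g (x + z)) * ennreal (exp (- ((norm z)\<^sup>2))) \<partial>lborel)" for x
    by (subst lborel_distr_plus [of x, symmetric], subst nn_integral_distr) auto
  have lower: "c * ennreal (g x) \<le> (\<integral>\<^sup>+z. ennreal (g (x + z)) * ennreal (exp (- ((norm z)\<^sup>2))) \<partial>lborel)" for x
  proof -
    have "c * ennreal (g x) = (\<integral>\<^sup>+z. ennreal (exp (- (\<kappa> * norm z) - (norm z)\<^sup>2) / A) * ennreal (g x) \<partial>(lborel :: 'a measure))"
      unfolding c_def by (rule nn_integral_multc [symmetric]) measurable
    also have "\<dots> \<le> (\<integral>\<^sup>+z. ennreal (g (x + z)) * ennreal (exp (- ((norm z)\<^sup>2))) \<partial>lborel)"
    proof (intro nn_integral_mono)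
      fix z
      have "g x \<le> g (x + z) * g (- z)"
        using submult [of "x + z" "- z"] by simp
      also have "\<dots> \<le> g (x + z) * (A * exp (\<kappa> * norm z))"
        using growth [of "- z"] pos [of "x + z"] by (intro mult_left_mono) auto
      finally have "exp (- (\<kappa> * norm z)) / A * exp (- ((norm z)\<^sup>2)) * g x
          \<le> exp (- (\<kappa> * norm z)) / A * exp (- ((norm z)\<^sup>2)) * (g (x + z) * (A * exp (\<kappa> * norm z)))"
        using A by (intro mult_left_mono) auto
      also have "\<dots> = g (x + z) * exp (- ((norm z)\<^sup>2))"
        using A by (simp add: exp_minus)
      finally have "exp (- (\<kappa> * norm z) - (norm z)\<^sup>2) / A * g x \<le> g (x + z) * exp (- ((norm z)\<^sup>2))"
        by (simp add: exp_diff exp_minus field_simps)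
      then show "ennreal (exp (- (\<kappa> * norm z) - (norm z)\<^sup>2) / A) * ennreal (g x)
          \<le> ennreal (g (x + z)) * ennreal (exp (- ((norm z)\<^sup>2)))"
        using A pos [of x] pos [of "x + z"] by (simp add: ennreal_leI flip: ennreal_mult)
    qed
    finally show ?thesis .
  qed
  have upper: "(\<integral>\<^sup>+z. ennreal (g (x + z)) * ennreal (exp (- ((norm z)\<^sup>2))) \<partial>lborel) \<le> C * ennreal (g x)" for x
  proof -
    have "(\<integral>\<^sup>+z. ennreal (g (x + z)) * ennreal (exp (- ((norm z)\<^sup>2))) \<partial>lborel)
        \<le> (\<integral>\<^sup>+z. (ennreal A * ennreal (g x)) * ennreal (exp (\<kappa> * norm z - (norm z)\<^sup>2)) \<partial>(lborel :: 'a measure))"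
    proof (intro nn_integral_mono)
      fix z
      have "g (x + z) \<le> g x * g z" by (rule submult)
      also have "\<dots> \<le> g x * (A * exp (\<kappa> * norm z))"
        using growth [of z] pos [of x] by (intro mult_left_mono) auto
      finally have "g (x + z) * exp (- ((norm z)\<^sup>2)) \<le> g x * (A * exp (\<kappa> * norm z)) * exp (- ((norm z)\<^sup>2))"
        by (intro mult_right_mono) auto
      also have "\<dots> = A * g x * exp (\<kappa> * norm z - (norm z)\<^sup>2)"
        by (simp add: exp_diff exp_minus field_simps)
      finally show "ennreal (g (x + z)) * ennreal (exp (- ((norm z)\<^sup>2)))
          \<le> (ennreal A * ennreal (g x)) * ennreal (exp (\<kappa> * norm z - (norm z)\<^sup>2))"
        using A pos [of x] pos [of "x + z"] by (simp add: ennreal_leI flip: ennreal_mult)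
    qed
    also have "\<dots> = C * ennreal (g x)"
      unfolding C_def by (subst nn_integral_cmult) (auto simp: ac_simps)
    finally show ?thesis .
  qed
  show ?thesis
    using c C lower upper unfolding shift by blast
qed

text \<open>Gaussian kernels \<open>exp (- |x - y|^2)\<close> have convergent expectations for each \<open>y\<close>. Integrating them against
  \<open>g y dy\<close> gives, up to constants, \<open>g\<close> itself, and Fatou's lemma for the integral in \<open>y\<close> keeps the inequality in the
  direction that is needed.\<close>

theorem ID_submultiplicative_moment_finite:
  fixes M \<mu> :: "'a::euclidean_space measure" and g :: "'a \<Rightarrow> real"
  assumes ID: "is_ID M b \<mu>"
    and g [measurable]: "g \<in> borel_measurable borel"
    and pos: "\<And>x. 0 < g x" and submult: "\<And>x y. g (x + y) \<le> g x * g y"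
    and growth: "\<And>x. g x \<le> A * exp (\<kappa> * norm x)" and "\<kappa> \<ge> 0"
    and large: "(\<integral>\<^sup>+x\<in>{x. 1 < norm x}. ennreal (g x) \<partial>M) < \<infinity>"
  shows "(\<integral>\<^sup>+x. ennreal (g x) \<partial>\<mu>) < \<infinity>"
proof -
  have levy: "levy_measure M" and \<mu>: "prob_space \<mu>" and sets_\<mu> [measurable_cong]: "sets \<mu> = sets borel"
    using ID by (simp_all add: is_ID_def)
  obtain P m \<beta> where "null_array M b P m \<beta>"
    using levy_measure_null_array [OF levy] by blast
  then interpret levy_null_array M b P m \<beta>
    by (intro levy_null_array.intro levy_null_array_axioms.intro levy)
  obtain a l where a: "a \<longlonglongrightarrow> l"
    "\<And>n. (\<integral>\<^sup>+\<omega>. ennreal (g (total n \<omega>)) \<partial>P n) \<le> ennreal (a n)"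
    using submultiplicative_moment_total_bound [OF g pos submult growth \<open>\<kappa> \<ge> 0\<close> large] by blast
  obtain c C :: ennreal where c: "c > 0" and C: "C < \<infinity>"
    and lower: "\<And>x. c * ennreal (g x) \<le> (\<integral>\<^sup>+y. ennreal (g y) * ennreal (exp (- ((norm (x - y))\<^sup>2))) \<partial>lborel)"
    and upper: "\<And>x. (\<integral>\<^sup>+y. ennreal (g y) * ennreal (exp (- ((norm (x - y))\<^sup>2))) \<partial>lborel) \<le> C * ennreal (g x)"
    using submultiplicative_smoothing_bounds [OF g pos submult growth] by blast
  let ?e = "\<lambda>x y :: 'a. exp (- ((norm (x - y))\<^sup>2))"
  have id [measurable]: "(\<lambda>x. x) \<in> borel_measurable \<mu>"
    by measurable
  have g\<mu> [measurable]: "(\<lambda>x. ennreal (g x)) \<in> borel_measurable \<mu>"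
    by measurable
  have kernel_meas: "(\<lambda>y. \<integral>\<omega>. ?e (total n \<omega>) y \<partial>P n) \<in> borel_measurable borel" for n
  proof -
    interpret P: prob_space "P n" by (rule prob_space_P)
    show ?thesis by measurable
  qed
  have "c * (\<integral>\<^sup>+x. ennreal (g x) \<partial>\<mu>) = (\<integral>\<^sup>+x. c * ennreal (g x) \<partial>\<mu>)"
    by (rule nn_integral_cmult [symmetric]) measurable
  also have "\<dots> \<le> (\<integral>\<^sup>+x. (\<integral>\<^sup>+y. ennreal (g y) * ennreal (?e x y) \<partial>lborel) \<partial>\<mu>)"
    by (intro nn_integral_mono lower)
  also have "\<dots> = (\<integral>\<^sup>+y. ennreal (g y) * ennreal (\<integral>x. ?e x y \<partial>\<mu>) \<partial>lborel)"
    by (rule nn_integral_gaussian_smoothing [OF \<mu> id g])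
  also have "\<dots> = (\<integral>\<^sup>+y. liminf (\<lambda>n. ennreal (g y) * ennreal (\<integral>\<omega>. ?e (total n \<omega>) y \<partial>P n)) \<partial>lborel)"
  proof (intro nn_integral_cong)
    fix y
    have "(\<lambda>n. \<integral>\<omega>. ?e (total n \<omega>) y \<partial>P n) \<longlonglongrightarrow> (\<integral>x. ?e x y \<partial>\<mu>)"
      using gaussian_kernel_tendsto [OF prob_space_P measurable_total \<mu> sets_\<mu> char_fun_total_tendsto [OF ID], of 1 y]
      by simp
    then have "(\<lambda>n. ennreal (g y) * ennreal (\<integral>\<omega>. ?e (total n \<omega>) y \<partial>P n)) \<longlonglongrightarrow> ennreal (g y) * ennreal (\<integral>x. ?e x y \<partial>\<mu>)"
      by (intro ennreal_tendsto_cmult tendsto_ennrealI) auto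
    then show "ennreal (g y) * ennreal (\<integral>x. ?e x y \<partial>\<mu>)
        = liminf (\<lambda>n. ennreal (g y) * ennreal (\<integral>\<omega>. ?e (total n \<omega>) y \<partial>P n))"
      by (intro lim_imp_Liminf [symmetric]) auto
  qed
  also have "\<dots> \<le> liminf (\<lambda>n. \<integral>\<^sup>+y. ennreal (g y) * ennreal (\<integral>\<omega>. ?e (total n \<omega>) y \<partial>P n) \<partial>lborel)"
    using kernel_meas by (intro nn_integral_liminf) auto
  also have "\<dots> \<le> liminf (\<lambda>n. C * ennreal (a n))"
  proof (rule Liminf_mono, rule always_eventually, rule allI)
    fix n
    have "(\<integral>\<^sup>+y. ennreal (g y) * ennreal (\<integral>\<omega>. ?e (total n \<omega>) y \<partial>P n) \<partial>lborel)
        = (\<integral>\<^sup>+\<omega>. (\<integral>\<^sup>+y. ennreal (g y) * ennreal (?e (total n \<omega>) y) \<partial>lborel) \<partial>P n)"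
      by (rule nn_integral_gaussian_smoothing [OF prob_space_P measurable_total g, symmetric])
    also have "\<dots> \<le> (\<integral>\<^sup>+\<omega>. C * ennreal (g (total n \<omega>)) \<partial>P n)"
      by (intro nn_integral_mono upper)
    also have "\<dots> = C * (\<integral>\<^sup>+\<omega>. ennreal (g (total n \<omega>)) \<partial>P n)"
      by (rule nn_integral_cmult) measurable
    also have "\<dots> \<le> C * ennreal (a n)"
      by (intro mult_left_mono a) simp
    finally show "(\<integral>\<^sup>+y. ennreal (g y) * ennreal (\<integral>\<omega>. ?e (total n \<omega>) y \<partial>P n) \<partial>lborel) \<le> C * ennreal (a n)" .
  qed
  also have "\<dots> = C * ennreal l"
    using C by (intro lim_imp_Liminf ennreal_tendsto_cmult tendsto_ennrealI a) auto
  finally have "c * (\<integral>\<^sup>+x. ennreal (g x) \<partial>\<mu>) \<le> C * ennreal l" .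
  also have "\<dots> < \<infinity>"
    using C by (simp add: ennreal_mult_less_top)
  finally show ?thesis
    using c by (auto simp: ennreal_mult_less_top)
qed

section \<open>Divergence for unbounded Levy measures\<close>

text \<open>A linear exponential damped by a Gaussian is a shifted Gaussian kernel, so its expectation converges exactly;
  letting \<open>\<epsilon>\<close> tend to 0 later removes the damping.\<close>

lemma exp_inner_minus_square_eq:
  fixes v x :: "'a::euclidean_space"
  assumes "norm v = 1" and "\<epsilon> > 0"
  shows "exp (s * (v \<bullet> x) - \<epsilon> * (norm x)\<^sup>2)
    = exp (s\<^sup>2 / (4 * \<epsilon>)) * exp (- (\<epsilon> * (norm (x - (s / (2 * \<epsilon>)) *\<^sub>R v))\<^sup>2))"
proof -
  let ?t = "s / (2 * \<epsilon>)"
  have vv: "v \<bullet> v = 1"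
    using assms(1) by (simp add: dot_square_norm)
  have "(norm (x - ?t *\<^sub>R v))\<^sup>2 = (norm x)\<^sup>2 - 2 * ?t * (v \<bullet> x) + ?t\<^sup>2"
    unfolding power2_norm_eq_inner
    by (simp add: inner_diff_left inner_diff_right vv inner_commute power2_eq_square algebra_simps)
  then have "\<epsilon> * (norm (x - ?t *\<^sub>R v))\<^sup>2 = \<epsilon> * (norm x)\<^sup>2 - s * (v \<bullet> x) + s\<^sup>2 / (4 * \<epsilon>)"
    using assms(2) by (simp add: field_simps power2_eq_square)
  then show ?thesis
    by (simp flip: exp_add)
qed

lemma exp_inner_minus_square_integrable:
  fixes X :: "'b \<Rightarrow> 'a::euclidean_space"
  assumes Q: "prob_space Q" and [measurable]: "X \<in> borel_measurable Q" and v: "norm v = 1" and \<epsilon>: "\<epsilon> > 0"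
  shows "integrable Q (\<lambda>\<omega>. exp (s * (v \<bullet> X \<omega>) - \<epsilon> * (norm (X \<omega>))\<^sup>2))"
proof -
  interpret Q: prob_space Q by fact
  have "integrable Q (\<lambda>\<omega>. exp (- (\<epsilon> * (norm (X \<omega> - (s / (2 * \<epsilon>)) *\<^sub>R v))\<^sup>2)))"
    using \<epsilon> by (intro Q.integrable_const_bound [where B = 1]) auto
  then show ?thesis
    unfolding exp_inner_minus_square_eq [OF v \<epsilon>] by (rule integrable_mult_right)
qed

context levy_null_array
begin

lemma exp_inner_minus_square_tendsto:
  assumes ID: "is_ID M b \<mu>" and v: "norm v = 1" and \<epsilon>: "\<epsilon> > 0"
  shows "(\<lambda>n. \<integral>\<omega>. exp (s * (v \<bullet> total n \<omega>) - \<epsilon> * (norm (total n \<omega>))\<^sup>2) \<partial>P n)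
    \<longlonglongrightarrow> (\<integral>x. exp (s * (v \<bullet> x) - \<epsilon> * (norm x)\<^sup>2) \<partial>\<mu>)"
proof -
  have \<mu>: "prob_space \<mu>" and sets_\<mu>: "sets \<mu> = sets borel"
    using ID by (simp_all add: is_ID_def)
  show ?thesis
    unfolding exp_inner_minus_square_eq [OF v \<epsilon>] integral_mult_right_zero
    using \<epsilon> by (intro tendsto_mult tendsto_const gaussian_kernel_tendsto [OF prob_space_P measurable_total \<mu> sets_\<mu> char_fun_total_tendsto [OF ID]]) simp
qed

text \<open>Here \<open>k\<close> vanishes outside a bounded set of jumps with \<open>v \<bullet> x > 1\<close>, so \<open>Q\<close> is 0 unless all large jumps lie
  in that set, and is otherwise \<open>exp (s V)\<close> for the sum \<open>V\<close> of their components along \<open>v\<close>. The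
  first correction makes the right side nonpositive when the small part exceeds \<open>C\<close> in norm. The second pays for the damping
  \<open>1 - \<epsilon> |S|^2\<close>: as \<open>|S| \<le> C + L V\<close>, the square of the norm is at most a multiple of \<open>Q\<close>. All three terms
  are products of jump weights or dominated by finitely many of them.\<close>

lemma exp_inner_total_lower_bound:
  fixes v :: 'a and L s C \<epsilon> :: real and n :: nat and \<omega> :: "nat \<Rightarrow> 'a" and k :: "'a \<Rightarrow> real"
  assumes v: "norm v = 1" and "s \<ge> 1" and "C \<ge> 0" and "L \<ge> 0" and "\<epsilon> > 0"
    and k: "\<And>x. k x \<noteq> 0 \<Longrightarrow> 1 < v \<bullet> x \<and> norm x \<le> L \<and> k x = exp (s * (v \<bullet> x))"
  defines "Q \<equiv> \<Prod>j\<in>large_indices n \<omega>. k (\<omega> j)"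
  shows "exp (s * (v \<bullet> total n \<omega>) - \<epsilon> * (norm (total n \<omega>))\<^sup>2)
    \<ge> exp (- (s * C)) * (Q - exp (- C) * exp (norm (small_part n \<omega>)) * Q - \<epsilon> * (4 * (C + L)\<^sup>2) * Q\<^sup>2)"
proof (cases "Q = 0")
  case False
  let ?J = "large_indices n \<omega>"
  define V where "V = (\<Sum>j\<in>?J. v \<bullet> \<omega> j)"
  let ?T = "small_part n \<omega>" and ?S = "total n \<omega>"
  have J: "1 < v \<bullet> \<omega> j \<and> norm (\<omega> j) \<le> L \<and> k (\<omega> j) = exp (s * (v \<bullet> \<omega> j))" if "j \<in> ?J" for j
  proof -
    have "k (\<omega> j) \<noteq> 0"
      using False that by (auto simp: Q_def)
    then show ?thesis
      by (rule k)
  qed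
  have Q_eq: "Q = exp (s * V)"
    using J by (simp add: Q_def V_def sum_distrib_left exp_sum)
  have V: "V \<ge> 0"
    unfolding V_def using J by (intro sum_nonneg) force
  have "norm (\<Sum>j\<in>?J. \<omega> j) \<le> (\<Sum>j\<in>?J. L * (v \<bullet> \<omega> j))"
  proof (rule sum_norm_le)
    fix j assume "j \<in> ?J"
    from J [OF this] have "norm (\<omega> j) \<le> L * 1" "1 \<le> v \<bullet> \<omega> j" by auto
    then show "norm (\<omega> j) \<le> L * (v \<bullet> \<omega> j)"
      using mult_left_mono [of 1 "v \<bullet> \<omega> j" L] \<open>L \<ge> 0\<close> by linarith
  qed
  then have jumps: "norm (\<Sum>j\<in>?J. \<omega> j) \<le> L * V"
    by (simp add: V_def sum_distrib_left)
  show ?thesis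
  proof (cases "norm ?T \<le> C")
    case True
    have "norm ?S \<le> C + L * V"
      unfolding total_eq_small_part using True jumps by (intro norm_triangle_le) simp
    also have "\<dots> \<le> (C + L) * (1 + V)"
      using V \<open>C \<ge> 0\<close> \<open>L \<ge> 0\<close> by (simp add: algebra_simps)
    also have "\<dots> \<le> (C + L) * (2 * exp (V / 2))"
      using exp_ge_add_one_self [of "V / 2"] \<open>C \<ge> 0\<close> \<open>L \<ge> 0\<close> by (intro mult_left_mono) linarith+
    finally have "(norm ?S)\<^sup>2 \<le> ((C + L) * (2 * exp (V / 2)))\<^sup>2"
      by (rule power_mono) simp
    also have "\<dots> = 4 * (C + L)\<^sup>2 * exp V"
      by (simp add: power_mult_distrib flip: exp_double)
    also have "\<dots> \<le> 4 * (C + L)\<^sup>2 * Q"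
      unfolding Q_eq using V \<open>s \<ge> 1\<close> mult_right_mono [of 1 s V] by (intro mult_left_mono) auto
    finally have S: "\<epsilon> * (norm ?S)\<^sup>2 \<le> \<epsilon> * (4 * (C + L)\<^sup>2 * Q)"
      using \<open>\<epsilon> > 0\<close> by (intro mult_left_mono) auto
    have "\<bar>v \<bullet> ?T\<bar> \<le> C"
      using Cauchy_Schwarz_ineq2 [of v ?T] v True by simp
    then have "V - C \<le> v \<bullet> ?S"
      by (simp add: total_eq_small_part inner_add_right inner_sum_right V_def)
    then have "s * (V - C) \<le> s * (v \<bullet> ?S)"
      using \<open>s \<ge> 1\<close> by (intro mult_left_mono) auto
    then have "exp (- (s * C)) * Q \<le> exp (s * (v \<bullet> ?S))"
      unfolding Q_eq by (simp add: right_diff_distrib flip: exp_add)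
    moreover have "1 - \<epsilon> * (4 * (C + L)\<^sup>2 * Q) \<le> exp (- (\<epsilon> * (norm ?S)\<^sup>2))"
      using S exp_ge_add_one_self [of "- (\<epsilon> * (norm ?S)\<^sup>2)"] by linarith
    ultimately have "(exp (- (s * C)) * Q) * (1 - \<epsilon> * (4 * (C + L)\<^sup>2 * Q)) \<le> exp (s * (v \<bullet> ?S)) * exp (- (\<epsilon> * (norm ?S)\<^sup>2))"
      by (intro order_trans [OF mult_left_mono mult_right_mono]) (auto simp: Q_eq)
    moreover have "exp (- (s * C)) * (Q - exp (- C) * exp (norm ?T) * Q - \<epsilon> * (4 * (C + L)\<^sup>2) * Q\<^sup>2)
        \<le> exp (- (s * C)) * (Q - \<epsilon> * (4 * (C + L)\<^sup>2) * Q\<^sup>2)"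
      by (intro mult_left_mono) (auto simp: Q_eq)
    moreover have "exp (- (s * C)) * (Q - \<epsilon> * (4 * (C + L)\<^sup>2) * Q\<^sup>2)
        = (exp (- (s * C)) * Q) * (1 - \<epsilon> * (4 * (C + L)\<^sup>2 * Q))"
      by (simp add: algebra_simps power2_eq_square)
    moreover have "exp (s * (v \<bullet> ?S)) * exp (- (\<epsilon> * (norm ?S)\<^sup>2)) = exp (s * (v \<bullet> ?S) - \<epsilon> * (norm ?S)\<^sup>2)"
      by (simp flip: exp_add)
    ultimately show ?thesis
      by linarith
  next
    case False
    then have "1 \<le> exp (- C) * exp (norm ?T)"
      by (simp flip: exp_add)
    then have "Q \<le> exp (- C) * exp (norm ?T) * Q"
      using mult_right_mono [of 1 "exp (- C) * exp (norm ?T)" Q] by (simp add: Q_eq)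
    moreover have "0 \<le> \<epsilon> * (4 * (C + L)\<^sup>2) * Q\<^sup>2"
      using \<open>\<epsilon> > 0\<close> by simp
    ultimately have "Q - exp (- C) * exp (norm ?T) * Q - \<epsilon> * (4 * (C + L)\<^sup>2) * Q\<^sup>2 \<le> 0"
      by linarith
    then have "exp (- (s * C)) * (Q - exp (- C) * exp (norm ?T) * Q - \<epsilon> * (4 * (C + L)\<^sup>2) * Q\<^sup>2) \<le> 0"
      by (intro mult_nonneg_nonpos) auto
    then show ?thesis
      using exp_ge_zero order_trans by blast
  qed
qed simp

text \<open>In the limit the first two terms of the pointwise bound carry the same factor \<open>exp (I s)\<close>, where \<open>I s\<close> is the integral of
  \<open>exp (s (v \<bullet> x))\<close> over the chosen jumps. Hence \<open>C\<close> can be fixed, independently of \<open>s\<close>, so that the first correction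
  costs at most half of the main term; the second disappears as \<open>\<epsilon>\<close> tends to 0 with \<open>s\<close> fixed.\<close>

lemma exp_inner_moment_lower_bound:
  fixes v :: 'a and L a :: real
  assumes ID: "is_ID M b \<mu>" and v: "norm v = 1" and "a \<ge> 1" and "L \<ge> 0"
  shows "\<exists>C\<ge>0. \<forall>s\<ge>1. ennreal (exp (measure M {x. a < v \<bullet> x \<and> norm x \<le> L} * exp (s * a) - C * s - C))
    \<le> (\<integral>\<^sup>+x. ennreal (exp (s * (v \<bullet> x))) \<partial>\<mu>)"
proof -
  let ?E = "{x. a < v \<bullet> x \<and> norm x \<le> L}" and ?L = "{x::'a. 1 < norm x}"
  let ?c = "\<lambda>u. small_jump_exponent M b u"
  have \<mu>: "prob_space \<mu>" and sets_\<mu> [measurable_cong]: "sets \<mu> = sets borel"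
    using ID by (simp_all add: is_ID_def)
  have sets_M [measurable_cong]: "sets M = sets borel"
    using levy by (simp add: levy_measure_def)
  have id [measurable]: "(\<lambda>x. x) \<in> borel_measurable \<mu>"
    by measurable
  have E: "?E \<in> sets M" by (simp add: sets_M)
  have E_sub: "?E \<subseteq> ?L"
  proof safe
    fix x assume "a < v \<bullet> x"
    also have "v \<bullet> x \<le> norm v * norm x" by (rule norm_cauchy_schwarz)
    finally show "1 < norm x" using v \<open>a \<ge> 1\<close> by simp
  qed
  have "emeasure M ?E \<le> emeasure M ?L"
    by (rule emeasure_mono [OF E_sub]) (simp add: sets_M)
  then have fin: "emeasure M ?E < \<infinity>"
    using levy_measure_large_finite [OF levy, of 1] by (auto simp: less_top[symmetric] top_unique)
  obtain U :: "'a set" where U: "finite U" "\<And>x. exp (1 * norm x) \<le> (\<Sum>u\<in>U. exp (u \<bullet> x))"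
    using exp_norm_le_sum_exp_inner [of 1] by auto
  define D where "D = (\<Sum>u\<in>U. exp (?c u))"
  define C where "C = max 0 (ln (2 * (D + 1)) - ?c 0)"
  have D: "D \<ge> 0" unfolding D_def by (intro sum_nonneg) simp
  have C: "C \<ge> 0" by (simp add: C_def)
  have "2 * (D + 1) * exp (- ?c 0) = exp (ln (2 * (D + 1)) - ?c 0)"
    using D by (simp add: exp_diff exp_minus field_simps)
  also have "\<dots> \<le> exp C" by (simp add: C_def)
  finally have "2 * D * exp (- ?c 0) \<le> exp C"
    by (smt (verit) exp_gt_zero mult_right_mono)
  then have CD: "exp (- C) * D \<le> exp (?c 0) / 2"
    by (simp add: exp_minus field_simps)
  \<comment> \<open>The extra 1 pays for the factor \<open>1/2\<close>, as \<open>ln 2 \<le> 1\<close>.\<close>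
  define C' where "C' = C + \<bar>?c 0\<bar> + 1"
  have "ennreal (exp (measure M ?E * exp (s * a) - C' * s - C')) \<le> (\<integral>\<^sup>+x. ennreal (exp (s * (v \<bullet> x))) \<partial>\<mu>)"
    if s: "s \<ge> 1" for s
  proof -
    define k where "k t x = (if x \<in> ?E then exp (t * (v \<bullet> x)) else 0)" for t x
    have k_meas [measurable]: "k t \<in> borel_measurable borel" for t
      unfolding k_def by measurable
    have k_nonneg: "k t x \<ge> 0" for t x by (simp add: k_def)
    have k_le: "k t x \<le> exp (t * L)" if "t \<ge> 0" for t x
      using that v norm_cauchy_schwarz [of v x] by (auto simp: k_def intro!: mult_left_mono)
    have k_int: "set_integrable M ?L (k t)" if "t \<ge> 0" for t
      unfolding set_integrable_def
    proof (rule integrableI_bounded_set_indicator [of _ _ _ "exp (t * L)"])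
      show "AE x in M. x \<in> ?L \<longrightarrow> norm (k t x) \<le> exp (t * L)"
        using k_le [OF that] k_nonneg by auto
    qed (use levy_measure_large_finite [OF levy, of 1] in \<open>auto simp: sets_M\<close>)
    define I where "I t = (LINT x:?L|M. k t x)" for t
    have "measure M ?E * exp (s * a) = (LINT x:?L|M. exp (s * a) * indicator ?E x)"
    proof -
      have "(LINT x:?L|M. exp (s * a) * indicator ?E x) = (LINT x|M. exp (s * a) * indicator ?E x)"
        unfolding set_lebesgue_integral_def
        using E_sub by (intro Bochner_Integration.integral_cong) (auto simp: indicator_def)
      then show ?thesis using E by simp
    qed
    also have "\<dots> \<le> I s"
      unfolding I_def
    proof (rule set_integral_mono)
      show "set_integrable M ?L (\<lambda>x. exp (s * a) * indicator ?E x)"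
        unfolding set_integrable_def
        by (intro integrable_mult_indicator integrable_mult_right integrable_real_indicator E fin) (simp add: sets_M)
      show "exp (s * a) * indicator ?E x \<le> k s x" for x
        using s by (auto simp: k_def indicator_def)
    qed (use k_int s in auto)
    finally have I_ge: "measure M ?E * exp (s * a) \<le> I s" .
    define K where "K = 4 * (C + L)\<^sup>2"
    define W where "W n t u = exp (u \<bullet> \<beta> n) * (LINT \<omega>|P n. (\<Prod>j<m n. jump_weight (k t) u (\<omega> j)))" for n t u
    have W_lim: "(\<lambda>n. W n t u) \<longlonglongrightarrow> exp (?c u + I t)" if "t \<ge> 0" for t u
      unfolding W_def I_def by (intro jump_weight_tendsto k_meas k_int that)
    have key: "exp (- (s * C)) * (exp (?c 0 + I s) - exp (- C) * (\<Sum>u\<in>U. exp (?c u + I s)) - \<epsilon> * K * exp (?c 0 + I (2 * s)))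
        \<le> (\<integral>x. exp (s * (v \<bullet> x) - \<epsilon> * (norm x)\<^sup>2) \<partial>\<mu>)" if \<epsilon>: "\<epsilon> > 0" for \<epsilon>
    proof (rule LIMSEQ_le)
      show "(\<lambda>n. \<integral>\<omega>. exp (s * (v \<bullet> total n \<omega>) - \<epsilon> * (norm (total n \<omega>))\<^sup>2) \<partial>P n)
          \<longlonglongrightarrow> (\<integral>x. exp (s * (v \<bullet> x) - \<epsilon> * (norm x)\<^sup>2) \<partial>\<mu>)"
        by (rule exp_inner_minus_square_tendsto [OF ID v \<epsilon>])
      show "(\<lambda>n. exp (- (s * C)) * (W n s 0 - exp (- C) * (\<Sum>u\<in>U. W n s u) - \<epsilon> * K * W n (2 * s) 0))
          \<longlonglongrightarrow> exp (- (s * C)) * (exp (?c 0 + I s) - exp (- C) * (\<Sum>u\<in>U. exp (?c u + I s)) - \<epsilon> * K * exp (?c 0 + I (2 * s)))"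
        using s by (intro tendsto_intros W_lim) auto
      have "exp (- (s * C)) * (W n s 0 - exp (- C) * (\<Sum>u\<in>U. W n s u) - \<epsilon> * K * W n (2 * s) 0)
          \<le> (\<integral>\<omega>. exp (s * (v \<bullet> total n \<omega>) - \<epsilon> * (norm (total n \<omega>))\<^sup>2) \<partial>P n)" for n
      proof -
        define w where "w t u \<omega> = exp (u \<bullet> \<beta> n) * (\<Prod>j<m n. jump_weight (k t) u (\<omega> j))" for t u \<omega>
        have w_int: "integrable (P n) (w t u)" if "t \<ge> 0" for t u
          unfolding w_def by (intro integrable_mult_right integrable_jump_weight k_meas k_int that)
        have w_W: "(LINT \<omega>|P n. w t u \<omega>) = W n t u" for t u
          unfolding w_def W_def by (rule integral_mult_right_zero)
        have pointwise: "exp (- (s * C)) * (w s 0 \<omega> - exp (- C) * (\<Sum>u\<in>U. w s u \<omega>) - \<epsilon> * K * w (2 * s) 0 \<omega>)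
            \<le> exp (s * (v \<bullet> total n \<omega>) - \<epsilon> * (norm (total n \<omega>))\<^sup>2)" for \<omega>
        proof -
          define Q where "Q = (\<Prod>j\<in>large_indices n \<omega>. k s (\<omega> j))"
          have Q: "Q \<ge> 0" unfolding Q_def by (intro prod_nonneg) (simp add: k_nonneg)
          have w_eq: "w s u \<omega> = exp (u \<bullet> small_part n \<omega>) * Q" for u
            unfolding w_def Q_def by (rule jump_weight_prod_eq)
          have "k (2 * s) x = (k s x)\<^sup>2" for x
            by (simp add: k_def flip: exp_double)
          then have w2_eq: "w (2 * s) 0 \<omega> = Q\<^sup>2"
            unfolding w_def jump_weight_prod_eq by (simp add: Q_def prod_power_distrib)
          have "exp (norm (small_part n \<omega>)) * Q \<le> (\<Sum>u\<in>U. w s u \<omega>)"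
            unfolding w_eq sum_distrib_right [symmetric]
            using U(2) [of "small_part n \<omega>"] by (intro mult_right_mono Q) simp
          then have "exp (- C) * (exp (norm (small_part n \<omega>)) * Q) \<le> exp (- C) * (\<Sum>u\<in>U. w s u \<omega>)"
            by (intro mult_left_mono) auto
          then have "exp (- (s * C)) * (w s 0 \<omega> - exp (- C) * (\<Sum>u\<in>U. w s u \<omega>) - \<epsilon> * K * w (2 * s) 0 \<omega>)
              \<le> exp (- (s * C)) * (Q - exp (- C) * exp (norm (small_part n \<omega>)) * Q - \<epsilon> * (4 * (C + L)\<^sup>2) * Q\<^sup>2)"
            unfolding w2_eq w_eq [of 0] K_def by (intro mult_left_mono) auto
          also have "\<dots> \<le> exp (s * (v \<bullet> total n \<omega>) - \<epsilon> * (norm (total n \<omega>))\<^sup>2)"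
            unfolding Q_def
            by (rule exp_inner_total_lower_bound [OF v s C \<open>L \<ge> 0\<close> \<epsilon>])
               (use \<open>a \<ge> 1\<close> in \<open>auto simp: k_def split: if_splits\<close>)
          finally show ?thesis .
        qed
        have "(\<integral>\<omega>. exp (- (s * C)) * (w s 0 \<omega> - exp (- C) * (\<Sum>u\<in>U. w s u \<omega>) - \<epsilon> * K * w (2 * s) 0 \<omega>) \<partial>P n)
            \<le> (\<integral>\<omega>. exp (s * (v \<bullet> total n \<omega>) - \<epsilon> * (norm (total n \<omega>))\<^sup>2) \<partial>P n)"
          using s by (intro integral_mono pointwise integrable_mult_right Bochner_Integration.integrable_diff
              Bochner_Integration.integrable_sum w_int
              exp_inner_minus_square_integrable [OF prob_space_P measurable_total v \<epsilon>]) auto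
        also have "(\<integral>\<omega>. exp (- (s * C)) * (w s 0 \<omega> - exp (- C) * (\<Sum>u\<in>U. w s u \<omega>) - \<epsilon> * K * w (2 * s) 0 \<omega>) \<partial>P n)
            = exp (- (s * C)) * (W n s 0 - exp (- C) * (\<Sum>u\<in>U. W n s u) - \<epsilon> * K * W n (2 * s) 0)"
          using s by (simp add: Bochner_Integration.integral_sum w_int w_W)
        finally show ?thesis .
      qed
      then show "\<exists>N. \<forall>n\<ge>N. exp (- (s * C)) * (W n s 0 - exp (- C) * (\<Sum>u\<in>U. W n s u) - \<epsilon> * K * W n (2 * s) 0)
          \<le> (\<integral>\<omega>. exp (s * (v \<bullet> total n \<omega>) - \<epsilon> * (norm (total n \<omega>))\<^sup>2) \<partial>P n)"
        by blast
    qed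
    have "(\<Sum>u\<in>U. exp (?c u + I s)) = D * exp (I s)"
      by (simp add: D_def exp_add sum_distrib_right)
    moreover have "exp (- C) * D * exp (I s) \<le> exp (?c 0) / 2 * exp (I s)"
      by (intro mult_right_mono CD) simp
    ultimately have half: "exp (?c 0 + I s) / 2 \<le> exp (?c 0 + I s) - exp (- C) * (\<Sum>u\<in>U. exp (?c u + I s))"
      by (simp add: exp_add)
    have le: "ennreal (exp (- (s * C)) * (exp (?c 0 + I s) / 2 - \<epsilon> * K * exp (?c 0 + I (2 * s))))
        \<le> (\<integral>\<^sup>+x. ennreal (exp (s * (v \<bullet> x))) \<partial>\<mu>)" if \<epsilon>: "\<epsilon> > 0" for \<epsilon>
    proof -
      have "exp (- (s * C)) * (exp (?c 0 + I s) / 2 - \<epsilon> * K * exp (?c 0 + I (2 * s)))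
          \<le> (\<integral>x. exp (s * (v \<bullet> x) - \<epsilon> * (norm x)\<^sup>2) \<partial>\<mu>)"
        using half by (intro order_trans [OF mult_left_mono key [OF \<epsilon>]]) auto
      then have "ennreal (exp (- (s * C)) * (exp (?c 0 + I s) / 2 - \<epsilon> * K * exp (?c 0 + I (2 * s))))
          \<le> ennreal (\<integral>x. exp (s * (v \<bullet> x) - \<epsilon> * (norm x)\<^sup>2) \<partial>\<mu>)"
        by (rule ennreal_leI)
      also have "\<dots> = (\<integral>\<^sup>+x. ennreal (exp (s * (v \<bullet> x) - \<epsilon> * (norm x)\<^sup>2)) \<partial>\<mu>)"
        by (intro nn_integral_eq_integral [symmetric] exp_inner_minus_square_integrable [OF \<mu> id v \<epsilon>]) auto
      also have "\<dots> \<le> (\<integral>\<^sup>+x. ennreal (exp (s * (v \<bullet> x))) \<partial>\<mu>)"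
        using \<epsilon> by (intro nn_integral_mono ennreal_leI) auto
      finally show ?thesis .
    qed
    have "((\<lambda>\<epsilon>. ennreal (exp (- (s * C)) * (exp (?c 0 + I s) / 2 - \<epsilon> * K * exp (?c 0 + I (2 * s)))))
        \<longlongrightarrow> ennreal (exp (- (s * C)) * (exp (?c 0 + I s) / 2 - 0 * K * exp (?c 0 + I (2 * s))))) (at_right 0)"
      by (intro tendsto_intros tendsto_ennrealI) 
    then have lim: "ennreal (exp (- (s * C)) * (exp (?c 0 + I s) / 2 - 0 * K * exp (?c 0 + I (2 * s))))
        \<le> (\<integral>\<^sup>+x. ennreal (exp (s * (v \<bullet> x))) \<partial>\<mu>)"
      by (rule tendsto_upperbound [OF _ eventually_mono [OF eventually_at_right_less le]]) simp_all
    have "exp (measure M ?E * exp (s * a) - C' * s - C') \<le> exp (- (s * C)) * (exp (?c 0 + I s) / 2)"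
    proof -
      have "ln 2 \<le> (1::real)" using ln_le_minus_one [of "2::real"] by simp
      moreover have "C * s + 1 * 0 \<le> C' * s"
        using s by (simp add: C'_def mult_right_mono)
      ultimately have "measure M ?E * exp (s * a) - C' * s - C' \<le> - (s * C) + (?c 0 + I s) - ln 2"
        using I_ge C by (simp add: C'_def algebra_simps)
      then have "exp (measure M ?E * exp (s * a) - C' * s - C') \<le> exp (- (s * C) + (?c 0 + I s) - ln 2)"
        by simp
      also have "\<dots> = exp (- (s * C)) * (exp (?c 0 + I s) / 2)"
        by (simp add: exp_diff exp_add exp_minus field_simps)
      finally show ?thesis .
    qed
    then show ?thesis
      using lim unfolding mult_zero_left diff_zero by (rule order_trans [OF ennreal_leI])
  qed
  moreover have "C' \<ge> 0" using C by (simp add: C'_def)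
  ultimately show ?thesis by blast
qed

end

text \<open>Young's inequality for the convex function \<open>\<theta> r log r\<close>, whose conjugate is \<open>\<theta> exp (s/\<theta> - 1)\<close>; it is
  \<open>1 + y \<le> exp y\<close> at \<open>y = s/\<theta> - 1 - log r\<close>.\<close>

lemma inner_le_norm_log_young:
  fixes r s \<theta> :: real
  assumes "\<theta> > 0" and "r \<ge> 0"
  shows "s * r \<le> \<theta> * (r * ln r) + \<theta> * exp (s / \<theta> - 1)"
proof (cases "r = 0")
  case False
  then have r: "r > 0" using assms by simp
  have "\<theta> * r * (1 + (s / \<theta> - 1 - ln r)) \<le> \<theta> * r * exp (s / \<theta> - 1 - ln r)"
    using assms by (intro mult_left_mono exp_ge_add_one_self) auto
  also have "\<dots> = \<theta> * exp (s / \<theta> - 1)"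
    using r by (simp add: exp_diff)
  finally show ?thesis
    using assms by (simp add: algebra_simps)
qed (use assms in simp)

text \<open>A vector of large norm has a large coordinate, so the complement of a ball is covered by the countably many
  truncated half-spaces that belong to the signed basis vectors; they cannot all be null.\<close>

lemma unbounded_levy_measure_direction:
  fixes M :: "'a::euclidean_space measure"
  assumes sets_M: "sets M = sets borel" and unbounded: "\<And>r. emeasure M {x. r < norm x} \<noteq> 0"
  shows "\<exists>v (L::nat). norm v = 1 \<and> emeasure M {x. a < v \<bullet> x \<and> norm x \<le> L} \<noteq> 0"
proof (rule ccontr)
  assume contra: "\<not> ?thesis"
  let ?V = "Basis \<union> uminus ` Basis :: 'a set"
  have "{x. a < v \<bullet> x \<and> norm x \<le> real L} \<in> null_sets M" if "v \<in> ?V" for v L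
  proof (rule null_setsI)
    have "norm v = 1" using that by auto
    then show "emeasure M {x. a < v \<bullet> x \<and> norm x \<le> real L} = 0"
      using contra by blast
  qed (simp add: sets_M)
  then have null: "(\<Union>v\<in>?V. \<Union>L. {x. a < v \<bullet> x \<and> norm x \<le> real L}) \<in> null_sets M"
    by (intro null_sets_UN' null_sets_UN) (auto intro: countable_finite)
  have "{x. DIM('a) * a < norm x} \<subseteq> (\<Union>v\<in>?V. \<Union>L. {x. a < v \<bullet> x \<and> norm x \<le> real L})"
  proof
    fix x :: 'a assume "x \<in> {x. DIM('a) * a < norm x}"
    then have x: "DIM('a) * a < norm x" by simp
    have "\<exists>i\<in>Basis. a < \<bar>x \<bullet> i\<bar>"
    proof (rule ccontr)
      assume "\<not> ?thesis"
      then have "(\<Sum>i\<in>Basis. \<bar>x \<bullet> i\<bar>) \<le> DIM('a) * a"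
        by (intro sum_bounded_above) auto
      with norm_le_l1 [of x] x show False by linarith
    qed
    then obtain i where i: "i \<in> Basis" "a < \<bar>x \<bullet> i\<bar>" by blast
    have "\<exists>v\<in>?V. a < v \<bullet> x"
    proof (cases "x \<bullet> i \<ge> 0")
      case True
      then show ?thesis using i by (intro bexI [of _ i]) (auto simp: inner_commute)
    next
      case False
      then show ?thesis using i by (intro bexI [of _ "- i"]) (auto simp: inner_commute)
    qed
    moreover have "norm x \<le> real (nat \<lceil>norm x\<rceil>)" by (rule real_nat_ceiling_ge)
    ultimately show "x \<in> (\<Union>v\<in>?V. \<Union>L. {x. a < v \<bullet> x \<and> norm x \<le> real L})" by blast
  qed
  then have "{x. DIM('a) * a < norm x} \<in> null_sets M"
    by (intro null_sets_subset [OF null]) (simp_all add: sets_M)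
  then show False
    using unbounded [of "DIM('a) * a"] by auto
qed

text \<open>Exponential moments grow like \<open>exp (e * exp (s * a))\<close> from below, but an integrable \<open>exp (\<theta> |x| log |x|)\<close> would
  keep them below a multiple of \<open>exp (\<theta> * exp (s / \<theta> - 1))\<close>.\<close>

theorem ID_norm_log_moment_infinite:
  fixes M \<mu> :: "'a::euclidean_space measure"
  assumes ID: "is_ID M b \<mu>" and unbounded: "\<And>r. emeasure M {x. r < norm x} \<noteq> 0" and \<theta>: "\<theta> > 0"
  shows "(\<integral>\<^sup>+x. ennreal (exp (\<theta> * (norm x * ln (norm x)))) \<partial>\<mu>) = \<infinity>"
proof (rule ccontr)
  assume "\<not> ?thesis"
  then obtain j where j: "j \<ge> 0" "(\<integral>\<^sup>+x. ennreal (exp (\<theta> * (norm x * ln (norm x)))) \<partial>\<mu>) = ennreal j"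
    by (metis ennreal_cases infinity_ennreal_def)
  have levy: "levy_measure M" and sets_\<mu> [measurable_cong]: "sets \<mu> = sets borel"
    using ID by (simp_all add: is_ID_def)
  have sets_M: "sets M = sets borel"
    using levy by (simp add: levy_measure_def)
  \<comment> \<open>Any \<open>a > 1/\<theta>\<close> separates the two growth rates; with this choice their quotient is \<open>exp s\<close>.\<close>
  define a where "a = 1 / \<theta> + 1"
  have a: "a \<ge> 1" using \<theta> by (simp add: a_def)
  obtain v L where v: "norm v = 1" and E0: "emeasure M {x. a < v \<bullet> x \<and> norm x \<le> real L} \<noteq> 0"
    using unbounded_levy_measure_direction [OF sets_M unbounded] by blast
  define e where "e = measure M {x. a < v \<bullet> x \<and> norm x \<le> real L}"
  have "{x. a < v \<bullet> x \<and> norm x \<le> real L} \<subseteq> {x. 1 < norm x}"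
  proof safe
    fix x assume "a < v \<bullet> x"
    also have "v \<bullet> x \<le> norm v * norm x" by (rule norm_cauchy_schwarz)
    finally show "1 < norm x" using v a by simp
  qed
  then have "emeasure M {x. a < v \<bullet> x \<and> norm x \<le> real L} \<le> emeasure M {x. 1 < norm x}"
    by (rule emeasure_mono) (simp add: sets_M)
  also have "\<dots> < \<infinity>" by (rule levy_measure_large_finite [OF levy]) simp
  finally have "e > 0"
    using E0 unfolding e_def measure_def
    by (simp add: enn2real_positive_iff zero_less_iff_neq_zero)
  obtain P m \<beta> where "null_array M b P m \<beta>"
    using levy_measure_null_array [OF levy] by blast
  then interpret levy_null_array M b P m \<beta>
    by (intro levy_null_array.intro levy_null_array_axioms.intro levy)
  obtain C where C: "C \<ge> 0"
    "\<And>s. s \<ge> 1 \<Longrightarrow> ennreal (exp (e * exp (s * a) - C * s - C)) \<le> (\<integral>\<^sup>+x. ennreal (exp (s * (v \<bullet> x))) \<partial>\<mu>)"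
    using exp_inner_moment_lower_bound [OF ID v a, of "real L"] unfolding e_def by auto
  have bound: "e * exp s \<le> \<theta> + C * \<theta> + C + j" if s: "s \<ge> 1" for s
  proof -
    have "(\<integral>\<^sup>+x. ennreal (exp (s * (v \<bullet> x))) \<partial>\<mu>)
        \<le> (\<integral>\<^sup>+x. ennreal (exp (\<theta> * exp (s / \<theta> - 1))) * ennreal (exp (\<theta> * (norm x * ln (norm x)))) \<partial>\<mu>)"
    proof (intro nn_integral_mono)
      fix x
      have "s * (v \<bullet> x) \<le> s * norm x"
        using norm_cauchy_schwarz [of v x] v s by (intro mult_left_mono) auto
      also have "\<dots> \<le> \<theta> * (norm x * ln (norm x)) + \<theta> * exp (s / \<theta> - 1)"
        by (rule inner_le_norm_log_young [OF \<theta>]) simp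
      finally have "exp (s * (v \<bullet> x)) \<le> exp (\<theta> * exp (s / \<theta> - 1)) * exp (\<theta> * (norm x * ln (norm x)))"
        by (simp flip: exp_add)
      then show "ennreal (exp (s * (v \<bullet> x))) \<le> ennreal (exp (\<theta> * exp (s / \<theta> - 1))) * ennreal (exp (\<theta> * (norm x * ln (norm x))))"
        by (simp add: ennreal_leI flip: ennreal_mult)
    qed
    also have "\<dots> = ennreal (exp (\<theta> * exp (s / \<theta> - 1)) * j)"
      using j by (subst nn_integral_cmult) (auto simp: ennreal_mult)
    finally have "ennreal (exp (e * exp (s * a) - C * s - C)) \<le> ennreal (exp (\<theta> * exp (s / \<theta> - 1)) * j)"
      using C(2) [OF s] by (rule order_trans [rotated])
    then have "exp (e * exp (s * a) - C * s - C) \<le> exp (\<theta> * exp (s / \<theta> - 1)) * j"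
      using j(1) by (simp add: ennreal_le_iff)
    also have "\<dots> \<le> exp (\<theta> * exp (s / \<theta> - 1)) * exp j"
    proof (rule mult_left_mono)
      show "j \<le> exp j" using exp_ge_add_one_self [of j] by linarith
    qed simp
    finally have "e * exp (s * a) - C * s - C \<le> \<theta> * exp (s / \<theta> - 1) + j"
      by (simp flip: exp_add)
    moreover have "exp (s * a) = exp s * exp (s / \<theta>)"
      by (simp add: a_def distrib_left add.commute flip: exp_add)
    moreover have "\<theta> * exp (s / \<theta> - 1) \<le> \<theta> * exp (s / \<theta>)"
      using \<theta> by (intro mult_left_mono) auto
    moreover have "C * s \<le> C * (\<theta> * exp (s / \<theta>))"
    proof (intro mult_left_mono C)
      have "s / \<theta> \<le> exp (s / \<theta>)" using exp_ge_add_one_self [of "s / \<theta>"] by linarith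
      then show "s \<le> \<theta> * exp (s / \<theta>)" using \<theta> by (simp add: field_simps)
    qed
    moreover have "C + j \<le> (C + j) * exp (s / \<theta>)"
      using C(1) j(1) \<theta> s by (intro mult_left_mono [of 1 _ "C + j", simplified]) auto
    ultimately have "e * exp s * exp (s / \<theta>) \<le> (\<theta> + C * \<theta> + C + j) * exp (s / \<theta>)"
      by (simp add: algebra_simps)
    then show ?thesis by simp
  qed
  define s where "s = max 1 ((\<theta> + C * \<theta> + C + j) / e)"
  have "\<theta> + C * \<theta> + C + j \<le> e * s"
    using \<open>e > 0\<close> by (simp add: s_def max_def field_simps)
  also have "\<dots> < e * exp s"
    using \<open>e > 0\<close> exp_gt_self by simp
  also have "\<dots> \<le> \<theta> + C * \<theta> + C + j"
    by (rule bound) (simp add: s_def)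
  finally show False by simp
qed

section \<open>The Levy measure of a tempered stable law\<close>

lemma nn_integral_TS_levy_measure:
  fixes R :: "'a::euclidean_space measure" and f :: "'a \<Rightarrow> ennreal"
  assumes R: "sets R = sets borel" and f: "f \<in> borel_measurable borel"
  shows "(\<integral>\<^sup>+x. f x \<partial>TS_levy_measure p \<alpha> R) =
    (\<integral>\<^sup>+x. (\<integral>\<^sup>+t\<in>{0<..}. (f (t *\<^sub>R x) * ennreal (t powr (- 1 - \<alpha>) * exp (- (t powr p)))) \<partial>lborel) \<partial>R)"
  using f
proof (induction rule: borel_measurable_induct)
  let ?w = "\<lambda>t::real. ennreal (t powr (- 1 - \<alpha>) * exp (- (t powr p)))"
  have inner: "(\<lambda>x. \<integral>\<^sup>+t\<in>{0<..}. (f (t *\<^sub>R x) * ?w t) \<partial>lborel) \<in> borel_measurable R"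
    if f [measurable]: "f \<in> borel_measurable borel" for f :: "'a \<Rightarrow> ennreal"
  proof -
    have "(\<lambda>(x, t). f (t *\<^sub>R x) * ?w t * indicator {0<..} t) \<in> borel_measurable (borel \<Otimes>\<^sub>M lborel)"
      by measurable
    then have "(\<lambda>x. \<integral>\<^sup>+t\<in>{0<..}. (f (t *\<^sub>R x) * ?w t) \<partial>lborel) \<in> borel_measurable borel"
      by (rule lborel.borel_measurable_nn_integral)
    then show ?thesis
      by (simp only: measurable_cong_sets [OF R refl])
  qed
  {
    case (cong f g)
    then show ?case by simp
  next
    case (set A)
    then show ?case
      by (simp add: emeasure_TS_levy_measure [OF R])
  next
    case (mult f c)
    note [measurable] = mult.hyps(2)
    have "(\<integral>\<^sup>+x. c * f x \<partial>TS_levy_measure p \<alpha> R) = c * (\<integral>\<^sup>+x. f x \<partial>TS_levy_measure p \<alpha> R)"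
      by (rule nn_integral_cmult) measurable
    also have "\<dots> = (\<integral>\<^sup>+x. c * (\<integral>\<^sup>+t\<in>{0<..}. (f (t *\<^sub>R x) * ?w t) \<partial>lborel) \<partial>R)"
      unfolding mult.IH by (rule nn_integral_cmult [OF inner [OF mult.hyps(2)], symmetric])
    also have "\<dots> = (\<integral>\<^sup>+x. (\<integral>\<^sup>+t\<in>{0<..}. (c * f (t *\<^sub>R x) * ?w t) \<partial>lborel) \<partial>R)"
      by (intro nn_integral_cong) (subst nn_integral_cmult [symmetric], measurable, simp add: mult.assoc)
    finally show ?case .
  next
    case (add u v)
    note [measurable] = add.hyps(1,3)
    have "(\<integral>\<^sup>+x. v x + u x \<partial>TS_levy_measure p \<alpha> R)
        = (\<integral>\<^sup>+x. v x \<partial>TS_levy_measure p \<alpha> R) + (\<integral>\<^sup>+x. u x \<partial>TS_levy_measure p \<alpha> R)"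
      by (rule nn_integral_add) measurable
    also have "\<dots> = (\<integral>\<^sup>+x. (\<integral>\<^sup>+t\<in>{0<..}. (v (t *\<^sub>R x) * ?w t) \<partial>lborel) + (\<integral>\<^sup>+t\<in>{0<..}. (u (t *\<^sub>R x) * ?w t) \<partial>lborel) \<partial>R)"
      unfolding add.IH by (rule nn_integral_add [OF inner [OF add.hyps(3)] inner [OF add.hyps(1)], symmetric])
    also have "\<dots> = (\<integral>\<^sup>+x. (\<integral>\<^sup>+t\<in>{0<..}. ((v (t *\<^sub>R x) + u (t *\<^sub>R x)) * ?w t) \<partial>lborel) \<partial>R)"
      by (intro nn_integral_cong) (subst nn_integral_add [symmetric], measurable, simp add: distrib_right)
    finally show ?case .
  next
    case (seq U)
    note [measurable] = seq.hyps(1)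
    have inc: "incseq U" by (rule seq.hyps)
    have "(\<integral>\<^sup>+x. (SUP i. U i) x \<partial>TS_levy_measure p \<alpha> R) = (\<integral>\<^sup>+x. (SUP i. U i x) \<partial>TS_levy_measure p \<alpha> R)"
      by (simp add: image_comp)
    also have "\<dots> = (SUP i. \<integral>\<^sup>+x. U i x \<partial>TS_levy_measure p \<alpha> R)"
      by (rule nn_integral_monotone_convergence_SUP [OF inc]) measurable
    also have "\<dots> = (SUP i. \<integral>\<^sup>+x. (\<integral>\<^sup>+t\<in>{0<..}. (U i (t *\<^sub>R x) * ?w t) \<partial>lborel) \<partial>R)"
      using seq.IH by simp
    also have "\<dots> = (\<integral>\<^sup>+x. (SUP i. \<integral>\<^sup>+t\<in>{0<..}. (U i (t *\<^sub>R x) * ?w t) \<partial>lborel) \<partial>R)"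
      using inc
      by (intro nn_integral_monotone_convergence_SUP [symmetric] inner seq.hyps)
         (auto simp: incseq_def le_fun_def intro!: nn_integral_mono mult_right_mono)
    also have "\<dots> = (\<integral>\<^sup>+x. (\<integral>\<^sup>+t\<in>{0<..}. ((SUP i. U i) (t *\<^sub>R x) * ?w t) \<partial>lborel) \<partial>R)"
    proof (intro nn_integral_cong)
      fix x
      have "(SUP i. \<integral>\<^sup>+t\<in>{0<..}. (U i (t *\<^sub>R x) * ?w t) \<partial>lborel)
          = (\<integral>\<^sup>+t. (SUP i. U i (t *\<^sub>R x) * ?w t * indicator {0<..} t) \<partial>lborel)"
        using inc
        by (intro nn_integral_monotone_convergence_SUP [symmetric])
           (auto simp: incseq_def le_fun_def intro!: mult_right_mono)
      also have "\<dots> = (\<integral>\<^sup>+t\<in>{0<..}. ((SUP i. U i) (t *\<^sub>R x) * ?w t) \<partial>lborel)"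
        by (simp add: image_comp SUP_mult_right_ennreal)
      finally show "(SUP i. \<integral>\<^sup>+t\<in>{0<..}. (U i (t *\<^sub>R x) * ?w t) \<partial>lborel)
          = (\<integral>\<^sup>+t\<in>{0<..}. ((SUP i. U i) (t *\<^sub>R x) * ?w t) \<partial>lborel)" .
    qed
    finally show ?case .
  }
qed

text \<open>Every nonzero point of \<open>R\<close> spreads positive mass over all of its ray.\<close>

lemma TS_levy_measure_unbounded:
  fixes R :: "'a::euclidean_space measure"
  assumes R: "rosinski_measure \<alpha> R" and nz: "R \<noteq> null_measure borel"
  shows "emeasure (TS_levy_measure p \<alpha> R) {x. r < norm x} \<noteq> 0"
proof
  assume zero: "emeasure (TS_levy_measure p \<alpha> R) {x. r < norm x} = 0"
  let ?w = "\<lambda>t::real. ennreal (t powr (- 1 - \<alpha>) * exp (- (t powr p)))"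
  let ?I = "\<lambda>x. \<integral>\<^sup>+t\<in>{0<..}. (indicator {x. r < norm x} (t *\<^sub>R x) * ?w t) \<partial>lborel"
  have sets_R [measurable_cong]: "sets R = sets borel" and R0: "emeasure R {0} = 0"
    using R by (simp_all add: rosinski_measure_def)
  have "(\<lambda>(x::'a, t). indicator {x. r < norm x} (t *\<^sub>R x) * ?w t * indicator {0<..} t) \<in> borel_measurable (R \<Otimes>\<^sub>M lborel)"
    by measurable
  then have meas: "?I \<in> borel_measurable R"
    by (rule lborel.borel_measurable_nn_integral)
  have "(\<integral>\<^sup>+x. ?I x \<partial>R) = 0"
    using zero by (simp add: emeasure_TS_levy_measure [OF sets_R])
  then have "AE x in R. ?I x = 0"
    using meas by (subst (asm) nn_integral_0_iff_AE) auto
  moreover have "AE x in R. x \<noteq> 0"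
    using R0 by (intro AE_I [where N = "{0}"]) (auto simp: sets_R)
  ultimately have "AE x in R. False"
  proof eventually_elim
    case (elim x)
    define c where "c = max 0 (r / norm x)"
    have "AE t in lborel. indicator {x. r < norm x} (t *\<^sub>R x) * ?w t * indicator {0<..} t = 0"
      using elim(1) by (subst (asm) nn_integral_0_iff_AE) auto
    then have "AE t in lborel. t \<notin> {c<..<c + 1}"
    proof eventually_elim
      case (elim t)
      show ?case
      proof
        assume "t \<in> {c<..<c + 1}"
        then have t: "t > 0" "r / norm x < t" by (auto simp: c_def)
        then have "r < norm (t *\<^sub>R x)"
          using \<open>x \<noteq> 0\<close> by (simp add: field_simps)
        with t elim show False by (simp add: indicator_def ennreal_eq_0_iff mult_le_0_iff not_le)
      qed
    qed
    then have "{c<..<c + 1} \<in> null_sets lborel"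
      by (subst AE_iff_null_sets) auto
    then have "emeasure lborel {c<..<c + 1} = 0"
      by (rule null_setsD1)
    then show ?case
      by (subst (asm) emeasure_lborel_Ioo) auto
  qed
  then have "emeasure R (space R) = 0"
    by (subst (asm) AE_iff_measurable [of "space R"]) auto
  then have "R = null_measure borel"
    using emeasure_mono [OF sets.sets_into_space sets.top, of _ R]
    by (intro measure_eqI) (auto simp: sets_R)
  with nz show False by simp
qed

text \<open>This is \<open>y \<le> exp y\<close> at \<open>y = \<delta> x / \<gamma>\<close>, raised to the power \<open>\<gamma>\<close>.\<close>

lemma powr_mult_exp_minus_le:
  fixes x \<gamma> \<delta> :: real
  assumes "x \<ge> 0" "\<gamma> > 0" "\<delta> > 0"
  shows "x powr \<gamma> * exp (- (\<delta> * x)) \<le> (\<gamma> / \<delta>) powr \<gamma>"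
proof -
  let ?y = "\<delta> * x / \<gamma>"
  have "?y powr \<gamma> \<le> exp ?y powr \<gamma>"
  proof (rule powr_mono2)
    show "?y \<le> exp ?y" using exp_ge_add_one_self [of ?y] by linarith
  qed (use assms in auto)
  also have "\<dots> = exp (\<delta> * x)"
    using assms by (simp add: exp_powr_real)
  finally have "?y powr \<gamma> * exp (- (\<delta> * x)) \<le> 1"
    by (simp add: exp_minus field_simps)
  then have "(\<gamma> / \<delta>) powr \<gamma> * (?y powr \<gamma> * exp (- (\<delta> * x))) \<le> (\<gamma> / \<delta>) powr \<gamma> * 1"
    by (intro mult_left_mono) auto
  moreover have "(\<gamma> / \<delta>) powr \<gamma> * ?y powr \<gamma> = x powr \<gamma>"
    using assms by (simp flip: powr_mult)
  ultimately show ?thesis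
    by (simp add: mult.assoc [symmetric])
qed

text \<open>Where \<open>B t^p\<close> does not already dominate \<open>|A| t^q\<close>, the variable is at most \<open>(|A| / B)^{1/(p-q)}\<close>.\<close>

lemma powr_difference_bounded:
  fixes A B p q t :: real
  assumes "0 < q" "q < p" "B > 0" "t > 0"
  shows "A * t powr q - B * t powr p \<le> \<bar>A\<bar> * (\<bar>A\<bar> / B) powr (q / (p - q))"
proof (cases "\<bar>A\<bar> \<le> B * t powr (p - q)")
  case True
  have "A * t powr q \<le> (B * t powr (p - q)) * t powr q"
    using True by (intro mult_right_mono) auto
  also have "\<dots> = B * t powr p"
    by (simp flip: powr_add)
  finally show ?thesis
    using assms by (smt (verit) mult_nonneg_nonneg powr_ge_zero)
next
  case False
  then have "t powr (p - q) \<le> \<bar>A\<bar> / B"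
    using assms by (simp add: field_simps)
  then have "(t powr (p - q)) powr (q / (p - q)) \<le> (\<bar>A\<bar> / B) powr (q / (p - q))"
    using assms by (intro powr_mono2) auto
  then have "t powr q \<le> (\<bar>A\<bar> / B) powr (q / (p - q))"
    using assms by (simp add: powr_powr)
  then have "\<bar>A\<bar> * t powr q \<le> \<bar>A\<bar> * (\<bar>A\<bar> / B) powr (q / (p - q))"
    by (intro mult_left_mono) auto
  moreover have "A * t powr q \<le> \<bar>A\<bar> * t powr q"
    by (intro mult_right_mono) auto
  moreover have "0 \<le> B * t powr p" using assms by simp
  ultimately show ?thesis by linarith
qed

text \<open>Half of the decay \<open>exp (- B t^p)\<close> absorbs the term \<open>A t^q\<close>, and the other half absorbs the power \<open>t^{\<beta>+2}\<close>;
  what remains is a multiple of the integrable \<open>t^{-2}\<close>.\<close>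

lemma nn_integral_stretched_exponential_finite:
  fixes A B p q a \<beta> :: real
  assumes pq: "0 < q" "q < p" and B: "B > 0" and a: "a > 0"
  shows "(\<integral>\<^sup>+t\<in>{a<..}. ennreal (t powr \<beta> * exp (A * t powr q - B * t powr p)) \<partial>lborel) < \<infinity>"
proof -
  define \<gamma> where "\<gamma> = \<bar>\<beta> + 2\<bar> / p + 1"
  define K1 where "K1 = a powr (\<beta> + 2 - p * \<gamma>)"
  define K2 where "K2 = (\<gamma> / (B / 2)) powr \<gamma>"
  define K3 where "K3 = exp (\<bar>A\<bar> * (\<bar>A\<bar> / (B / 2)) powr (q / (p - q)))"
  have \<gamma>: "\<gamma> > 0" unfolding \<gamma>_def using pq by (intro add_nonneg_pos) auto
  have p\<gamma>: "\<beta> + 2 - p * \<gamma> \<le> 0" using pq by (simp add: \<gamma>_def distrib_left)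
  have K: "K1 \<ge> 0" "K2 \<ge> 0" "K3 \<ge> 0" by (simp_all add: K1_def K2_def K3_def)
  have bound: "t powr \<beta> * exp (A * t powr q - B * t powr p) \<le> K1 * K2 * K3 * t powr (- 2)" if t: "t \<ge> a" for t
  proof -
    have t0: "t > 0" using t a by simp
    have "t powr (\<beta> + 2) = t powr (\<beta> + 2 - p * \<gamma>) * (t powr p) powr \<gamma>"
      by (simp add: powr_powr flip: powr_add)
    also have "\<dots> \<le> K1 * (t powr p) powr \<gamma>"
      unfolding K1_def using t a p\<gamma> by (intro mult_right_mono powr_mono2') auto
    finally have 1: "t powr (\<beta> + 2) \<le> K1 * (t powr p) powr \<gamma>" .
    have 2: "(t powr p) powr \<gamma> * exp (- (B / 2 * t powr p)) \<le> K2"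
      unfolding K2_def using B \<gamma> by (intro powr_mult_exp_minus_le) auto
    have 3: "exp (A * t powr q - B / 2 * t powr p) \<le> K3"
      unfolding K3_def using powr_difference_bounded [OF pq _ t0, of "B / 2" A] B by simp
    have "t powr \<beta> * exp (A * t powr q - B * t powr p)
        = (t powr (\<beta> + 2) * exp (- (B / 2 * t powr p)) * exp (A * t powr q - B / 2 * t powr p)) * t powr (- 2)"
    proof -
      have "exp (A * t powr q - B * t powr p) = exp (- (B / 2 * t powr p)) * exp (A * t powr q - B / 2 * t powr p)"
        by (simp flip: exp_add)
      moreover have "t powr \<beta> = t powr (\<beta> + 2) * t powr (- 2)"
        by (simp flip: powr_add)
      ultimately show ?thesis by simp
    qed
    also have "\<dots> \<le> (K1 * K2 * K3) * t powr (- 2)"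
    proof (rule mult_right_mono)
      have "t powr (\<beta> + 2) * exp (- (B / 2 * t powr p)) \<le> (K1 * (t powr p) powr \<gamma>) * exp (- (B / 2 * t powr p))"
        using 1 by (intro mult_right_mono) auto
      also have "\<dots> \<le> K1 * K2"
        using mult_left_mono [OF 2 K(1)] by (simp add: mult.assoc)
      finally show "t powr (\<beta> + 2) * exp (- (B / 2 * t powr p)) * exp (A * t powr q - B / 2 * t powr p) \<le> K1 * K2 * K3"
        using K by (intro mult_mono [OF _ 3]) auto
    qed simp
    finally show ?thesis by simp
  qed
  have "(\<integral>\<^sup>+t\<in>{a<..}. ennreal (t powr \<beta> * exp (A * t powr q - B * t powr p)) \<partial>lborel)
      \<le> (\<integral>\<^sup>+t\<in>{a..}. ennreal (K1 * K2 * K3 * t powr (- 2)) \<partial>lborel)"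
    using bound by (intro nn_integral_mono) (auto simp: indicator_def intro!: ennreal_leI)
  also have "\<dots> = ennreal (0 - (- (K1 * K2 * K3) * a powr (- 1)))"
  proof (rule nn_integral_FTC_atLeast)
    fix t assume "a \<le> t"
    then have t: "t > 0" using a by simp
    show "((\<lambda>t. - (K1 * K2 * K3) * t powr (- 1)) has_real_derivative K1 * K2 * K3 * t powr (- 2)) (at t)"
      using DERIV_cmult [OF has_real_derivative_powr [OF t, of "- 1"], of "- (K1 * K2 * K3)"] by simp
    show "0 \<le> K1 * K2 * K3 * t powr (- 2)" using K by simp
  next
    have "((\<lambda>t::real. t powr (- 1)) \<longlongrightarrow> 0) at_top"
      by (rule tendsto_neg_powr) (auto simp: filterlim_ident)
    from tendsto_mult_right_zero [OF this]
    show "((\<lambda>t. - (K1 * K2 * K3) * t powr (- 1)) \<longlongrightarrow> 0) at_top" .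
  qed measurable
  also have "\<dots> < \<infinity>" by simp
  finally show ?thesis .
qed

section \<open>Exponential moments of tempered stable laws\<close>

text \<open>The contribution of the ray through a point of norm \<open>r\<close> to the integral of \<open>exp (\<theta> |x|^q)\<close> over \<open>|x| > 1\<close>
  with respect to the tempered stable Levy measure.\<close>

definition tempered_tail_moment :: "real \<Rightarrow> real \<Rightarrow> real \<Rightarrow> real \<Rightarrow> real \<Rightarrow> ennreal" where
  "tempered_tail_moment p \<alpha> q \<theta> r = (\<integral>\<^sup>+t\<in>{t. 0 < t \<and> 1 < t * r}.
     ennreal (exp (\<theta> * (t * r) powr q) * (t powr (- 1 - \<alpha>) * exp (- (t powr p)))) \<partial>lborel)"

text \<open>Since \<open>1 < t r\<close> on the domain of integration, a factor \<open>(t r)^2\<close> may be inserted, which yields the quadratic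
  behaviour in \<open>r\<close> that a Rosinski measure controls near 0.\<close>

lemma tempered_tail_moment_small:
  assumes pq: "0 < q" "q < p" and "\<theta> > 0"
  shows "\<exists>J<\<infinity>. \<forall>r. 0 \<le> r \<longrightarrow> r \<le> 1 \<longrightarrow> tempered_tail_moment p \<alpha> q \<theta> r \<le> J * ennreal (r\<^sup>2)"
proof -
  define J where "J = (\<integral>\<^sup>+t\<in>{1<..}. ennreal (t powr (1 - \<alpha>) * exp (\<theta> * t powr q - 1 * t powr p)) \<partial>lborel)"
  have "J < \<infinity>"
    unfolding J_def by (rule nn_integral_stretched_exponential_finite [OF pq]) auto
  moreover have "tempered_tail_moment p \<alpha> q \<theta> r \<le> J * ennreal (r\<^sup>2)" if r: "0 \<le> r" "r \<le> 1" for r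
  proof -
    have "tempered_tail_moment p \<alpha> q \<theta> r
        \<le> (\<integral>\<^sup>+t. ennreal (t powr (1 - \<alpha>) * exp (\<theta> * t powr q - 1 * t powr p)) * indicator {1<..} t * ennreal (r\<^sup>2) \<partial>lborel)"
      unfolding tempered_tail_moment_def
    proof (intro nn_integral_mono)
      fix t :: real
      show "ennreal (exp (\<theta> * (t * r) powr q) * (t powr (- 1 - \<alpha>) * exp (- (t powr p)))) * indicator {t. 0 < t \<and> 1 < t * r} t
          \<le> ennreal (t powr (1 - \<alpha>) * exp (\<theta> * t powr q - 1 * t powr p)) * indicator {1<..} t * ennreal (r\<^sup>2)"
      proof (cases "0 < t \<and> 1 < t * r")
        case True
        have tr: "t * r \<le> t" using True r by (simp add: mult_left_le)
        then have t1: "t > 1" using True by linarith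
        have "t powr (1 - \<alpha>) * r\<^sup>2 = t powr (- 1 - \<alpha>) * (t powr 2 * r\<^sup>2)"
          by (simp add: mult.assoc [symmetric] flip: powr_add)
        also have "t powr 2 * r\<^sup>2 = (t * r)\<^sup>2"
          using t1 by (simp add: power_mult_distrib)
        finally have eq: "t powr (1 - \<alpha>) * r\<^sup>2 = t powr (- 1 - \<alpha>) * (t * r)\<^sup>2" .
        have "1 \<le> (t * r)\<^sup>2" using True by (simp add: one_le_power)
        then have 1: "t powr (- 1 - \<alpha>) \<le> t powr (1 - \<alpha>) * r\<^sup>2"
          unfolding eq using mult_left_mono [of 1 "(t * r)\<^sup>2" "t powr (- 1 - \<alpha>)"] by simp
        have "(t * r) powr q \<le> t powr q"
          using tr True pq by (intro powr_mono2) auto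
        then have 2: "exp (\<theta> * (t * r) powr q) \<le> exp (\<theta> * t powr q)"
          using \<open>\<theta> > 0\<close> by simp
        have "exp (\<theta> * (t * r) powr q) * (t powr (- 1 - \<alpha>) * exp (- (t powr p)))
            \<le> exp (\<theta> * t powr q) * ((t powr (1 - \<alpha>) * r\<^sup>2) * exp (- (t powr p)))"
          by (intro mult_mono 1 2) auto
        also have "\<dots> = (t powr (1 - \<alpha>) * exp (\<theta> * t powr q - 1 * t powr p)) * r\<^sup>2"
          by (simp add: exp_diff exp_minus field_simps)
        finally show ?thesis
          using True t1 by (simp add: ennreal_leI flip: ennreal_mult)
      qed simp
    qed
    also have "\<dots> = J * ennreal (r\<^sup>2)"
      unfolding J_def by (rule nn_integral_multc) measurable
    finally show ?thesis .
  qed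
  ultimately show ?thesis by blast
qed

text \<open>The gap between the maximum of \<open>(p/q) s^q - s^p\<close>, attained at 1, and its value at \<open>s\<close>. Its sign is the weighted
  arithmetic-geometric mean inequality for \<open>s^p\<close> and 1.\<close>

lemma powr_tangent_gap_nonneg:
  fixes p q s :: real
  assumes "0 < q" "q < p" "s > 0"
  shows "0 \<le> s powr p - p / q * s powr q + (p / q - 1)"
proof -
  have "(s powr p) powr (q / p) * 1 powr (1 - q / p) \<le> q / p * s powr p + (1 - q / p) * 1"
    using assms by (intro Youngs_inequality_0) auto
  then have "s powr q \<le> q / p * s powr p + (1 - q / p)"
    using assms by (simp add: powr_powr)
  then have "p / q * s powr q \<le> p / q * (q / p * s powr p + (1 - q / p))"
    using assms by (intro mult_left_mono) auto
  also have "\<dots> = s powr p + (p / q - 1)"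
    using assms by (simp add: field_simps)
  finally show ?thesis by linarith
qed

text \<open>The gap decreases on \<open>(0, 1)\<close>. It is positive at \<open>1/2\<close> because it is nonnegative at \<open>3/4\<close>; stopping
  short of 1 keeps its derivative strictly negative.\<close>

lemma powr_tangent_gap_away_from_one:
  fixes p q :: real
  assumes pq: "0 < q" "q < p"
  shows "\<exists>\<delta>>0. \<forall>s. 0 < s \<longrightarrow> s \<le> 1 / 2 \<longrightarrow> \<delta> \<le> s powr p - p / q * s powr q + (p / q - 1)"
proof -
  define \<psi> where "\<psi> s = s powr p - p / q * s powr q + (p / q - 1)" for s :: real
  have dec: "\<psi> y < \<psi> x" if "0 < x" "x < y" "y < 1" for x y
  proof (rule DERIV_neg_imp_decreasing [OF that(2)])
    fix s assume "x \<le> s" "s \<le> y"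
    then have s: "0 < s" "s < 1" using that by auto
    have "(\<psi> has_real_derivative p * s powr (p - 1) - p / q * (q * s powr (q - 1)) + 0) (at s)"
      unfolding \<psi>_def
      by (intro DERIV_add DERIV_diff DERIV_cmult has_real_derivative_powr DERIV_const s)
    moreover have "p * s powr (p - 1) - p / q * (q * s powr (q - 1)) + 0 < 0"
    proof -
      have "s powr (p - 1) < s powr (q - 1)"
        using s pq by (intro powr_less_mono') auto
      then show ?thesis using pq by simp
    qed
    ultimately show "\<exists>y. (\<psi> has_real_derivative y) (at s) \<and> y < 0" by blast
  qed
  have "0 \<le> \<psi> (3 / 4)"
    unfolding \<psi>_def using pq by (intro powr_tangent_gap_nonneg) auto
  also have "\<dots> < \<psi> (1 / 2)" by (rule dec) auto
  finally have "\<psi> (1 / 2) > 0" .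
  moreover have "\<psi> (1 / 2) \<le> \<psi> s" if "0 < s" "s \<le> 1 / 2" for s
  proof (cases "s = 1 / 2")
    case False
    then show ?thesis using dec [of s "1 / 2"] that by (intro less_imp_le) auto
  qed (simp only: order_refl)
  ultimately show ?thesis
    unfolding \<psi>_def by blast
qed

text \<open>Laplace's method, up to constants. After the substitution \<open>t = \<tau> s\<close>, with \<open>\<tau>\<close> the point where the exponent is
  maximal, the exponent becomes \<open>T (\<kappa> - 1) - T \<psi>(s)\<close> with \<open>\<kappa> = p/q\<close>, \<open>T = \<tau>^p\<close> and \<open>\<psi>\<close> the gap above. For
  \<open>r > 1\<close> the parameter \<open>T\<close> stays above a positive constant \<open>T0\<close>, so \<open>exp (- T \<psi>(s))\<close> is bounded by an integrable
  function of \<open>s\<close> on \<open>s > 1/2\<close>. For \<open>s \<le> 1/2\<close> the singularity of \<open>s^{-1-\<alpha>}\<close> at 0 is cut off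
  at \<open>s > 1/(\<tau> r)\<close>, and the resulting power of \<open>T\<close> is beaten by \<open>exp (- \<delta> T)\<close>.\<close>

lemma tempered_tail_moment_large:
  assumes \<alpha>: "\<alpha> < 2" and pq: "0 < q" "q < p" and \<theta>: "\<theta> > 0"
  shows "\<exists>C<\<infinity>. \<forall>r>1. tempered_tail_moment p \<alpha> q \<theta> r
    \<le> C * ennreal (exp (A_const p q * (\<theta> * r powr q) powr (p / (p - q))) * r powr (- (\<alpha> * q / (p - q))))"
proof -
  define \<kappa> where "\<kappa> = p / q"
  define \<psi> where "\<psi> s = s powr p - \<kappa> * s powr q + (\<kappa> - 1)" for s
  define c0 where "c0 = (\<theta> / \<kappa>) powr (1 / (p - q))"
  define T0 where "T0 = c0 powr p"
  have \<kappa>: "\<kappa> > 1" using pq by (simp add: \<kappa>_def)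
  have c0: "c0 > 0" using \<theta> \<kappa> by (simp add: c0_def)
  have T0: "T0 > 0" using c0 by (simp add: T0_def)
  have \<psi>_nonneg: "0 \<le> \<psi> s" if "s > 0" for s
    using powr_tangent_gap_nonneg [OF pq that] by (simp add: \<psi>_def \<kappa>_def)
  obtain \<delta> where \<delta>: "\<delta> > 0" "\<And>s. 0 < s \<Longrightarrow> s \<le> 1 / 2 \<Longrightarrow> \<delta> \<le> \<psi> s"
    using powr_tangent_gap_away_from_one [OF pq] unfolding \<psi>_def \<kappa>_def by blast
  define C1 where "C1 = c0 powr (3 - 3 * p / q) * ((3 / q) / \<delta>) powr (3 / q)"
  define J where "J = (\<integral>\<^sup>+s\<in>{1/2<..}. ennreal (s powr (- 1 - \<alpha>) * exp (T0 * \<kappa> * s powr q - T0 * s powr p)) \<partial>lborel)"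
  define C where "C = ennreal (c0 powr (- \<alpha>)) * (ennreal (C1 / 2) + ennreal (exp (- (T0 * (\<kappa> - 1)))) * J)"
  have C1: "C1 \<ge> 0" by (simp add: C1_def)
  have "J < \<infinity>"
    unfolding J_def by (rule nn_integral_stretched_exponential_finite [OF pq T0]) simp
  then have "C < \<infinity>"
    by (simp add: C_def ennreal_mult_less_top)
  moreover have "tempered_tail_moment p \<alpha> q \<theta> r
    \<le> C * ennreal (exp (A_const p q * (\<theta> * r powr q) powr (p / (p - q))) * r powr (- (\<alpha> * q / (p - q))))"
    if r: "r > 1" for r
  proof -
    define \<tau> where "\<tau> = c0 * r powr (q / (p - q))"
    define T where "T = \<tau> powr p"
    have \<tau>: "\<tau> > 0" using c0 r by (simp add: \<tau>_def)
    have T: "T > 0" using \<tau> by (simp add: T_def)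
    have T_ge: "T0 \<le> T"
    proof -
      have "1 \<le> r powr (q / (p - q))"
        using r pq by (intro ge_one_powr_ge_zero) auto
      then have "c0 \<le> \<tau>" using c0 by (simp add: \<tau>_def)
      then show ?thesis unfolding T0_def T_def using c0 pq by (intro powr_mono2) auto
    qed
    have \<theta>r: "\<theta> * r powr q = \<kappa> * \<tau> powr (p - q)"
      using \<theta> \<kappa> r pq by (simp add: \<tau>_def c0_def powr_mult powr_powr)
    have \<tau>r3: "(\<tau> * r) powr 3 = c0 powr (3 - 3 * p / q) * T powr (3 / q)"
    proof -
      have "\<tau> * r = c0 * r powr (q / (p - q) + 1)"
        using r by (simp add: \<tau>_def powr_add)
      also have "q / (p - q) + 1 = p / (p - q)"
        using pq by (simp add: field_simps)
      finally have "(\<tau> * r) powr 3 = c0 powr 3 * r powr (p / (p - q) * 3)"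
        using c0 by (simp add: powr_mult powr_powr)
      moreover have "T powr (3 / q) = c0 powr (3 * p / q) * r powr (p / (p - q) * 3)"
        using c0 pq by (simp add: T_def \<tau>_def powr_mult powr_powr field_simps)
      moreover have "c0 powr (3 - 3 * p / q) * c0 powr (3 * p / q) = c0 powr 3"
        by (simp flip: powr_add)
      ultimately show ?thesis by (simp add: mult.assoc [symmetric])
    qed
    have Aconst: "A_const p q * (\<theta> * r powr q) powr (p / (p - q)) = T * (\<kappa> - 1)"
    proof -
      have "(\<theta> * r powr q) powr (p / (p - q)) = \<kappa> powr (p / (p - q)) * T"
        unfolding \<theta>r using \<kappa> \<tau> pq by (simp add: powr_mult powr_powr T_def)
      moreover have "(q / p) powr (q / (p - q)) = \<kappa> powr (- (q / (p - q)))"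
      proof -
        have "q / p = inverse \<kappa>" using pq by (simp add: \<kappa>_def)
        then show ?thesis using \<kappa> by (simp add: powr_minus inverse_powr)
      qed
      moreover have "\<kappa> powr (- (q / (p - q))) * \<kappa> powr (p / (p - q)) = \<kappa>"
      proof -
        have "p / (p - q) - q / (p - q) = 1"
          using pq by (simp flip: diff_divide_distrib)
        then have "- (q / (p - q)) + p / (p - q) = 1" by simp
        then show ?thesis using \<kappa> by (simp flip: powr_add)
      qed
      moreover have "(1 - q / p) * \<kappa> = \<kappa> - 1"
        using pq by (simp add: \<kappa>_def field_simps)
      ultimately have "A_const p q * (\<theta> * r powr q) powr (p / (p - q))
          = (\<kappa> powr (- (q / (p - q))) * \<kappa> powr (p / (p - q))) * (1 - q / p) * T"
        by (simp add: A_const_def mult_ac)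
      also have "\<dots> = T * (\<kappa> - 1)"
        using \<open>\<kappa> powr (- (q / (p - q))) * \<kappa> powr (p / (p - q)) = \<kappa>\<close> \<open>(1 - q / p) * \<kappa> = \<kappa> - 1\<close>
        by (simp add: mult_ac)
      finally show ?thesis .
    qed
    have pw: "\<tau> powr (- \<alpha>) = c0 powr (- \<alpha>) * r powr (- (\<alpha> * q / (p - q)))"
      using c0 by (simp add: \<tau>_def powr_mult powr_powr mult.commute)
    let ?e = "exp (T * (\<kappa> - 1))"
    let ?g = "\<lambda>s. ennreal C1 * indicator {0..1/2} s + ennreal (exp (- (T0 * (\<kappa> - 1)))) *
      (ennreal (s powr (- 1 - \<alpha>) * exp (T0 * \<kappa> * s powr q - T0 * s powr p)) * indicator {1/2<..} s)"
    have "tempered_tail_moment p \<alpha> q \<theta> r = ennreal \<tau> * (\<integral>\<^sup>+s.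
        ennreal (exp (\<theta> * ((\<tau> * s) * r) powr q) * ((\<tau> * s) powr (- 1 - \<alpha>) * exp (- ((\<tau> * s) powr p))))
          * indicator {t. 0 < t \<and> 1 < t * r} (\<tau> * s) \<partial>lborel)"
      unfolding tempered_tail_moment_def
      using \<tau> by (subst nn_integral_real_affine [where c = \<tau> and t = 0]) auto
    also have "\<dots> \<le> ennreal \<tau> * (\<integral>\<^sup>+s. ennreal (\<tau> powr (- 1 - \<alpha>) * ?e) * ?g s \<partial>lborel)"
    proof (intro mult_left_mono nn_integral_mono)
      fix s :: real
      show "ennreal (exp (\<theta> * ((\<tau> * s) * r) powr q) * ((\<tau> * s) powr (- 1 - \<alpha>) * exp (- ((\<tau> * s) powr p))))
          * indicator {t. 0 < t \<and> 1 < t * r} (\<tau> * s) \<le> ennreal (\<tau> powr (- 1 - \<alpha>) * ?e) * ?g s"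
      proof (cases "0 < \<tau> * s \<and> 1 < (\<tau> * s) * r")
        case True
        then have s: "s > 0" using \<tau> by (simp add: zero_less_mult_iff)
        have "\<theta> * ((\<tau> * s) * r) powr q = (\<theta> * r powr q) * (\<tau> powr q * s powr q)"
          using \<tau> s r by (simp add: powr_mult mult_ac)
        also have "\<dots> = T * \<kappa> * s powr q"
          unfolding \<theta>r T_def by (simp add: mult_ac flip: powr_add)
        finally have "exp (\<theta> * ((\<tau> * s) * r) powr q) * ((\<tau> * s) powr (- 1 - \<alpha>) * exp (- ((\<tau> * s) powr p)))
            = \<tau> powr (- 1 - \<alpha>) * (s powr (- 1 - \<alpha>) * exp (T * \<kappa> * s powr q - T * s powr p))"
          using \<tau> s by (simp add: powr_mult T_def exp_diff exp_minus field_simps)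
        also have "T * \<kappa> * s powr q - T * s powr p = T * (\<kappa> - 1) + - (T * \<psi> s)"
          by (simp add: \<psi>_def algebra_simps)
        finally have eq: "exp (\<theta> * ((\<tau> * s) * r) powr q) * ((\<tau> * s) powr (- 1 - \<alpha>) * exp (- ((\<tau> * s) powr p)))
            = (\<tau> powr (- 1 - \<alpha>) * ?e) * (s powr (- 1 - \<alpha>) * exp (- (T * \<psi> s)))"
          by (simp only: exp_add mult_ac)
        have "ennreal (s powr (- 1 - \<alpha>) * exp (- (T * \<psi> s))) \<le> ?g s"
        proof (cases "s \<le> 1 / 2")
          case small: True
          \<comment> \<open>The exponent 3 exceeds \<open>1 + \<alpha>\<close> for every admissible \<open>\<alpha>\<close>.\<close>
          have "s powr (- 1 - \<alpha>) \<le> s powr (- 3)"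
            using s small \<alpha> by (intro powr_mono') auto
          also have "\<dots> \<le> (1 / (\<tau> * r)) powr (- 3)"
            using True \<tau> r s by (intro powr_mono2') (auto simp: field_simps)
          also have "\<dots> = (\<tau> * r) powr 3"
            using \<tau> r by (simp add: powr_divide powr_minus field_simps)
          finally have "s powr (- 1 - \<alpha>) * exp (- (T * \<psi> s)) \<le> (\<tau> * r) powr 3 * exp (- (\<delta> * T))"
            using \<delta>(2) [OF s small] T by (intro mult_mono) auto
          also have "\<dots> = c0 powr (3 - 3 * p / q) * (T powr (3 / q) * exp (- (\<delta> * T)))"
            by (simp add: \<tau>r3)
          also have "\<dots> \<le> C1"
            unfolding C1_def using T pq \<delta>(1) by (intro mult_left_mono powr_mult_exp_minus_le) auto
          finally show ?thesis
            using small s by (simp add: ennreal_leI)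
        next
          case large: False
          have "s powr (- 1 - \<alpha>) * exp (- (T * \<psi> s)) \<le> s powr (- 1 - \<alpha>) * exp (- (T0 * \<psi> s))"
            using T_ge \<psi>_nonneg [OF s] by (intro mult_left_mono) (auto intro: mult_right_mono)
          also have "- (T0 * \<psi> s) = - (T0 * (\<kappa> - 1)) + (T0 * \<kappa> * s powr q - T0 * s powr p)"
            by (simp add: \<psi>_def algebra_simps)
          finally have "s powr (- 1 - \<alpha>) * exp (- (T * \<psi> s))
              \<le> exp (- (T0 * (\<kappa> - 1))) * (s powr (- 1 - \<alpha>) * exp (T0 * \<kappa> * s powr q - T0 * s powr p))"
            by (simp only: exp_add mult_ac)
          then have "ennreal (s powr (- 1 - \<alpha>) * exp (- (T * \<psi> s)))
              \<le> ennreal (exp (- (T0 * (\<kappa> - 1)))) * ennreal (s powr (- 1 - \<alpha>) * exp (T0 * \<kappa> * s powr q - T0 * s powr p))"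
            by (simp add: ennreal_leI flip: ennreal_mult)
          then show ?thesis
            using large s by simp
        qed
        then have "ennreal (\<tau> powr (- 1 - \<alpha>) * ?e) * ennreal (s powr (- 1 - \<alpha>) * exp (- (T * \<psi> s)))
            \<le> ennreal (\<tau> powr (- 1 - \<alpha>) * ?e) * ?g s"
          by (rule mult_left_mono) simp
        then show ?thesis
          unfolding eq using True by (simp add: ennreal_mult)
      qed simp
    qed simp
    also have "(\<integral>\<^sup>+s. ennreal (\<tau> powr (- 1 - \<alpha>) * ?e) * ?g s \<partial>lborel)
        = ennreal (\<tau> powr (- 1 - \<alpha>) * ?e) * (\<integral>\<^sup>+s. ?g s \<partial>lborel)"
      by (rule nn_integral_cmult) measurable
    also have "(\<integral>\<^sup>+s. ?g s \<partial>lborel)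
        = (\<integral>\<^sup>+s. ennreal C1 * indicator {0..1/2::real} s \<partial>lborel) + (\<integral>\<^sup>+s. ennreal (exp (- (T0 * (\<kappa> - 1)))) *
          (ennreal (s powr (- 1 - \<alpha>) * exp (T0 * \<kappa> * s powr q - T0 * s powr p)) * indicator {1/2<..} s) \<partial>lborel)"
      by (rule nn_integral_add) measurable
    also have "(\<integral>\<^sup>+s. ennreal C1 * indicator {0..1/2::real} s \<partial>lborel) = ennreal C1 * ennreal (1 / 2)"
      by (subst nn_integral_cmult_indicator) simp_all
    also have "\<dots> = ennreal (C1 / 2)"
      using ennreal_mult [OF C1, of "1 / 2"] by simp
    also have "(\<integral>\<^sup>+s. ennreal (exp (- (T0 * (\<kappa> - 1)))) *
          (ennreal (s powr (- 1 - \<alpha>) * exp (T0 * \<kappa> * s powr q - T0 * s powr p)) * indicator {1/2<..} s) \<partial>lborel)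
        = ennreal (exp (- (T0 * (\<kappa> - 1)))) * J"
      unfolding J_def by (rule nn_integral_cmult) measurable
    also have "ennreal \<tau> * (ennreal (\<tau> powr (- 1 - \<alpha>) * ?e) * (ennreal (C1 / 2) + ennreal (exp (- (T0 * (\<kappa> - 1)))) * J))
        = ennreal (\<tau> * (\<tau> powr (- 1 - \<alpha>) * ?e)) * (ennreal (C1 / 2) + ennreal (exp (- (T0 * (\<kappa> - 1)))) * J)"
      using \<tau> by (simp add: ennreal_mult mult.assoc)
    also have "\<tau> * (\<tau> powr (- 1 - \<alpha>) * ?e) = c0 powr (- \<alpha>) * (?e * r powr (- (\<alpha> * q / (p - q))))"
    proof -
      have "\<tau> * \<tau> powr (- 1 - \<alpha>) = \<tau> powr (1 + (- 1 - \<alpha>))"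
        using \<tau> by (subst powr_add) simp
      then have "\<tau> * (\<tau> powr (- 1 - \<alpha>) * ?e) = \<tau> powr (- \<alpha>) * ?e"
        by (simp add: mult.assoc [symmetric])
      then show ?thesis unfolding pw by simp
    qed
    also have "ennreal (c0 powr (- \<alpha>) * (?e * r powr (- (\<alpha> * q / (p - q)))))
          * (ennreal (C1 / 2) + ennreal (exp (- (T0 * (\<kappa> - 1)))) * J)
        = C * ennreal (?e * r powr (- (\<alpha> * q / (p - q))))"
      unfolding C_def by (simp add: ennreal_mult mult_ac)
    finally show ?thesis
      unfolding Aconst .
  qed
  ultimately show ?thesis by blast
qed

text \<open>The Levy integral is the \<open>R\<close>-integral of the contributions of the rays. Points of norm at most 1 are
  controlled by the integrability condition on Rosinski measures, whose weight is \<open>|x|^2\<close> there in all three cases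
  of \<open>\<alpha>\<close>; the other points are controlled by the assumption.\<close>

lemma TS_levy_exponential_tail_finite:
  fixes R :: "'a::euclidean_space measure"
  assumes R: "rosinski_measure \<alpha> R" and \<alpha>: "\<alpha> < 2" and pq: "0 < q" "q < p" and \<theta>: "\<theta> > 0"
    and tail: "(\<integral>\<^sup>+x\<in>{x. norm x > 1}.
               ennreal (exp (A_const p q * (\<theta> * norm x powr q) powr (p / (p - q))) *
                        norm x powr (- (\<alpha> * q / (p - q)))) \<partial>R) < \<infinity>"
  shows "(\<integral>\<^sup>+x\<in>{x. 1 < norm x}. ennreal (exp (\<theta> * norm x powr q)) \<partial>TS_levy_measure p \<alpha> R) < \<infinity>"
proof -
  have sets_R [measurable_cong]: "sets R = sets borel"
    and weight: "(\<integral>\<^sup>+x. ennreal (rosinski_weight \<alpha> (norm x)) \<partial>R) < \<infinity>"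
    using R by (simp_all add: rosinski_measure_def)
  let ?W = "\<lambda>x::'a. ennreal (exp (A_const p q * (\<theta> * norm x powr q) powr (p / (p - q))) * norm x powr (- (\<alpha> * q / (p - q))))"
  obtain J where J: "J < \<infinity>" "\<And>r. 0 \<le> r \<Longrightarrow> r \<le> 1 \<Longrightarrow> tempered_tail_moment p \<alpha> q \<theta> r \<le> J * ennreal (r\<^sup>2)"
    using tempered_tail_moment_small [OF pq \<theta>] by blast
  obtain C where C: "C < \<infinity>" "\<And>x::'a. norm x > 1 \<Longrightarrow> tempered_tail_moment p \<alpha> q \<theta> (norm x) \<le> C * ?W x"
    using tempered_tail_moment_large [OF \<alpha> pq \<theta>] by blast
  have "(\<lambda>x::'a. ennreal (rosinski_weight \<alpha> (norm x))) \<in> borel_measurable R"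
    unfolding rosinski_weight_def by measurable
  note [measurable] = this
  have "(\<integral>\<^sup>+x\<in>{x. 1 < norm x}. ennreal (exp (\<theta> * norm x powr q)) \<partial>TS_levy_measure p \<alpha> R)
      = (\<integral>\<^sup>+x. tempered_tail_moment p \<alpha> q \<theta> (norm x) \<partial>R)"
    unfolding tempered_tail_moment_def
    by (subst nn_integral_TS_levy_measure [OF sets_R])
       (auto intro!: nn_integral_cong simp: indicator_def ennreal_mult)
  also have "\<dots> \<le> (\<integral>\<^sup>+x. J * ennreal (rosinski_weight \<alpha> (norm x)) + C * (?W x * indicator {x. norm x > 1} x) \<partial>R)"
  proof (intro nn_integral_mono)
    fix x :: 'a
    show "tempered_tail_moment p \<alpha> q \<theta> (norm x)
        \<le> J * ennreal (rosinski_weight \<alpha> (norm x)) + C * (?W x * indicator {x. norm x > 1} x)"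
    proof (cases "norm x \<le> 1")
      case True
      have "rosinski_weight \<alpha> (norm x) = (norm x)\<^sup>2"
      proof (cases "x = 0")
        case False
        then have n: "norm x > 0" by simp
        have "norm x powr 2 \<le> norm x powr \<alpha>"
          using True n \<alpha> by (intro powr_mono') auto
        then have 1: "(norm x)\<^sup>2 \<le> norm x powr \<alpha>" using n by simp
        have 2: "(norm x)\<^sup>2 \<le> 1" using True by (simp add: power_le_one)
        have 3: "ln (norm x) \<le> 0" using True n by simp
        show ?thesis using 1 2 3 by (simp add: rosinski_weight_def)
      qed (simp add: rosinski_weight_def)
      then have "tempered_tail_moment p \<alpha> q \<theta> (norm x) \<le> J * ennreal (rosinski_weight \<alpha> (norm x))"
        using J(2) [of "norm x"] True by simp
      then show ?thesis using True by simp
    next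
      case False
      then have "tempered_tail_moment p \<alpha> q \<theta> (norm x) \<le> C * (?W x * indicator {x. norm x > 1} x)"
        using C(2) [of x] by simp
      then show ?thesis by (rule add_increasing [rotated]) simp
    qed
  qed
  also have "\<dots> = J * (\<integral>\<^sup>+x. ennreal (rosinski_weight \<alpha> (norm x)) \<partial>R) + C * (\<integral>\<^sup>+x\<in>{x. norm x > 1}. ?W x \<partial>R)"
    by (subst nn_integral_add, measurable, subst nn_integral_cmult, measurable, subst nn_integral_cmult, measurable)
  also have "\<dots> < \<infinity>"
    using J(1) C(1) weight tail by (simp add: ennreal_mult_less_top)
  finally show ?thesis .
qed

lemma powr_subadditive:
  fixes a b q :: real
  assumes "a \<ge> 0" "b \<ge> 0" "0 < q" "q \<le> 1"
  shows "(a + b) powr q \<le> a powr q + b powr q"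
proof (cases "a + b = 0")
  case False
  then have s: "a + b > 0" using assms by linarith
  have le: "x \<le> x powr q" if "0 \<le> x" "x \<le> 1" for x :: real
    using powr_mono' [of q 1 x] that assms by simp
  have "1 = a / (a + b) + b / (a + b)"
    using s by (simp flip: add_divide_distrib)
  also have "\<dots> \<le> (a / (a + b)) powr q + (b / (a + b)) powr q"
    using assms s by (intro add_mono le) auto
  also have "\<dots> = (a powr q + b powr q) / (a + b) powr q"
    using assms s by (simp add: powr_divide add_divide_distrib)
  finally show ?thesis
    using s by (simp add: field_simps)
qed (use assms in auto)

text \<open>For \<open>q \<le> 1\<close> the power \<open>|x|^q\<close> is subadditive and at most \<open>1 + |x|\<close>, so its exponential is
  submultiplicative of exponential growth.\<close>

lemma TS_exponential_moment_finite:
  fixes R \<mu> :: "'a::euclidean_space measure"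
  assumes TS: "is_TS p \<alpha> R b \<mu>" and \<alpha>: "\<alpha> < 2" and q: "0 < q" "q \<le> 1" "q < p" and \<theta>: "\<theta> > 0"
    and tail: "(\<integral>\<^sup>+x\<in>{x. norm x > 1}.
               ennreal (exp (A_const p q * (\<theta> * norm x powr q) powr (p / (p - q))) *
                        norm x powr (- (\<alpha> * q / (p - q)))) \<partial>R) < \<infinity>"
  shows "(\<integral>\<^sup>+x. ennreal (exp (\<theta> * norm x powr q)) \<partial>\<mu>) < \<infinity>"
proof (rule ID_submultiplicative_moment_finite)
  show "is_ID (TS_levy_measure p \<alpha> R) b \<mu>"
    using TS by (simp add: is_TS_def)
  show "(\<integral>\<^sup>+x\<in>{x. 1 < norm x}. ennreal (exp (\<theta> * norm x powr q)) \<partial>TS_levy_measure p \<alpha> R) < \<infinity>"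
    by (rule TS_levy_exponential_tail_finite [OF _ \<alpha> q(1,3) \<theta> tail]) (use TS in \<open>simp add: is_TS_def\<close>)
  show "exp (\<theta> * norm (x + y) powr q) \<le> exp (\<theta> * norm x powr q) * exp (\<theta> * norm y powr q)" for x y :: 'a
  proof -
    have "norm (x + y) powr q \<le> (norm x + norm y) powr q"
      using q by (intro powr_mono2 norm_triangle_ineq) auto
    also have "\<dots> \<le> norm x powr q + norm y powr q"
      using q by (intro powr_subadditive) auto
    finally have "\<theta> * norm (x + y) powr q \<le> \<theta> * (norm x powr q + norm y powr q)"
      using \<theta> by (intro mult_left_mono) auto
    then show ?thesis by (simp add: distrib_left flip: exp_add)
  qed
  show "exp (\<theta> * norm x powr q) \<le> exp \<theta> * exp (\<theta> * norm x)" for x :: 'a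
  proof -
    have "norm x powr q \<le> (1 + norm x) powr q"
      using q by (intro powr_mono2) auto
    also have "\<dots> \<le> (1 + norm x) powr 1"
      using q by (intro powr_mono) auto
    finally have "\<theta> * norm x powr q \<le> \<theta> * (1 + norm x)"
      using \<theta> by (intro mult_left_mono) auto
    then show ?thesis by (simp add: distrib_left flip: exp_add)
  qed
qed (use \<theta> in auto)

theorem theorem15:
  fixes \<alpha> p :: real and R \<mu> :: "'a::euclidean_space measure" and b :: 'a
  assumes "\<alpha> < 2" and "p > 0" and "is_TS p \<alpha> R b \<mu>"
  shows "(\<forall>q \<theta>. 0 < q \<and> q \<le> 1 \<and> q < p \<and> \<theta> > 0 \<longrightarrow>
            (\<integral>\<^sup>+x\<in>{x. norm x > 1}.
               ennreal (exp (A_const p q * (\<theta> * norm x powr q) powr (p / (p - q))) *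
                        norm x powr (- (\<alpha> * q / (p - q)))) \<partial>R) < \<infinity> \<longrightarrow>
            (\<integral>\<^sup>+x. ennreal (exp (\<theta> * norm x powr q)) \<partial>\<mu>) < \<infinity>) \<and>
         (R \<noteq> null_measure borel \<longrightarrow>
            (\<forall>\<theta>>0. (\<integral>\<^sup>+x. ennreal (exp (\<theta> * (norm x * ln (norm x)))) \<partial>\<mu>) = \<infinity>))"
proof (intro conjI allI impI)
  fix q \<theta> :: real
  assume "0 < q \<and> q \<le> 1 \<and> q < p \<and> \<theta> > 0"
    and "(\<integral>\<^sup>+x\<in>{x. norm x > 1}.
           ennreal (exp (A_const p q * (\<theta> * norm x powr q) powr (p / (p - q))) *
                    norm x powr (- (\<alpha> * q / (p - q)))) \<partial>R) < \<infinity>"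
  then show "(\<integral>\<^sup>+x. ennreal (exp (\<theta> * norm x powr q)) \<partial>\<mu>) < \<infinity>"
    using TS_exponential_moment_finite [OF assms(3,1)] by blast
next
  fix \<theta> :: real
  assume R: "R \<noteq> null_measure borel" and "\<theta> > 0"
  have ID: "is_ID (TS_levy_measure p \<alpha> R) b \<mu>" and ros: "rosinski_measure \<alpha> R"
    using assms(3) by (simp_all add: is_TS_def)
  show "(\<integral>\<^sup>+x. ennreal (exp (\<theta> * (norm x * ln (norm x)))) \<partial>\<mu>) = \<infinity>"
    by (rule ID_norm_log_moment_infinite [OF ID TS_levy_measure_unbounded [OF ros R] \<open>\<theta> > 0\<close>])
qed

end
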